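(* Let $\mathcal{H}$ be a Hilbert space, $\mathcal{B}$ a von Neumann algebra, $T:B(\mathcal{H})\otimes\mathcal{B}\to B(\mathcal{H})$ a CP-map, and let $A\in B(\mathcal{H})$ and $B\in\mathcal{B}$ be Hermitean. Suppose that $A$ has an orthonormal basis of eigenvectors $\psi_i$ with eigenvalues $a_i$. For $i,j$ with $a_i\ne a_j$ and $\alpha,\beta\in\mathbb{C}$ with $|\alpha|^2+|\beta|^2=1$ define the states $$\rho_{\mathrm{coh}}:=|\alpha\psi_i+\beta\psi_j\rangle\langle\alpha\psi_i+\beta\psi_j|,\qquad\rho_{\mathrm{inc}}:=|\alpha|^2|\psi_i\rangle\langle\psi_i|+|\beta|^2|\psi_j\rangle\langle\psi_j|.$$ Suppose that $T$ is nondestructive, i.e. $R^*(|\psi_i\rangle\langle\psi_i|)=|\psi_i\rangle\langle\psi_i|$ for all $\psi_i$, where $R(X):=T(X\otimes\mathbf 1)$. If the measurement infidelity $\delta:=\sup_S\|T(\mathbf 1\otimes\mathbf 1_S(B))-\mathbf 1_S(A)\|$ (supremum over Borel sets $S\subset\mathbb{R}$) satisfies $\delta\in[0,\frac12]$, then $$d\bigl(R^*(\rho_{\mathrm{coh}}),\rho_{\mathrm{inc}}\bigr)\le\sqrt{\delta(1-\delta)}.$$ This bound is sharp in the sense that for all $\delta\in[0,\frac12]$ there exists a CP-map $T:B(\mathcal{H})\otimes\mathcal{B}\to B(\mathcal{H})$ (for some Hilbert space $\mathcal{H}$ and von Neumann algebra $\mathcal{B}$), together with Hermitean $A\in B(\mathcal{H})$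 and $B\in\mathcal{B}$, an orthonormal basis of eigenvectors $\psi_i$ of $A$ with eigenvalues $a_i$ for which $T$ is nondestructive, indices $i,j$ with $a_i\ne a_j$, and $\alpha,\beta\in\mathbb{C}$ with $|\alpha|^2+|\beta|^2=1$, such that the measurement infidelity $\sup_S\|T(\mathbf 1\otimes\mathbf 1_S(B))-\mathbf 1_S(A)\|$ equals the given value $\delta$, for which equality is attained.
   Context: A CP-map between von Neumann algebras is a linear, unital, completely positive map that is weakly continuous, in the sense that it pulls back normal states to normal states. $B(\mathcal{H})\otimes\mathcal{B}$ is the von Neumann algebra tensor product. $\mathbf 1_S(X)$ is the spectral projection of the self-adjoint operator $X$ for the Borel set $S$. Density operators $\rho$ are identified with the states $X\mapsto\operatorname{tr}(\rho X)$, and $R^*(\rho):=\rho\circ R$. The trace distance is $d(\rho,\sigma)=\sup_P(\rho(P)-\sigma(P))$, the supremum being over projections $P\in B(\mathcal{H})$. *)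

theory Defs
  imports "HOL-Analysis.Analysis"
begin

section \<open>Complex Hilbert spaces\<close>

text \<open>
  The topology and the norm are those of the underlying real inner product space, whose inner
  product is the real part of the complex one. The complex inner product is linear in the second
  argument.
\<close>

class chilbert_space = real_inner + complete_space +
  fixes scaleC :: "complex \<Rightarrow> 'a \<Rightarrow> 'a" (infixr \<open>*\<^sub>C\<close> 75)
    and cinner :: "'a \<Rightarrow> 'a \<Rightarrow> complex"
  assumes scaleC_add_right: "c *\<^sub>C (x + y) = c *\<^sub>C x + c *\<^sub>C y"
    and scaleC_add_left: "(c + d) *\<^sub>C x = c *\<^sub>C x + d *\<^sub>C x"
    and scaleC_scaleC: "c *\<^sub>C d *\<^sub>C x = (c * d) *\<^sub>C x"
    and scaleR_scaleC: "r *\<^sub>R x = complex_of_real r *\<^sub>C x"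
    and cinner_commute: "cinner x y = cnj (cinner y x)"
    and cinner_add_right: "cinner x (y + z) = cinner x y + cinner x z"
    and cinner_scaleC_right: "cinner x (c *\<^sub>C y) = c * cinner x y"
    and inner_eq_Re_cinner: "inner x y = Re (cinner x y)"

instantiation complex :: chilbert_space
begin

definition "scaleC_complex (c::complex) (x::complex) = c * x"
definition "cinner_complex (x::complex) y = cnj x * y"

instance
  by standard (auto simp: scaleC_complex_def cinner_complex_def algebra_simps scaleR_conv_of_real
      inner_complex_def)

end

instantiation vec :: (chilbert_space, finite) chilbert_space
begin

definition "scaleC_vec c (x::'a ^ 'b) = (\<chi> i. c *\<^sub>C (x $ i))"
definition "cinner_vec (x::'a ^ 'b) y = (\<Sum>i\<in>UNIV. cinner (x $ i) (y $ i))"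

instance
proof
  fix x y z :: "'a ^ 'b" and c d :: complex and r :: real
  show "c *\<^sub>C (x + y) = c *\<^sub>C x + c *\<^sub>C y"
    by (simp add: vec_eq_iff scaleC_vec_def scaleC_add_right)
  show "(c + d) *\<^sub>C x = c *\<^sub>C x + d *\<^sub>C x"
    by (simp add: vec_eq_iff scaleC_vec_def scaleC_add_left)
  show "c *\<^sub>C d *\<^sub>C x = (c * d) *\<^sub>C x"
    by (simp add: vec_eq_iff scaleC_vec_def scaleC_scaleC)
  show "r *\<^sub>R x = complex_of_real r *\<^sub>C x"
    by (simp add: vec_eq_iff scaleC_vec_def scaleR_scaleC)
  show "cinner x y = cnj (cinner y x)"
    unfolding cinner_vec_def cnj_sum by (rule sum.cong[OF refl], rule cinner_commute)
  show "cinner x (y + z) = cinner x y + cinner x z"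
    by (simp add: cinner_vec_def cinner_add_right sum.distrib)
  show "cinner x (c *\<^sub>C y) = c * cinner x y"
    by (simp add: cinner_vec_def scaleC_vec_def cinner_scaleC_right sum_distrib_left)
  show "inner x y = Re (cinner x y)"
    by (simp add: cinner_vec_def inner_vec_def inner_eq_Re_cinner)
qed

end

lemma scaleC_norm: "norm (c *\<^sub>C (x::'a::chilbert_space)) = cmod c * norm x"
proof -
  have "cinner (c *\<^sub>C x) (c *\<^sub>C x) = c * cnj (c * cnj (cinner x x))"
    by (metis cinner_commute cinner_scaleC_right)
  also have "\<dots> = complex_of_real ((cmod c)\<^sup>2) * cinner x x"
    by (simp only: complex_norm_square complex_cnj_mult complex_cnj_cnj mult.assoc)
  finally have "Re (cinner (c *\<^sub>C x) (c *\<^sub>C x)) = (cmod c)\<^sup>2 * Re (cinner x x)"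
    by simp
  then show ?thesis
    unfolding norm_eq_sqrt_inner[of x] norm_eq_sqrt_inner[of "c *\<^sub>C x"] inner_eq_Re_cinner
    by (simp add: real_sqrt_mult)
qed

lemma scaleC_scaleR_right: "c *\<^sub>C r *\<^sub>R (x::'a::chilbert_space) = r *\<^sub>R c *\<^sub>C x"
  by (simp add: scaleR_scaleC scaleC_scaleC mult.commute)

definition cspan :: "'a::chilbert_space set \<Rightarrow> 'a set" where
  "cspan S = span {c *\<^sub>C x | c x. x \<in> S}"

definition is_onb :: "'a::chilbert_space set \<Rightarrow> bool" where
  "is_onb S \<longleftrightarrow> (\<forall>x\<in>S. \<forall>y\<in>S. cinner x y = of_bool (x = y)) \<and> closure (cspan S) = UNIV"

section \<open>Bounded operators\<close>

text \<open>
  Operators are the complex-linear elements of the library's type of bounded real-linear maps;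
  its norm is the operator norm.
\<close>

definition bounded_ops :: "('a::chilbert_space \<Rightarrow>\<^sub>L 'a) set" where
  "bounded_ops = {X :: 'a \<Rightarrow>\<^sub>L 'a. \<forall>c x. X (c *\<^sub>C x) = c *\<^sub>C X x}"

lift_definition scaleC_op ::
  "complex \<Rightarrow> ('a::chilbert_space \<Rightarrow>\<^sub>L 'a) \<Rightarrow> ('a \<Rightarrow>\<^sub>L 'a)" is "\<lambda>c X x. c *\<^sub>C X x"
proof -
  fix c :: complex and X :: "'a \<Rightarrow> 'a"
  assume X: "bounded_linear X"
  have "bounded_linear (\<lambda>x::'a. c *\<^sub>C x)"
    by (rule bounded_linear_intro[where K="cmod c"])
      (simp_all add: scaleC_add_right scaleC_scaleR_right scaleC_norm mult.commute)
  from bounded_linear_compose[OF this X] show "bounded_linear (\<lambda>x. c *\<^sub>C X x)" .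
qed

lift_definition ketbra :: "'a::chilbert_space \<Rightarrow> 'a \<Rightarrow>\<^sub>L 'a" is "\<lambda>v x. cinner v x *\<^sub>C v"
proof -
  fix v :: 'a
  have bound: "cmod (cinner v x) \<le> norm v * norm x" for x
  proof (cases "cinner v x = 0")
    case False
    define u where "u = cnj (cinner v x) / complex_of_real (cmod (cinner v x))"
    have u: "cmod u = 1" using False by (simp add: u_def norm_divide)
    have "u * cinner v x = complex_of_real (cmod (cinner v x))"
      using False by (simp add: u_def mult.commute complex_norm_square[symmetric] power2_eq_square)
    then have "cmod (cinner v x) = inner v (u *\<^sub>C x)"
      by (simp add: inner_eq_Re_cinner cinner_scaleC_right)
    also have "\<dots> \<le> norm v * norm (u *\<^sub>C x)"
      by (rule norm_cauchy_schwarz)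
    finally show ?thesis by (simp add: scaleC_norm u)
  qed simp
  show "bounded_linear (\<lambda>x. cinner v x *\<^sub>C v)"
  proof (rule bounded_linear_intro[where K="norm v * norm v"])
    fix x
    show "norm (cinner v x *\<^sub>C v) \<le> norm x * (norm v * norm v)"
      using mult_right_mono[OF bound[of x] norm_ge_zero[of v]] by (simp add: scaleC_norm mult_ac)
  qed (simp_all add: cinner_add_right scaleC_add_left scaleR_scaleC cinner_scaleC_right scaleC_scaleC)
qed

definition is_adjoint :: "('a::chilbert_space \<Rightarrow>\<^sub>L 'a) \<Rightarrow> ('a \<Rightarrow>\<^sub>L 'a) \<Rightarrow> bool" where
  "is_adjoint X Y \<longleftrightarrow> (\<forall>x y. cinner (X x) y = cinner x (Y y))"

definition hermitean :: "('a::chilbert_space \<Rightarrow>\<^sub>L 'a) \<Rightarrow> bool" where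
  "hermitean X \<longleftrightarrow> X \<in> bounded_ops \<and> is_adjoint X X"

definition positive_op :: "('a::chilbert_space \<Rightarrow>\<^sub>L 'a) \<Rightarrow> bool" where
  "positive_op X \<longleftrightarrow> X \<in> bounded_ops \<and> (\<forall>v. cinner v (X v) \<in> \<real>\<^sub>\<ge>\<^sub>0)"

definition projection_op :: "('a::chilbert_space \<Rightarrow>\<^sub>L 'a) \<Rightarrow> bool" where
  "projection_op P \<longleftrightarrow> hermitean P \<and> P o\<^sub>L P = P"

section \<open>Spectral projections\<close>

definition projection_valued_measure ::
  "(real set \<Rightarrow> ('a::chilbert_space \<Rightarrow>\<^sub>L 'a)) \<Rightarrow> bool" where
  "projection_valued_measure E \<longleftrightarrow>
     (\<forall>S\<in>sets borel. projection_op (E S)) \<and> E UNIV = id_blinfun \<and>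
     (\<forall>F::nat \<Rightarrow> real set. range F \<subseteq> sets borel \<longrightarrow> disjoint_family F \<longrightarrow>
        (\<forall>v. (\<lambda>n. E (F n) v) sums E (\<Union>n. F n) v))"

definition scalar_measure ::
  "(real set \<Rightarrow> ('a::chilbert_space \<Rightarrow>\<^sub>L 'a)) \<Rightarrow> 'a \<Rightarrow> real measure" where
  "scalar_measure E v = measure_of UNIV (sets borel) (\<lambda>S. ennreal (Re (cinner v (E S v))))"

text \<open>The identity \<open>X = \<integral>\<lambda> dE(\<lambda>)\<close>, read weakly; by polarisation the diagonal matrix elements suffice.\<close>

definition spectral_measure ::
  "('a::chilbert_space \<Rightarrow>\<^sub>L 'a) \<Rightarrow> (real set \<Rightarrow> ('a \<Rightarrow>\<^sub>L 'a)) \<Rightarrow> bool" where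
  "spectral_measure X E \<longleftrightarrow> projection_valued_measure E \<and>
     (\<forall>v. integrable (scalar_measure E v) (\<lambda>l. l) \<and>
          cinner v (X v) = complex_of_real (\<integral>l. l \<partial>(scalar_measure E v)))"

text \<open>
  By the spectral theorem a Hermitean operator has a spectral measure, and its values on Borel
  sets are unique; so the description below is proper for Hermitean \<open>X\<close> and Borel \<open>S\<close>.
\<close>

definition spectral_projection ::
  "('a::chilbert_space \<Rightarrow>\<^sub>L 'a) \<Rightarrow> real set \<Rightarrow> ('a \<Rightarrow>\<^sub>L 'a)" where
  "spectral_projection X S = (THE P. \<exists>E. spectral_measure X E \<and> P = E S)"

section \<open>Von Neumann algebras and tensor products\<close>

definition commutant :: "('a::chilbert_space \<Rightarrow>\<^sub>L 'a) set \<Rightarrow> ('a \<Rightarrow>\<^sub>L 'a) set" where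
  "commutant M = {Y \<in> bounded_ops. \<forall>X\<in>M. X o\<^sub>L Y = Y o\<^sub>L X}"

definition von_neumann_algebra :: "('a::chilbert_space \<Rightarrow>\<^sub>L 'a) set \<Rightarrow> bool" where
  "von_neumann_algebra M \<longleftrightarrow>
     M \<subseteq> bounded_ops \<and> (\<forall>X\<in>M. \<exists>Y\<in>M. is_adjoint X Y) \<and> commutant (commutant M) = M"

text \<open>
  \<open>hilbert_tensor t\<close>: the target space of \<open>t\<close>, with \<open>t x y\<close> for \<open>x \<otimes> y\<close>, is the Hilbert space
  tensor product of the two source spaces, that is, the completion of their algebraic tensor
  product. This determines it up to a unique unitary.
\<close>

definition hilbert_tensor ::
  "('h::chilbert_space \<Rightarrow> 'k::chilbert_space \<Rightarrow> 'l::chilbert_space) \<Rightarrow> bool" where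
  "hilbert_tensor t \<longleftrightarrow>
     (\<forall>x x' y. t (x + x') y = t x y + t x' y) \<and> (\<forall>x y y'. t x (y + y') = t x y + t x y') \<and>
     (\<forall>c x y. t (c *\<^sub>C x) y = c *\<^sub>C t x y) \<and> (\<forall>c x y. t x (c *\<^sub>C y) = c *\<^sub>C t x y) \<and>
     (\<forall>x y x' y'. cinner (t x y) (t x' y') = cinner x x' * cinner y y') \<and>
     closure (cspan {t x y | x y. True}) = UNIV"

definition op_tensor ::
  "('h::chilbert_space \<Rightarrow> 'k::chilbert_space \<Rightarrow> 'l::chilbert_space) \<Rightarrow>
     ('h \<Rightarrow>\<^sub>L 'h) \<Rightarrow> ('k \<Rightarrow>\<^sub>L 'k) \<Rightarrow> ('l \<Rightarrow>\<^sub>L 'l)" where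
  "op_tensor t X Y = (THE Z. Z \<in> bounded_ops \<and> (\<forall>x y. Z (t x y) = t (X x) (Y y)))"

text \<open>The generating set is closed under adjoints, so its bicommutant is the von Neumann algebra
  it generates.\<close>

definition algebra_tensor ::
  "('h::chilbert_space \<Rightarrow> 'k::chilbert_space \<Rightarrow> 'l::chilbert_space) \<Rightarrow>
     ('h \<Rightarrow>\<^sub>L 'h) set \<Rightarrow> ('k \<Rightarrow>\<^sub>L 'k) set \<Rightarrow> ('l \<Rightarrow>\<^sub>L 'l) set" where
  "algebra_tensor t M N = commutant (commutant {op_tensor t X Y | X Y. X \<in> M \<and> Y \<in> N})"

section \<open>States\<close>

definition op_trace :: "('a::chilbert_space \<Rightarrow>\<^sub>L 'a) \<Rightarrow> complex" where
  "op_trace X = (\<Sum>\<^sub>\<infinity>e\<in>(SOME S. is_onb S). cinner e (X e))"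

text \<open>
  A sum that does not converge unconditionally is \<open>0\<close>, so trace \<open>1\<close> makes a positive operator
  trace class.
\<close>

definition density_op :: "('a::chilbert_space \<Rightarrow>\<^sub>L 'a) \<Rightarrow> bool" where
  "density_op \<rho> \<longleftrightarrow> positive_op \<rho> \<and> op_trace \<rho> = 1"

definition density_state :: "('a::chilbert_space \<Rightarrow>\<^sub>L 'a) \<Rightarrow> ('a \<Rightarrow>\<^sub>L 'a) \<Rightarrow> complex" where
  "density_state \<rho> X = op_trace (\<rho> o\<^sub>L X)"

definition normal_state ::
  "('a::chilbert_space \<Rightarrow>\<^sub>L 'a) set \<Rightarrow> (('a \<Rightarrow>\<^sub>L 'a) \<Rightarrow> complex) \<Rightarrow> bool" where
  "normal_state M \<phi> \<longleftrightarrow> (\<exists>\<rho>. density_op \<rho> \<and> (\<forall>X\<in>M. \<phi> X = density_state \<rho> X))"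

definition trace_distance ::
  "(('a::chilbert_space \<Rightarrow>\<^sub>L 'a) \<Rightarrow> complex) \<Rightarrow> (('a \<Rightarrow>\<^sub>L 'a) \<Rightarrow> complex) \<Rightarrow> real" where
  "trace_distance \<phi> \<sigma> = (SUP P\<in>{P. projection_op P}. Re (\<phi> P) - Re (\<sigma> P))"

section \<open>CP-maps\<close>

text \<open>
  An \<open>n \<times> n\<close> matrix \<open>X\<close> with entries in an algebra of operators on \<open>'a\<close> is positive if it is
  positive as an operator on the \<open>n\<close>-fold direct sum of \<open>'a\<close>.
\<close>

definition positive_matrix :: "nat \<Rightarrow> (nat \<Rightarrow> nat \<Rightarrow> ('a::chilbert_space \<Rightarrow>\<^sub>L 'a)) \<Rightarrow> bool" where
  "positive_matrix n X \<longleftrightarrow>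
     (\<forall>v::nat \<Rightarrow> 'a. (\<Sum>i<n. \<Sum>j<n. cinner (v i) (X i j (v j))) \<in> \<real>\<^sub>\<ge>\<^sub>0)"

definition completely_positive ::
  "('a::chilbert_space \<Rightarrow>\<^sub>L 'a) set \<Rightarrow> (('a \<Rightarrow>\<^sub>L 'a) \<Rightarrow> ('b::chilbert_space \<Rightarrow>\<^sub>L 'b)) \<Rightarrow> bool" where
  "completely_positive M T \<longleftrightarrow>
     (\<forall>n X. (\<forall>i<n. \<forall>j<n. X i j \<in> M) \<longrightarrow> positive_matrix n X \<longrightarrow>
        positive_matrix n (\<lambda>i j. T (X i j)))"

definition cp_map ::
  "('a::chilbert_space \<Rightarrow>\<^sub>L 'a) set \<Rightarrow> ('b::chilbert_space \<Rightarrow>\<^sub>L 'b) set \<Rightarrow>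
     (('a \<Rightarrow>\<^sub>L 'a) \<Rightarrow> ('b \<Rightarrow>\<^sub>L 'b)) \<Rightarrow> bool" where
  "cp_map M N T \<longleftrightarrow>
     (\<forall>X\<in>M. T X \<in> N) \<and>
     (\<forall>X\<in>M. \<forall>Y\<in>M. T (X + Y) = T X + T Y) \<and>
     (\<forall>X\<in>M. \<forall>c. T (scaleC_op c X) = scaleC_op c (T X)) \<and>
     T id_blinfun = id_blinfun \<and>
     completely_positive M T \<and>
     (\<forall>\<phi>. normal_state N \<phi> \<longrightarrow> normal_state M (\<lambda>X. \<phi> (T X)))"

section \<open>Nondestructive measurements\<close>

definition reduced_map ::
  "('h::chilbert_space \<Rightarrow> 'k::chilbert_space \<Rightarrow> 'l::chilbert_space) \<Rightarrow>
     (('l \<Rightarrow>\<^sub>L 'l) \<Rightarrow> ('h \<Rightarrow>\<^sub>L 'h)) \<Rightarrow> ('h \<Rightarrow>\<^sub>L 'h) \<Rightarrow> ('h \<Rightarrow>\<^sub>L 'h)" where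
  "reduced_map t T X = T (op_tensor t X id_blinfun)"

definition pullback :: "('b \<Rightarrow> 'c) \<Rightarrow> ('c \<Rightarrow> complex) \<Rightarrow> 'b \<Rightarrow> complex" where
  "pullback R \<phi> = (\<lambda>X. \<phi> (R X))"

definition measurement_infidelity ::
  "('h::chilbert_space \<Rightarrow> 'k::chilbert_space \<Rightarrow> 'l::chilbert_space) \<Rightarrow>
     (('l \<Rightarrow>\<^sub>L 'l) \<Rightarrow> ('h \<Rightarrow>\<^sub>L 'h)) \<Rightarrow> ('h \<Rightarrow>\<^sub>L 'h) \<Rightarrow> ('k \<Rightarrow>\<^sub>L 'k) \<Rightarrow> real" where
  "measurement_infidelity t T A B =
     (SUP S\<in>sets borel.
        norm (T (op_tensor t id_blinfun (spectral_projection B S)) - spectral_projection A S))"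

locale nondestructive_measurement =
  fixes tens :: "'h::chilbert_space \<Rightarrow> 'k::chilbert_space \<Rightarrow> 'l::chilbert_space"
    and \<B> :: "('k \<Rightarrow>\<^sub>L 'k) set"
    and T :: "('l \<Rightarrow>\<^sub>L 'l) \<Rightarrow> ('h \<Rightarrow>\<^sub>L 'h)"
    and A :: "'h \<Rightarrow>\<^sub>L 'h" and B :: "'k \<Rightarrow>\<^sub>L 'k"
    and \<psi> :: "'i \<Rightarrow> 'h" and a :: "'i \<Rightarrow> real"
  assumes tens: "hilbert_tensor tens"
    and algebra: "von_neumann_algebra \<B>"
    and cp: "cp_map (algebra_tensor tens bounded_ops \<B>) bounded_ops T"
    and A: "hermitean A"
    and B: "B \<in> \<B>" "hermitean B"
    and basis: "inj \<psi>" "is_onb (range \<psi>)"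
    and eigenvector: "\<And>i. A (\<psi> i) = a i *\<^sub>R \<psi> i"
    and nondestructive: "\<And>i X. X \<in> bounded_ops \<Longrightarrow>
      pullback (reduced_map tens T) (density_state (ketbra (\<psi> i))) X = density_state (ketbra (\<psi> i)) X"

definition coherent_op :: "('i \<Rightarrow> 'h::chilbert_space) \<Rightarrow> 'i \<Rightarrow> 'i \<Rightarrow> complex \<Rightarrow> complex \<Rightarrow> ('h \<Rightarrow>\<^sub>L 'h)" where
  "coherent_op \<psi> i j \<alpha> \<beta> = ketbra (\<alpha> *\<^sub>C \<psi> i + \<beta> *\<^sub>C \<psi> j)"

definition incoherent_op :: "('i \<Rightarrow> 'h::chilbert_space) \<Rightarrow> 'i \<Rightarrow> 'i \<Rightarrow> complex \<Rightarrow> complex \<Rightarrow> ('h \<Rightarrow>\<^sub>L 'h)" where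
  "incoherent_op \<psi> i j \<alpha> \<beta> =
     (cmod \<alpha>)\<^sup>2 *\<^sub>R ketbra (\<psi> i) + (cmod \<beta>)\<^sup>2 *\<^sub>R ketbra (\<psi> j)"

end

(*
  For a test projection p, the off-diagonal element of R(p) between psi_i and psi_j is estimated by splitting p (x) 1 and
  (1 - p) (x) 1 along the projection P = 1_{a_i}(B): each of the four resulting positive operators
  (T(p (x) P) and so on) obeys the Cauchy-Schwarz inequality, and the diagonal elements of T(1 (x) P) are at
  least 1 - delta in psi_i and at most delta in psi_j. The bound is attained by the von Neumann
  measurement psi_i |-> psi_i (x) phi_i with pointer states phi_1 = (sqrt (1 - delta), sqrt delta)
  and phi_2 = (sqrt delta, sqrt (1 - delta)).
*)
theory Submission
  imports Defs
begin

text \<open>Nondestructiveness fixes the diagonal elements of R(p), so at p the two states differ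
  only by the interference term 2 Re(cnj \<alpha> * \<beta> * x), where x is the off-diagonal
  element of R(p), and 2 |\<alpha> \<beta>| \<le> 1. Estimating x from p alone would lose a factor
  2. Using 1 - p as well recovers it: orthogonality of psi_i and psi_j makes the two off-diagonal
  elements opposite, so 2 |x| is at most the sum of all four terms. The main obstacle is that
  spectral projections are definite descriptions over weakly defined spectral measures. Their
  uniqueness has to be proved, and also that those of B lie in the algebra on which T is a CP-map.
  Both are instances of one intertwining statement. The pointer states reflect the case of equality:
  a wrong reading has probability \<delta>, and their overlap 2 sqrt(\<delta> (1 - \<delta>))
  multiplies the off-diagonal element of the test projection, which can be as large as 1/2.\<close>

section \<open>Complex inner products, dense spans and bounded operators\<close>

lemma bounded_bilinear_scaleC:
  "bounded_bilinear (scaleC :: complex \<Rightarrow> 'a::chilbert_space \<Rightarrow> 'a)"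
  by (rule bounded_bilinear.intro)
    (auto simp: scaleC_add_left scaleC_add_right scaleC_scaleC scaleC_scaleR_right scaleC_norm
      scaleR_scaleC[of _ "_ :: 'a"] scaleR_conv_of_real mult.commute intro!: exI[of _ 1])

interpretation scaleC: bounded_bilinear "scaleC :: complex \<Rightarrow> 'a::chilbert_space \<Rightarrow> 'a"
  by (rule bounded_bilinear_scaleC)

lemma scaleC_one [simp]: "1 *\<^sub>C x = (x::'a::chilbert_space)"
  using scaleR_scaleC[of 1 x] by simp

lemma cinner_scaleC_left: "cinner (c *\<^sub>C x) y = cnj c * cinner x y"
  by (metis cinner_commute cinner_scaleC_right complex_cnj_cnj complex_cnj_mult)

lemma cinner_self: "cinner x x = complex_of_real ((norm x)\<^sup>2)"
proof -
  have "Im (cinner x x) = 0"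
    using arg_cong[OF cinner_commute[of x x], of Im] by simp
  then show ?thesis
    by (simp add: complex_eq_iff power2_norm_eq_inner inner_eq_Re_cinner)
qed

text \<open>The phase \<open>u\<close> turns the complex inner product into a nonnegative real
  number, to which the real Cauchy-Schwarz inequality applies.\<close>

lemma cinner_Cauchy_Schwarz: "cmod (cinner x y) \<le> norm x * norm y"
proof (cases "cinner x y = 0")
  case False
  define u where "u = cnj (cinner x y) / complex_of_real (cmod (cinner x y))"
  have u: "cmod u = 1" using False by (simp add: u_def norm_divide)
  have "u * cinner x y = complex_of_real (cmod (cinner x y))"
    using False by (simp add: u_def mult.commute complex_norm_square[symmetric] power2_eq_square)
  then have "cmod (cinner x y) = inner x (u *\<^sub>C y)"
    by (simp add: inner_eq_Re_cinner cinner_scaleC_right)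
  also have "\<dots> \<le> norm x * norm (u *\<^sub>C y)"
    by (rule norm_cauchy_schwarz)
  finally show ?thesis by (simp add: scaleC_norm u)
qed simp

lemma bounded_bilinear_cinner:
  "bounded_bilinear (cinner :: 'a::chilbert_space \<Rightarrow> 'a \<Rightarrow> complex)"
proof (rule bounded_bilinear.intro)
  show "cinner (x + x') y = cinner x y + cinner x' y" for x x' y :: 'a
    by (metis cinner_add_right cinner_commute complex_cnj_add)
  show "\<exists>K. \<forall>x y :: 'a. cmod (cinner x y) \<le> norm x * norm y * K"
    using cinner_Cauchy_Schwarz by (intro exI[of _ 1]) auto
qed (auto simp: cinner_add_right scaleR_scaleC[of _ "_::'a"] cinner_scaleC_left cinner_scaleC_right
      scaleR_conv_of_real)

interpretation cinner: bounded_bilinear "cinner :: 'a::chilbert_space \<Rightarrow> 'a \<Rightarrow> complex"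
  by (rule bounded_bilinear_cinner)

declare scaleC.zero_left [simp] scaleC.zero_right [simp]
  cinner.zero_left [simp] cinner.zero_right [simp]

lemmas cinner_simps =
  cinner.add_left cinner.add_right cinner.diff_left cinner.diff_right
  cinner.minus_left cinner.minus_right cinner.sum_left cinner.sum_right
  cinner_scaleC_left cinner_scaleC_right

lemma cinner_scaleR_left: "cinner (r *\<^sub>R x) y = complex_of_real r * cinner x y"
  by (simp add: cinner.scaleR_left scaleR_conv_of_real)

lemma cinner_scaleR_right: "cinner x (r *\<^sub>R y) = complex_of_real r * cinner x y"
  by (simp add: cinner.scaleR_right scaleR_conv_of_real)

lemma cinner_eqI: "(\<And>u. cinner u x = cinner u y) \<Longrightarrow> x = y"
  by (metis cinner.diff_right cinner_self eq_iff_diff_eq_0 norm_eq_zero of_real_eq_0_iff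
      power_eq_0_iff)

lemma Re_cinner_self: "Re (cinner x x) = (norm x)\<^sup>2"
  by (simp add: cinner_self)

text \<open>The vectors satisfying \<open>P\<close> form a closed subspace that contains all complex
  multiples of \<open>S\<close>. This reduces identities between bounded operators to basis vectors
  or simple tensors.\<close>

lemma dense_cspan_induct:
  fixes v :: "'a::chilbert_space"
  assumes dense: "closure (cspan S) = UNIV"
    and closed: "closed {x. P x}"
    and base: "\<And>x. x \<in> S \<Longrightarrow> P x"
    and zero: "P 0"
    and add: "\<And>x y. P x \<Longrightarrow> P y \<Longrightarrow> P (x + y)"
    and scale: "\<And>c x. P x \<Longrightarrow> P (c *\<^sub>C x)"
  shows "P v"
proof -
  have "subspace {x. P x}"
    using zero add scale by (auto simp: subspace_def scaleR_scaleC)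
  then have "cspan S \<subseteq> {x. P x}"
    unfolding cspan_def by (rule span_minimal[rotated]) (auto intro: base scale)
  from closure_minimal[OF this closed] dense show ?thesis by auto
qed

lemma bounded_opsI:
  "(\<And>c x. blinfun_apply X (c *\<^sub>C x) = c *\<^sub>C X x) \<Longrightarrow> X \<in> bounded_ops"
  by (simp add: bounded_ops_def)

lemma bounded_ops_scaleC: "X \<in> bounded_ops \<Longrightarrow> blinfun_apply X (c *\<^sub>C x) = c *\<^sub>C X x"
  by (simp add: bounded_ops_def)

lemma bounded_ops_id: "id_blinfun \<in> bounded_ops"
  by (simp add: bounded_ops_def)

lemma bounded_ops_compose: "X \<in> bounded_ops \<Longrightarrow> Y \<in> bounded_ops \<Longrightarrow> X o\<^sub>L Y \<in> bounded_ops"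
  by (simp add: bounded_ops_def)

lemma bounded_ops_add: "X \<in> bounded_ops \<Longrightarrow> Y \<in> bounded_ops \<Longrightarrow> X + Y \<in> bounded_ops"
  by (simp add: bounded_ops_def blinfun.add_left scaleC_add_right)

lemma bounded_ops_minus: "X \<in> bounded_ops \<Longrightarrow> - X \<in> bounded_ops"
  by (simp add: bounded_ops_def blinfun.minus_left scaleC.minus_right)

lemma bounded_ops_diff: "X \<in> bounded_ops \<Longrightarrow> Y \<in> bounded_ops \<Longrightarrow> X - Y \<in> bounded_ops"
  by (simp add: bounded_ops_def blinfun.diff_left scaleC.diff_right)

lemma bounded_ops_scaleR: "X \<in> bounded_ops \<Longrightarrow> r *\<^sub>R X \<in> bounded_ops"
  by (simp add: bounded_ops_def blinfun.scaleR_left scaleC_scaleR_right)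

lemma bounded_ops_eqI:
  assumes "X \<in> bounded_ops" "Y \<in> bounded_ops" "closure (cspan S) = UNIV"
    and "\<And>x. x \<in> S \<Longrightarrow> blinfun_apply X x = blinfun_apply Y x"
  shows "X = Y"
proof (rule blinfun_eqI)
  show "X v = Y v" for v
    by (rule dense_cspan_induct[OF assms(3)])
      (auto intro!: closed_Collect_eq continuous_intros
        simp: assms bounded_ops_scaleC blinfun.add_right)
qed

section \<open>Extension of bounded maps from a dense subspace\<close>

lemma subspace_closure:
  fixes S :: "'a::real_normed_vector set"
  assumes S: "subspace S"
  shows "subspace (closure S)"
proof (rule subspaceI)
  show "0 \<in> closure S"
    using subspace_0[OF S] closure_subset by blast
  fix x y :: 'a and c :: real
  assume x: "x \<in> closure S"
  then obtain f where f: "\<And>n::nat. f n \<in> S" "f \<longlonglongrightarrow> x"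
    unfolding closure_sequential by blast
  show "c *\<^sub>R x \<in> closure S"
    unfolding closure_sequential
    using f S by (intro exI[of _ "\<lambda>n. c *\<^sub>R f n"]) (auto intro!: tendsto_intros subspace_mul)
  assume "y \<in> closure S"
  then obtain g where g: "\<And>n::nat. g n \<in> S" "g \<longlonglongrightarrow> y"
    unfolding closure_sequential by blast
  show "x + y \<in> closure S"
    unfolding closure_sequential
    using f g S by (intro exI[of _ "\<lambda>n. f n + g n"]) (auto intro!: tendsto_intros subspace_add)
qed

text \<open>The closure of the graph \<open>G\<close> is the graph of the extension.\<close>

lemma dense_graph_extension:
  fixes G :: "('a::real_normed_vector \<times> 'b::{real_normed_vector,complete_space}) set"
  assumes G: "subspace G" and dense: "closure (fst ` G) = UNIV"
    and bound: "\<And>u w. (u, w) \<in> G \<Longrightarrow> norm w \<le> M * norm u"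
  shows "\<exists>Z :: 'a \<Rightarrow>\<^sub>L 'b. \<forall>z\<in>G. blinfun_apply Z (fst z) = snd z"
proof -
  let ?G = "closure G"
  have sub: "subspace ?G" using G by (rule subspace_closure)
  have "G \<subseteq> {z. norm (snd z) \<le> M * norm (fst z)}" using bound by auto
  then have "?G \<subseteq> {z. norm (snd z) \<le> M * norm (fst z)}"
    by (rule closure_minimal) (intro closed_Collect_le continuous_intros)
  then have bound': "norm w \<le> M * norm u" if "(u, w) \<in> ?G" for u w
    using that by auto
  \<comment> \<open>The bound at \<open>u = 0\<close> forces the value 0, which is what makes the
    closed subspace single-valued.\<close>
  have uniq: "w = w'" if "(u, w) \<in> ?G" "(u, w') \<in> ?G" for u w w'
    using bound'[of 0 "w - w'"] subspace_diff[OF sub that] by simp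
  have ex: "\<exists>w. (u, w) \<in> ?G" for u
  proof -
    have "u \<in> closure (fst ` G)" using dense by simp
    then obtain f where f: "\<And>n::nat. f n \<in> fst ` G" "f \<longlonglongrightarrow> u"
      unfolding closure_sequential by blast
    have "\<exists>w. (f n, w) \<in> G" for n using f(1)[of n] by auto
    then obtain g where g: "\<And>n. (f n, g n) \<in> G" by metis
    have "Cauchy g"
    proof (rule metric_CauchyI)
      fix e :: real assume "e > 0"
      have "Cauchy f" using f by (intro LIMSEQ_imp_Cauchy)
      \<comment> \<open>\<open>\<bar>M\<bar> + 1\<close> is positive whatever the sign of
        \<open>M\<close>, so it may divide \<open>e\<close>.\<close>
      then obtain N where N: "\<And>m n. m \<ge> N \<Longrightarrow> n \<ge> N \<Longrightarrow> dist (f m) (f n) < e / (\<bar>M\<bar> + 1)"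
        using \<open>e > 0\<close> metric_CauchyD[of f "e / (\<bar>M\<bar> + 1)"] by fastforce
      have "dist (g m) (g n) < e" if "m \<ge> N" "n \<ge> N" for m n
      proof -
        have "norm (g m - g n) \<le> M * norm (f m - f n)"
          using subspace_diff[OF G g[of m] g[of n]] by (auto intro: bound)
        also have "\<dots> \<le> (\<bar>M\<bar> + 1) * norm (f m - f n)"
          by (rule mult_right_mono) auto
        also have "\<dots> < e"
          using N[OF that] by (simp add: dist_norm field_simps)
        finally show ?thesis by (simp add: dist_norm)
      qed
      then show "\<exists>N. \<forall>m\<ge>N. \<forall>n\<ge>N. dist (g m) (g n) < e" by blast
    qed
    then obtain w where "g \<longlonglongrightarrow> w" using Cauchy_convergent convergent_def by blast
    then have "(\<lambda>n. (f n, g n)) \<longlonglongrightarrow> (u, w)" using f by (intro tendsto_Pair)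
    then show ?thesis using g unfolding closure_sequential
      by (intro exI[of _ w] exI[of _ "\<lambda>n. (f n, g n)"]) simp
  qed
  then obtain z where z: "\<And>u. (u, z u) \<in> ?G" by metis
  have "bounded_linear z"
  proof (rule bounded_linear_intro[where K=M])
    show "z (x + y) = z x + z y" for x y
      using subspace_add[OF sub z[of x] z[of y]] by (intro uniq[OF z]) simp
    show "z (r *\<^sub>R x) = r *\<^sub>R z x" for r x
      using subspace_mul[OF sub z[of x], of r] by (intro uniq[OF z]) simp
    show "norm (z x) \<le> norm x * M" for x
      using bound'[OF z[of x]] by (simp add: mult.commute)
  qed
  then show ?thesis
    using uniq[OF z closure_subset[THEN subsetD]]
    by (intro exI[of _ "Blinfun z"]) (auto simp: bounded_linear_Blinfun_apply)
qed

subsection \<open>Orthonormal expansions\<close>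

text \<open>The orthogonality half of \<open>is_onb\<close>, without density, so that it passes to
  the finite subsets of a basis.\<close>

definition orthonormal :: "'a::chilbert_space set \<Rightarrow> bool" where
  "orthonormal S \<longleftrightarrow> (\<forall>x\<in>S. \<forall>y\<in>S. cinner x y = of_bool (x = y))"

lemma orthonormal_cinner:
  "orthonormal S \<Longrightarrow> x \<in> S \<Longrightarrow> y \<in> S \<Longrightarrow> cinner x y = of_bool (x = y)"
  by (simp add: orthonormal_def)

lemma orthonormal_residual:
  assumes "orthonormal F" "finite F" "e \<in> F"
  shows "cinner e (v - (\<Sum>f\<in>F. cinner f v *\<^sub>C f)) = 0"
  using assms by (simp add: cinner_simps orthonormal_cinner of_bool_def if_distrib[of "(*) _"]
      sum.If_cases cong: if_cong)

text \<open>By Pythagoras, since the residual is orthogonal to the partial sum. The bound is uniform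
  in \<open>F\<close>, which lets the expansion below pass to limits of vectors.\<close>

lemma norm_residual_le:
  assumes F: "orthonormal F" "finite F"
  shows "norm (v - (\<Sum>f\<in>F. cinner f v *\<^sub>C f)) \<le> norm v"
proof -
  let ?p = "\<Sum>f\<in>F. cinner f v *\<^sub>C f"
  have "orthogonal ?p (v - ?p)"
    unfolding orthogonal_def inner_eq_Re_cinner
    by (subst cinner.sum_left) (simp add: cinner_scaleC_left orthonormal_residual[OF F])
  from norm_add_Pythagorean[OF this] have "(norm (v - ?p))\<^sup>2 \<le> (norm v)\<^sup>2"
    by simp
  then show ?thesis by (rule power2_le_imp_le) simp
qed

text \<open>The vectors equal to their own expansion form a subspace containing the basis. It is
  closed because taking residuals is a contraction for every finite set of basis vectors at
  once.\<close>

lemma onb_expansion: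
  assumes S: "is_onb S"
  shows "((\<lambda>e. cinner e v *\<^sub>C e) has_sum v) S"
proof -
  let ?p = "\<lambda>v F. \<Sum>e\<in>F. cinner e v *\<^sub>C e"
  have orth: "orthonormal F" if "F \<subseteq> S" for F
    using S that unfolding is_onb_def orthonormal_def by blast
  show ?thesis
  proof (rule dense_cspan_induct[of S])
    show "closure (cspan S) = UNIV" using S by (simp add: is_onb_def)
    show "((\<lambda>e. cinner e 0 *\<^sub>C e) has_sum 0) S" by (intro has_sum_0) (simp add: cinner.zero_right scaleC.zero_left)
    fix x y c
    show "((\<lambda>e. cinner e (x + y) *\<^sub>C e) has_sum x + y) S"
      if "((\<lambda>e. cinner e x *\<^sub>C e) has_sum x) S" "((\<lambda>e. cinner e y *\<^sub>C e) has_sum y) S"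
      using has_sum_add[OF that] by (simp add: cinner_simps scaleC_add_left)
    show "((\<lambda>e. cinner e (c *\<^sub>C x) *\<^sub>C e) has_sum c *\<^sub>C x) S"
      if "((\<lambda>e. cinner e x *\<^sub>C e) has_sum x) S"
      using has_sum_bounded_linear[OF scaleC.bounded_linear_right that, of c]
      by (simp add: cinner_simps scaleC_scaleC)
    show "((\<lambda>e. cinner e x *\<^sub>C e) has_sum x) S" if "x \<in> S"
    proof -
      have "((\<lambda>e. cinner e x *\<^sub>C e) has_sum (\<Sum>e\<in>{x}. cinner e x *\<^sub>C e)) {x}"
        by (rule has_sum_finite) simp
      then have "((\<lambda>e. cinner e x *\<^sub>C e) has_sum (\<Sum>e\<in>{x}. cinner e x *\<^sub>C e)) S"
        by (rule has_sum_cong_neutral[THEN iffD1, rotated -1])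
          (use that S in \<open>auto simp: is_onb_def\<close>)
      then show ?thesis using that orth[of S] by (simp add: orthonormal_cinner)
    qed
    show "closed {x. ((\<lambda>e. cinner e x *\<^sub>C e) has_sum x) S}"
      unfolding closed_sequential_limits
    proof (intro allI impI, elim conjE)
      fix u v assume u: "\<forall>n. u n \<in> {x. ((\<lambda>e. cinner e x *\<^sub>C e) has_sum x) S}" and uv: "u \<longlonglongrightarrow> v"
      show "v \<in> {x. ((\<lambda>e. cinner e x *\<^sub>C e) has_sum x) S}"
        unfolding mem_Collect_eq has_sum_def
      proof (rule tendstoI)
        fix e :: real assume e: "e > 0"
        obtain n where n: "dist (u n) v < e / 2"
          using metric_LIMSEQ_D[OF uv, of "e/2"] e by auto
        have "(?p (u n) \<longlongrightarrow> u n) (finite_subsets_at_top S)"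
          using u by (simp add: has_sum_def)
        then have "\<forall>\<^sub>F F in finite_subsets_at_top S. dist (?p (u n) F) (u n) < e / 2"
          using e by (intro tendstoD) auto
        moreover have "\<forall>\<^sub>F F in finite_subsets_at_top S. finite F \<and> F \<subseteq> S"
          by (rule eventually_finite_subsets_at_top_weakI) auto
        ultimately show "\<forall>\<^sub>F F in finite_subsets_at_top S. dist (?p v F) v < e"
        proof eventually_elim
          case (elim F)
          have "norm (v - u n - ?p (v - u n) F) \<le> norm (v - u n)"
            using elim orth by (intro norm_residual_le) auto
          \<comment> \<open>The residual of \<open>v\<close> is that of \<open>v - u n\<close>,
            small uniformly in \<open>F\<close>, plus that of \<open>u n\<close>, small for large
            \<open>F\<close>.\<close>
          moreover have eq: "v - ?p v F = (v - u n - ?p (v - u n) F) + (u n - ?p (u n) F)"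
            by (simp add: cinner_simps scaleC.diff_left sum_subtractf)
          have "norm (v - ?p v F) \<le> norm (v - u n - ?p (v - u n) F) + norm (u n - ?p (u n) F)"
            unfolding eq by (rule norm_triangle_ineq)
          ultimately show ?case
            using n elim by (simp add: dist_norm norm_minus_commute)
        qed
      qed
    qed
  qed
qed

text \<open>\<open>op_trace\<close> sums over an unspecified basis, whose existence \<open>S\<close>
  witnesses; expanding each \<open>u k\<close> in it gives a value free of the choice. Functionals
  of the form \<open>cinner (w k) (X k x)\<close> cover a finite-rank operator times a bounded one
  without mentioning adjoints.\<close>

lemma op_trace_finite_rank:
  fixes u :: "'i \<Rightarrow> 'a::chilbert_space"
  assumes S: "is_onb (S :: 'a set)" and F: "finite F" and X: "\<And>k. k \<in> F \<Longrightarrow> X k \<in> bounded_ops"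
    and Y: "\<And>x. blinfun_apply Y x = (\<Sum>k\<in>F. cinner (w k) (X k x) *\<^sub>C u k)"
  shows "op_trace Y = (\<Sum>k\<in>F. cinner (w k) (X k (u k)))"
proof -
  define S' where "S' = (SOME S::'a set. is_onb S)"
  have S': "is_onb S'" unfolding S'_def using S by (rule someI)
  have one: "((\<lambda>e. cinner (w k) (X k e) * cinner e (u k)) has_sum cinner (w k) (X k (u k))) S'"
    if k: "k \<in> F" for k
  proof -
    have "bounded_linear (\<lambda>x. cinner (w k) (X k x))"
      by (intro bounded_linear_compose[OF cinner.bounded_linear_right] blinfun.bounded_linear_right)
    from has_sum_bounded_linear[OF this onb_expansion[OF S', of "u k"]] show ?thesis
      by (simp add: bounded_ops_scaleC[OF X[OF k]] cinner_simps mult.commute)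
  qed
  have "((\<lambda>e. \<Sum>k\<in>G. cinner (w k) (X k e) * cinner e (u k)) has_sum
      (\<Sum>k\<in>G. cinner (w k) (X k (u k)))) S'" if "G \<subseteq> F" for G
    using finite_subset[OF that F] that
    by (induction G rule: finite_induct) (auto intro!: has_sum_add one has_sum_0)
  then have "((\<lambda>e. cinner e (Y e)) has_sum (\<Sum>k\<in>F. cinner (w k) (X k (u k)))) S'"
    by (simp add: Y cinner_simps)
  then show ?thesis unfolding op_trace_def S'_def by (rule infsumI)
qed

lemma ketbra_apply: "ketbra v x = cinner v x *\<^sub>C v"
  by (simp add: ketbra.rep_eq)

lemma density_state_ketbra:
  fixes v :: "'a::chilbert_space"
  assumes "is_onb (S :: 'a set)" "X \<in> bounded_ops"
  shows "density_state (ketbra v) X = cinner v (X v)"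
  using op_trace_finite_rank[OF assms(1), of "{()}" "\<lambda>_. X" "ketbra v o\<^sub>L X" "\<lambda>_. v" "\<lambda>_. v"] assms(2)
  by (simp add: density_state_def ketbra_apply)

subsection \<open>Positive operators and projections\<close>

text \<open>Polarisation: reality of the form at \<open>x + y\<close> settles the imaginary parts,
  and at \<open>x + \<i> *\<^sub>C y\<close> the real parts.\<close>

lemma positive_form_hermitean:
  assumes K: "K \<in> bounded_ops" "\<And>v. cinner v (blinfun_apply K v) \<in> \<real>\<^sub>\<ge>\<^sub>0"
  shows "cinner x (K y) = cinner (K x) y"
proof -
  let ?q = "\<lambda>x y. cinner x (K y)"
  have im: "Im (?q v v) = 0" for v
    using K(2)[of v] by (simp add: complex_nonneg_Reals_iff)
  have "Im (?q x y) + Im (?q y x) = 0"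
    using im[of "x + y"] im[of x] im[of y]
    by (simp add: cinner_simps blinfun.add_right)
  moreover have "Re (?q x y) - Re (?q y x) = 0"
    using im[of "x + \<i> *\<^sub>C y"] im[of x] im[of y]
    by (simp add: cinner_simps blinfun.add_right bounded_ops_scaleC[OF K(1)])
  ultimately have "?q x y = cnj (?q y x)"
    by (simp add: complex_eq_iff)
  then show ?thesis using cinner_commute by metis
qed

lemma positive_form_Cauchy_Schwarz:
  assumes K: "K \<in> bounded_ops" "\<And>v. cinner v (blinfun_apply K v) \<in> \<real>\<^sub>\<ge>\<^sub>0"
  shows "(cmod (cinner x (K y)))\<^sup>2 \<le> Re (cinner x (K x)) * Re (cinner y (K y))"
proof -
  define z a b where "z = cinner x (K y)" and "a = Re (cinner x (K x))" and "b = Re (cinner y (K y))"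
  have nonneg: "0 \<le> a" "0 \<le> b"
    using K(2)[of x] K(2)[of y] by (simp_all add: a_def b_def complex_nonneg_Reals_iff)
  have yx: "cinner y (K x) = cnj z"
    using positive_form_hermitean[OF K, of y x] cinner_commute[of "K y" x] by (simp add: z_def)
  \<comment> \<open>The coefficient \<open>cnj z\<close> aligns the phases, so that the cross terms
    become a real multiple of \<open>(cmod z)\<^sup>2\<close> and one real parameter
    \<open>r\<close> suffices.\<close>
  have form: "0 \<le> r\<^sup>2 * a - 2 * r * (cmod z)\<^sup>2 + (cmod z)\<^sup>2 * b" for r :: real
  proof -
    have "0 \<le> Re (cinner (complex_of_real r *\<^sub>C x - cnj z *\<^sub>C y)
        (K (complex_of_real r *\<^sub>C x - cnj z *\<^sub>C y)))"
      using K(2)[of "complex_of_real r *\<^sub>C x - cnj z *\<^sub>C y"]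
      by (simp add: complex_nonneg_Reals_iff)
    also have "\<dots> = r\<^sup>2 * a - 2 * r * (cmod z)\<^sup>2 + (cmod z)\<^sup>2 * b"
      unfolding cmod_power2
      by (simp add: cinner_simps blinfun.diff_right bounded_ops_scaleC[OF K(1)] z_def[symmetric]
          yx algebra_simps a_def b_def power2_eq_square complex_nonneg_Reals_iff)
    finally show ?thesis .
  qed
  have "(cmod z)\<^sup>2 \<le> a * b"
  proof (cases "z = 0 \<or> a = 0")
    case True
    then show ?thesis
    proof (cases "z = 0")
      case False
      then have "a = 0" using True by simp
      \<comment> \<open>For \<open>a = 0\<close> the form equals
        \<open>(cmod z)\<^sup>2 * (b - 2 * r)\<close>, which is negative at this
        \<open>r\<close>.\<close>
      with form[of "b / 2 + 1"] False show ?thesis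
        by (simp add: algebra_simps)
    qed (use nonneg in simp)
  next
    case False
    then have "a > 0" using nonneg by simp
    \<comment> \<open>The quadratic in \<open>r\<close> has its minimum at
      \<open>(cmod z)\<^sup>2 / a\<close>.\<close>
    have "0 \<le> ((cmod z)\<^sup>2 / a)\<^sup>2 * a - 2 * ((cmod z)\<^sup>2 / a) * (cmod z)\<^sup>2 + (cmod z)\<^sup>2 * b"
      by (rule form)
    also have "\<dots> = (cmod z)\<^sup>2 / a * (a * b - (cmod z)\<^sup>2)"
      using \<open>a > 0\<close> by (simp add: field_simps power2_eq_square)
    finally have "0 \<le> (cmod z)\<^sup>2 / a * (a * b - (cmod z)\<^sup>2)" .
    moreover have "0 < (cmod z)\<^sup>2 / a" using False \<open>a > 0\<close> by simp
    ultimately have "0 \<le> a * b - (cmod z)\<^sup>2"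
      using zero_le_mult_iff[of "(cmod z)\<^sup>2 / a" "a * b - (cmod z)\<^sup>2"] by linarith
    then show ?thesis by simp
  qed
  then show ?thesis by (simp add: z_def a_def b_def)
qed

lemma positive_opD:
  "positive_op K \<Longrightarrow> K \<in> bounded_ops"
  "positive_op K \<Longrightarrow> cinner v (blinfun_apply K v) \<in> \<real>\<^sub>\<ge>\<^sub>0"
  by (simp_all add: positive_op_def)

text \<open>Cauchy-Schwarz for the form of \<open>K\<close> at the pair \<open>K x\<close>,
  \<open>x\<close>. The bound \<open>s\<close> is asked at these two vectors only, so the lemma
  works inside an invariant subspace such as the range of a spectral projection.\<close>

lemma norm_le_of_positive_form:
  assumes K: "K \<in> bounded_ops" "\<And>v. cinner v (blinfun_apply K v) \<in> \<real>\<^sub>\<ge>\<^sub>0"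
    and x: "Re (cinner x (K x)) \<le> s * (norm x)\<^sup>2"
    and Kx: "Re (cinner (K x) (K (K x))) \<le> s * (norm (K x))\<^sup>2"
    and s: "0 \<le> s"
  shows "norm (K x) \<le> s * norm x"
proof (cases "K x = 0")
  case False
  have nonneg: "0 \<le> Re (cinner v (K v))" for v
    using K(2)[of v] by (simp add: complex_nonneg_Reals_iff)
  have "((norm (K x))\<^sup>2)\<^sup>2 = (cmod (cinner (K x) (K x)))\<^sup>2"
    by (simp add: cinner_self norm_power)
  also have "\<dots> \<le> Re (cinner (K x) (K (K x))) * Re (cinner x (K x))"
    by (rule positive_form_Cauchy_Schwarz[OF K])
  also have "\<dots> \<le> (s * (norm (K x))\<^sup>2) * (s * (norm x)\<^sup>2)"
    using x Kx s nonneg by (intro mult_mono) auto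
  finally have "(norm (K x))\<^sup>2 * (norm (K x))\<^sup>2 \<le> (norm (K x))\<^sup>2 * (s * norm x)\<^sup>2"
    by (simp add: power2_eq_square mult_ac)
  then have "(norm (K x))\<^sup>2 \<le> (s * norm x)\<^sup>2"
    using False by (subst (asm) mult_le_cancel_left_pos) simp_all
  then show ?thesis using s by (intro power2_le_imp_le[of "norm (K x)"]) auto
qed (use s in simp)

lemma projection_opD:
  assumes "projection_op P"
  shows "P \<in> bounded_ops" "blinfun_apply P (P x) = P x"
    "cinner (P x) y = cinner x (P y)" "cinner x (P x) = complex_of_real ((norm (P x))\<^sup>2)"
proof -
  show *: "P \<in> bounded_ops" "P (P x) = P x" "cinner (P x) y = cinner x (P y)" for x y
    using assms blinfun_apply_blinfun_compose[of P P]
    by (auto simp: projection_op_def hermitean_def is_adjoint_def)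
  show "cinner x (P x) = complex_of_real ((norm (P x))\<^sup>2)"
    using *(2)[of x] *(3)[of x "P x"] by (simp add: cinner_self)
qed

lemma projection_opI:
  assumes "P \<in> bounded_ops" "\<And>x. blinfun_apply P (P x) = P x" "\<And>x y. cinner (P x) y = cinner x (P y)"
  shows "projection_op P"
  using assms by (auto simp: projection_op_def hermitean_def is_adjoint_def intro: blinfun_eqI)

lemma projection_op_id: "projection_op id_blinfun"
  by (rule projection_opI) (auto simp: bounded_ops_id)

lemma projection_op_zero: "projection_op 0"
  by (rule projection_opI) (auto simp: bounded_ops_def scaleC.zero_right cinner.zero_left cinner.zero_right)

lemma projection_op_complement: "projection_op P \<Longrightarrow> projection_op (id_blinfun - P)"
  by (rule projection_opI)
    (auto simp: bounded_ops_diff bounded_ops_id projection_opD blinfun.diff_left blinfun.diff_right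
      cinner_simps)

lemma projection_op_norm_apply: "projection_op P \<Longrightarrow> norm (P x) \<le> norm x"
proof -
  assume P: "projection_op P"
  have "(norm (P x))\<^sup>2 = cmod (cinner x (P x))"
    by (simp add: projection_opD[OF P] norm_power)
  also have "\<dots> \<le> norm x * norm (P x)" by (rule cinner_Cauchy_Schwarz)
  finally show ?thesis by (cases "P x = 0") (auto simp: power2_eq_square)
qed

lemma projection_op_norm_le: "projection_op P \<Longrightarrow> norm P \<le> 1"
  by (rule norm_blinfun_bound) (auto simp: projection_op_norm_apply)

lemma positive_op_projection: "projection_op P \<Longrightarrow> positive_op P"
  by (simp add: positive_op_def projection_opD)

lemma projection_op_ketbra: "norm v = 1 \<Longrightarrow> projection_op (ketbra v)"
  by (rule projection_opI)
    (auto simp: bounded_ops_def ketbra_apply cinner_simps scaleC_scaleC cinner_self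
      mult.commute cinner_commute[of _ v] )

subsection \<open>Tensor products of operators\<close>

lemma hilbert_tensorD:
  assumes "hilbert_tensor t"
  shows "t (x + x') y = t x y + t x' y" "t x (y + y') = t x y + t x y'"
    "t (c *\<^sub>C x) y = c *\<^sub>C t x y" "t x (c *\<^sub>C y) = c *\<^sub>C t x y"
    "cinner (t x y) (t x' y') = cinner x x' * cinner y y'"
    "closure (cspan {t x y | x y. True}) = UNIV"
  using assms by (auto simp: hilbert_tensor_def)

text \<open>Results about operators on the first factor carry over to the second.\<close>

lemma hilbert_tensor_flip:
  assumes t: "hilbert_tensor t"
  shows "hilbert_tensor (\<lambda>y x. t x y)"
proof -
  have flip: "{t x y | y x. True} = {t x y | x y. True}" by blast
  show ?thesis
    using hilbert_tensorD(6)[OF t, folded flip]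
    unfolding hilbert_tensor_def by (simp add: hilbert_tensorD(1-5)[OF t])
qed

lemma bounded_bilinear_tensor:
  assumes t: "hilbert_tensor t"
  shows "bounded_bilinear t"
proof
  show "\<exists>K. \<forall>a b. norm (t a b) \<le> norm a * norm b * K"
  proof (intro exI[of _ 1] allI)
    fix a b
    have "complex_of_real ((norm (t a b))\<^sup>2) = complex_of_real ((norm a * norm b)\<^sup>2)"
      unfolding cinner_self[symmetric] hilbert_tensorD(5)[OF t]
      by (simp add: cinner_self power_mult_distrib)
    then have "(norm (t a b))\<^sup>2 = (norm a * norm b)\<^sup>2" by (simp only: of_real_eq_iff)
    then show "norm (t a b) \<le> norm a * norm b * 1" by (simp add: power2_eq_iff_nonneg)
  qed
qed (simp_all add: hilbert_tensorD[OF t] scaleR_scaleC)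

text \<open>Orthonormal second factors make the summands pairwise orthogonal. The norm then depends
  only on the norms of the first factors, on which an operator's bound is known.\<close>

lemma norm_tensor_orthonormal_sum:
  assumes t: "hilbert_tensor t" and F: "orthonormal F" "finite F"
  shows "(norm (\<Sum>f\<in>F. t (x f) f))\<^sup>2 = (\<Sum>f\<in>F. (norm (x f))\<^sup>2)"
proof -
  have "(norm (\<Sum>f\<in>F. t (x f) f))\<^sup>2 = (\<Sum>f\<in>F. (norm (t (x f) f))\<^sup>2)"
    using F by (intro norm_sum_Pythagorean)
      (auto simp: pairwise_def orthogonal_def inner_eq_Re_cinner hilbert_tensorD(5)[OF t]
        orthonormal_cinner)
  also have "\<dots> = (\<Sum>f\<in>F. (norm (x f))\<^sup>2)"
    using F by (intro sum.cong refl)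
      (simp add: Re_cinner_self[symmetric] hilbert_tensorD(5)[OF t] orthonormal_cinner)
  finally show ?thesis .
qed

text \<open>Gram-Schmidt on the second factors, one simple tensor at a time. Linearity of
  \<open>X\<close> lets the same regrouping serve both components of the graph.\<close>

lemma tensor_left_span_form:
  assumes t: "hilbert_tensor t"
    and g: "g \<in> span {(t x y, t (blinfun_apply X x) y) | x y. True}" and X: "X \<in> bounded_ops"
  shows "\<exists>F x. finite F \<and> orthonormal F \<and> g = (\<Sum>f\<in>F. t (x f) f, \<Sum>f\<in>F. t (X (x f)) f)"
  using g
proof (induction rule: span_induct_alt)
  case base
  show ?case by (intro exI[of _ "{}"]) (auto simp: orthonormal_def zero_prod_def)
next
  interpret t: bounded_bilinear t using t by (rule bounded_bilinear_tensor)
  case (step c z g)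
  then obtain x0 y where z: "z = (t x0 y, t (X x0) y)" by auto
  define x' where "x' = c *\<^sub>R x0"
  have cz: "c *\<^sub>R z = (t x' y, t (X x') y)"
    by (simp add: z x'_def t.scaleR_left blinfun.scaleR_right)
  from step obtain F x where F: "finite F" "orthonormal F"
    and g: "g = (\<Sum>f\<in>F. t (x f) f, \<Sum>f\<in>F. t (X (x f)) f)" by auto
  define p where "p = (\<Sum>f\<in>F. cinner f y *\<^sub>C f)"
  have residual: "cinner f (y - p) = 0" if "f \<in> F" for f
    unfolding p_def using F that by (intro orthonormal_residual)
  \<comment> \<open>The part \<open>p\<close> of \<open>y\<close> in the span of \<open>F\<close> is
    absorbed by the existing coefficients; a nonzero residual contributes one new unit vector
    \<open>e\<close> with coefficient \<open>r *\<^sub>R x'\<close>.\<close>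
  define x1 where "x1 = (\<lambda>f. x f + cinner f y *\<^sub>C x')"
  have sums: "(\<Sum>f\<in>F. t (x1 f) f) = (\<Sum>f\<in>F. t (x f) f) + t x' p"
    "(\<Sum>f\<in>F. t (X (x1 f)) f) = (\<Sum>f\<in>F. t (X (x f)) f) + t (X x') p"
    by (simp_all add: x1_def p_def t.add_left t.sum_right hilbert_tensorD(3,4)[OF t] sum.distrib
        blinfun.add_right bounded_ops_scaleC[OF X])
  show ?case
  proof (cases "y = p")
    case True
    then show ?thesis
      using F by (intro exI[of _ F] exI[of _ x1]) (simp add: cz g sums add.commute)
  next
    case False
    define r where "r = norm (y - p)"
    define e where "e = (1 / r) *\<^sub>R (y - p)"
    have r: "r > 0" using False by (simp add: r_def)
    have ee: "cinner e e = 1"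
      using r by (simp add: cinner_self e_def r_def)
    have fe: "cinner f e = 0" if "f \<in> F" for f
      by (simp add: e_def cinner_scaleR_right residual[OF that])
    have ef: "cinner e f = 0" if "f \<in> F" for f
      using fe[OF that] cinner_commute[of e f] by simp
    have eF: "e \<notin> F" using ee fe by force
    have re: "y - p = r *\<^sub>R e" using r by (simp add: e_def)
    have "t x' y = t x' p + t (r *\<^sub>R x') e" "t (X x') y = t (X x') p + t (X (r *\<^sub>R x')) e"
      using arg_cong[OF re, of "t x'"] arg_cong[OF re, of "t (X x')"]
      by (simp_all add: t.diff_right t.scaleR_right t.scaleR_left blinfun.scaleR_right algebra_simps)
    moreover have "(\<Sum>f\<in>F. t ((x1(e := v)) f) f) = (\<Sum>f\<in>F. t (x1 f) f)"
      "(\<Sum>f\<in>F. t (X ((x1(e := v)) f)) f) = (\<Sum>f\<in>F. t (X (x1 f)) f)" for v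
      by (rule sum.cong; use eF in auto)+
    ultimately show ?thesis
      using F eF sums
      by (intro exI[of _ "insert e F"] exI[of _ "x1(e := r *\<^sub>R x')"])
        (auto simp: cz g orthonormal_def ee ef fe add_ac simp del: fun_upd_apply, simp_all)
  qed
qed

text \<open>The graph of \<open>X\<close> acting on the first factor is bounded by
  \<open>norm X\<close> once its elements have orthonormal second factors. This bound contains
  well-definedness, and density does the rest.\<close>

lemma tensor_left_exists:
  fixes t :: "'h::chilbert_space \<Rightarrow> 'k::chilbert_space \<Rightarrow> 'l::chilbert_space"
  assumes t: "hilbert_tensor t" and X: "X \<in> bounded_ops"
  shows "\<exists>Z\<in>bounded_ops. \<forall>x y. blinfun_apply Z (t x y) = t (X x) y"
proof -
  let ?B = "{(t x y, t (X x) y) | x y. True}"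
  interpret t: bounded_bilinear t using t by (rule bounded_bilinear_tensor)
  \<comment> \<open>Simple tensors absorb complex scalars, so their complex span is a real span,
    which is what the graph argument handles.\<close>
  have gen: "{c *\<^sub>C z | c z. z \<in> {t x y | x y. True}} = {t x y | x y. True}"
  proof (intro equalityI subsetI)
    fix z assume "z \<in> {t x y | x y. True}"
    then show "z \<in> {c *\<^sub>C z | c z. z \<in> {t x y | x y. True}}"
      by (intro CollectI exI[of _ 1] exI[of _ z]) simp
  next
    fix z assume "z \<in> {c *\<^sub>C z | c z. z \<in> {t x y | x y. True}}"
    then obtain c x y where "z = t (c *\<^sub>C x) y"
      by (auto simp: hilbert_tensorD(3)[OF t])
    then show "z \<in> {t x y | x y. True}" by blast
  qed
  have "fst ` span ?B = span (fst ` ?B)"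
    by (rule linear_span_image[symmetric]) (simp add: bounded_linear.linear bounded_linear_fst)
  also have "fst ` ?B = {t x y | x y. True}" by force
  finally have dense: "closure (fst ` span ?B) = UNIV"
    using hilbert_tensorD(6)[OF t] unfolding cspan_def gen by simp
  have bound: "norm w \<le> norm X * norm u" if uw: "(u, w) \<in> span ?B" for u w
  proof -
    obtain F x where F: "finite F" "orthonormal F"
      and u: "u = (\<Sum>f\<in>F. t (x f) f)" and w: "w = (\<Sum>f\<in>F. t (X (x f)) f)"
      using tensor_left_span_form[OF t uw X] by auto
    have "(norm w)\<^sup>2 = (\<Sum>f\<in>F. (norm (X (x f)))\<^sup>2)"
      unfolding w by (rule norm_tensor_orthonormal_sum[OF t F(2,1)])
    also have "\<dots> \<le> (\<Sum>f\<in>F. (norm X)\<^sup>2 * (norm (x f))\<^sup>2)"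
      by (intro sum_mono) (metis norm_blinfun norm_ge_zero power_mono power_mult_distrib)
    also have "\<dots> = (norm X * norm u)\<^sup>2"
      unfolding u power_mult_distrib norm_tensor_orthonormal_sum[OF t F(2,1)]
      by (simp add: sum_distrib_left)
    finally show ?thesis by (rule power2_le_imp_le) simp
  qed
  from dense_graph_extension[OF subspace_span dense bound]
  obtain Z where Z: "\<forall>z\<in>span ?B. blinfun_apply Z (fst z) = snd z" ..
  have Zt: "Z (t x y) = t (X x) y" for x y
    using Z[rule_format, of "(t x y, t (X x) y)"] by (auto intro: span_base)
  \<comment> \<open>The extension is only real-linear by construction; complex linearity is
    recovered on simple tensors by density.\<close>
  have "Z \<in> bounded_ops"
  proof (rule bounded_opsI)
    fix c v
    show "Z (c *\<^sub>C v) = c *\<^sub>C Z v"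
    proof (rule dense_cspan_induct[OF hilbert_tensorD(6)[OF t], of "\<lambda>v. \<forall>c. Z (c *\<^sub>C v) = c *\<^sub>C Z v", THEN spec])
      show "closed {v. \<forall>c. Z (c *\<^sub>C v) = c *\<^sub>C Z v}"
        by (intro closed_Collect_all closed_Collect_eq continuous_intros
          scaleC.continuous_on)
    qed (auto simp: Zt hilbert_tensorD(3)[OF t, symmetric] bounded_ops_scaleC[OF X] scaleC_add_right
        blinfun.add_right scaleC_scaleC scaleC.zero_right)
  qed
  then show ?thesis using Zt by blast
qed

text \<open>The product of X \<otimes> 1 and 1 \<otimes> Y serves as witness, and density of the
  simple tensors gives uniqueness; hence the description in \<open>op_tensor\<close> is
  proper.\<close>

lemma op_tensor_exists:
  assumes t: "hilbert_tensor t" and X: "X \<in> bounded_ops" and Y: "Y \<in> bounded_ops"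
  shows "\<exists>!Z. Z \<in> bounded_ops \<and> (\<forall>x y. blinfun_apply Z (t x y) = t (X x) (Y y))"
proof -
  obtain V where V: "V \<in> bounded_ops" "\<And>x y. blinfun_apply V (t x y) = t (X x) y"
    using tensor_left_exists[OF t X] by blast
  obtain W where W: "W \<in> bounded_ops" "\<And>x y. blinfun_apply W (t x y) = t x (Y y)"
    using tensor_left_exists[OF hilbert_tensor_flip[OF t] Y] by blast
  show ?thesis
  proof (rule ex1I[of _ "V o\<^sub>L W"])
    show "V o\<^sub>L W \<in> bounded_ops \<and> (\<forall>x y. (V o\<^sub>L W) (t x y) = t (X x) (Y y))"
      using V W by (simp add: bounded_ops_compose)
    show "Z = V o\<^sub>L W" if "Z \<in> bounded_ops \<and> (\<forall>x y. blinfun_apply Z (t x y) = t (X x) (Y y))" for Z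
      by (rule bounded_ops_eqI[OF _ _ hilbert_tensorD(6)[OF t]])
        (use that V W in \<open>auto simp: bounded_ops_compose\<close>)
  qed
qed

lemma op_tensor:
  assumes "hilbert_tensor t" "X \<in> bounded_ops" "Y \<in> bounded_ops"
  shows op_tensor_bounded_ops: "op_tensor t X Y \<in> bounded_ops"
    and op_tensor_apply: "blinfun_apply (op_tensor t X Y) (t x y) = t (X x) (Y y)"
  using theI'[OF op_tensor_exists[OF assms]] by (auto simp: op_tensor_def)

lemma op_tensor_eqI:
  assumes "hilbert_tensor t" "X \<in> bounded_ops" "Y \<in> bounded_ops" "Z \<in> bounded_ops"
    and "\<And>x y. blinfun_apply Z (t x y) = t (blinfun_apply X x) (blinfun_apply Y y)"
  shows "op_tensor t X Y = Z"
  using op_tensor[OF assms(1-3)] assms(4,5) op_tensor_exists[OF assms(1-3)] by blast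

lemma op_tensor_id: "hilbert_tensor t \<Longrightarrow> op_tensor t id_blinfun id_blinfun = id_blinfun"
  by (rule op_tensor_eqI) (auto simp: bounded_ops_id)

lemma op_tensor_add_left:
  assumes t: "hilbert_tensor t" and "X \<in> bounded_ops" "X' \<in> bounded_ops" "Y \<in> bounded_ops"
  shows "op_tensor t (X + X') Y = op_tensor t X Y + op_tensor t X' Y"
  using assms by (intro op_tensor_eqI)
    (auto simp: bounded_ops_add op_tensor_bounded_ops op_tensor_apply blinfun.add_left
      hilbert_tensorD[OF t])

lemma op_tensor_add_right:
  assumes t: "hilbert_tensor t" and "X \<in> bounded_ops" "Y \<in> bounded_ops" "Y' \<in> bounded_ops"
  shows "op_tensor t X (Y + Y') = op_tensor t X Y + op_tensor t X Y'"
  using assms by (intro op_tensor_eqI)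
    (auto simp: bounded_ops_add op_tensor_bounded_ops op_tensor_apply blinfun.add_left
      hilbert_tensorD[OF t])

lemma projection_op_tensor:
  assumes t: "hilbert_tensor t" and P: "projection_op P" and Q: "projection_op Q"
  shows "projection_op (op_tensor t P Q)"
proof (rule projection_opI)
  let ?Z = "op_tensor t P Q"
  note Z = op_tensor[OF t projection_opD(1)[OF P] projection_opD(1)[OF Q]]
  note dense = hilbert_tensorD(6)[OF t]
  show "?Z \<in> bounded_ops" by (rule Z)
  have "?Z o\<^sub>L ?Z = ?Z"
    by (rule bounded_ops_eqI[OF _ _ dense])
      (auto simp: Z bounded_ops_compose projection_opD[OF P] projection_opD[OF Q])
  then show "?Z (?Z x) = ?Z x" for x by (metis blinfun_apply_blinfun_compose)
  show "cinner (?Z u) v = cinner u (?Z v)" for u v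
  proof (rule dense_cspan_induct[OF dense, of "\<lambda>u. cinner (?Z u) v = cinner u (?Z v)"])
    show "closed {u. cinner (?Z u) v = cinner u (?Z v)}"
      by (intro closed_Collect_eq cinner.continuous_on continuous_intros)
    fix u assume "u \<in> {t x y | x y. True}"
    then obtain x y where u: "u = t x y" by auto
    show "cinner (?Z u) v = cinner u (?Z v)"
    proof (rule dense_cspan_induct[OF dense, of "\<lambda>v. cinner (?Z u) v = cinner u (?Z v)"])
      show "closed {v. cinner (?Z u) v = cinner u (?Z v)}"
        by (intro closed_Collect_eq cinner.continuous_on continuous_intros)
    qed (auto simp: u Z cinner_simps blinfun.add_right bounded_ops_scaleC[OF Z(1)]
        hilbert_tensorD(5)[OF t] projection_opD[OF P] projection_opD[OF Q] cinner.zero_right)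
  qed (auto simp: cinner_simps blinfun.add_right bounded_ops_scaleC[OF Z(1)] cinner.zero_left)
qed

lemma subset_bicommutant: "M \<subseteq> bounded_ops \<Longrightarrow> M \<subseteq> commutant (commutant M)"
  unfolding commutant_def by auto

lemma op_tensor_in_algebra_tensor:
  assumes "hilbert_tensor t" "M \<subseteq> bounded_ops" "N \<subseteq> bounded_ops" "X \<in> M" "Y \<in> N"
  shows "op_tensor t X Y \<in> algebra_tensor t M N"
  unfolding algebra_tensor_def
  by (rule subset_bicommutant[THEN subsetD]) (use assms op_tensor_bounded_ops in blast)+

subsection \<open>Projection-valued measures\<close>

context
  fixes E :: "real set \<Rightarrow> ('a::chilbert_space \<Rightarrow>\<^sub>L 'a)"
  assumes E: "projection_valued_measure E"
begin

lemma pvm_projection: "S \<in> sets borel \<Longrightarrow> projection_op (E S)"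
  using E by (simp add: projection_valued_measure_def)

lemma pvm_UNIV: "E UNIV = id_blinfun"
  using E by (simp add: projection_valued_measure_def)

lemma pvm_sums:
  "range F \<subseteq> sets borel \<Longrightarrow> disjoint_family F \<Longrightarrow> (\<lambda>n::nat. E (F n) v) sums E (\<Union>n. F n) v"
  using E by (simp add: projection_valued_measure_def)

lemma pvm_empty: "E {} = 0"
proof (rule blinfun_eqI)
  fix v
  have "(\<lambda>n::nat. E {} v) sums E (\<Union>n::nat. {}) v"
    by (rule pvm_sums) (auto simp: disjoint_family_on_def)
  \<comment> \<open>A constant series converges only if its terms vanish.\<close>
  then have "summable (\<lambda>n::nat. E {} v)" by (rule sums_summable)
  then show "E {} v = blinfun_apply 0 v" by (simp add: summable_const_iff)
qed

lemma pvm_Un: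
  assumes "S \<in> sets borel" "S' \<in> sets borel" "S \<inter> S' = {}"
  shows "E (S \<union> S') v = E S v + E S' v"
proof -
  have "(\<lambda>n. E (binaryset S S' n) v) sums E (\<Union>n. binaryset S S' n) v"
    using assms by (intro pvm_sums) (auto simp: disjoint_family_on_def binaryset_def)
  moreover have "(\<lambda>n. E (binaryset S S' n) v) sums (E S v + E S' v)"
    by (rule binaryset_sums) (simp add: pvm_empty)
  ultimately show ?thesis
    by (simp add: sums_unique2 UN_binaryset_eq)
qed

text \<open>For \<open>w\<close> in the range of \<open>E S'\<close>, additivity gives that the
  squared norm of \<open>E (S \<union> S') w\<close> is the sum of those of \<open>E S w\<close> and
  \<open>w\<close>; a projection cannot increase the norm, so \<open>E S w\<close> vanishes.
  Multiplicativity of \<open>E\<close> follows from this.\<close>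

lemma pvm_orthogonal:
  assumes "S \<in> sets borel" "S' \<in> sets borel" "S \<inter> S' = {}"
  shows "E S (E S' v) = 0"
proof -
  let ?w = "E S' v"
  have P: "projection_op (E S)" "projection_op (E S')" "projection_op (E (S \<union> S'))"
    using assms by (auto intro: pvm_projection)
  have "E (S \<union> S') ?w = E S ?w + ?w"
    using pvm_Un[OF assms] projection_opD(2)[OF P(2)] by simp
  then have "cinner ?w (E (S \<union> S') ?w) = cinner ?w (E S ?w) + cinner ?w ?w"
    by (simp add: cinner_simps)
  then have "complex_of_real ((norm (E (S \<union> S') ?w))\<^sup>2) =
      complex_of_real ((norm (E S ?w))\<^sup>2 + (norm ?w)\<^sup>2)"
    using projection_opD(4)[OF P(3), of ?w] projection_opD(4)[OF P(1), of ?w]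
    by (simp add: cinner_self)
  then have "(norm (E (S \<union> S') ?w))\<^sup>2 = (norm (E S ?w))\<^sup>2 + (norm ?w)\<^sup>2"
    by (simp only: of_real_eq_iff)
  moreover have "(norm (E (S \<union> S') ?w))\<^sup>2 \<le> (norm ?w)\<^sup>2"
    by (intro power_mono projection_op_norm_apply P) simp
  ultimately show ?thesis by simp
qed

lemma pvm_Int:
  assumes "S \<in> sets borel" "S' \<in> sets borel"
  shows "E S (E S' v) = E (S \<inter> S') v"
proof -
  have [measurable]: "S \<inter> S' \<in> sets borel" "S' - S \<in> sets borel" "S - S' \<in> sets borel"
    using assms by auto
  have "E S' v = E (S \<inter> S') v + E (S' - S) v"
    by (subst pvm_Un[symmetric]) (auto intro!: arg_cong[of _ _ "\<lambda>S. blinfun_apply (E S) v"])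
  then have "E S (E S' v) = E S (E (S \<inter> S') v)"
    using pvm_orthogonal[OF assms(1), of "S' - S"] by (simp add: blinfun.add_right)
  also have "\<dots> = E (S \<inter> S') (E (S \<inter> S') v) + E (S - S') (E (S \<inter> S') v)"
    by (subst pvm_Un[symmetric]) (auto intro!: arg_cong[of _ _ "\<lambda>S. blinfun_apply (E S) _"])
  also have "E (S - S') (E (S \<inter> S') v) = 0"
    by (rule pvm_orthogonal) auto
  finally show ?thesis
    by (simp add: projection_opD[OF pvm_projection])
qed

lemma pvm_Compl:
  assumes "S \<in> sets borel"
  shows "E (- S) v = v - E S v"
  using pvm_Un[of S "- S" v] assms by (simp add: pvm_UNIV Compl_partition algebra_simps)

lemma sets_scalar_measure [measurable_cong, simp]: "sets (scalar_measure E v) = sets borel"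
  unfolding scalar_measure_def
  by (metis sets.sigma_sets_eq sets_measure_of space_borel sets.space_closed)

lemma space_scalar_measure [simp]: "space (scalar_measure E v) = UNIV"
  using sets_eq_imp_space_eq[OF sets_scalar_measure] by simp

text \<open>\<open>measure_of\<close> takes the prescribed values only for a countably additive set
  function; here this comes from strong additivity of \<open>E\<close> under the continuous
  functional \<open>Re (cinner v x)\<close>.\<close>

lemma emeasure_scalar_measure:
  assumes "S \<in> sets borel"
  shows "emeasure (scalar_measure E v) S = ennreal ((norm (E S v))\<^sup>2)"
proof -
  let ?\<mu> = "\<lambda>S. ennreal (Re (cinner v (E S v)))"
  have "emeasure (scalar_measure E v) S = ?\<mu> S"
    unfolding scalar_measure_def
  proof (rule emeasure_measure_of_sigma[OF _ _ _ assms])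
    show "sigma_algebra UNIV (sets borel)"
      using sets.sigma_algebra_axioms[of borel] by simp
    show "positive (sets borel) ?\<mu>"
      by (simp add: positive_def pvm_empty)
    show "countably_additive (sets borel) ?\<mu>"
      unfolding countably_additive_def
    proof (intro allI impI)
      fix F :: "nat \<Rightarrow> real set"
      assume F: "range F \<subseteq> sets borel" "disjoint_family F" "\<Union> (range F) \<in> sets borel"
      have "bounded_linear (\<lambda>x. Re (cinner v x))"
        by (intro bounded_linear_compose[OF bounded_linear_Re] cinner.bounded_linear_right)
      from bounded_linear.sums[OF this pvm_sums[OF F(1,2), of v]]
      have "(\<lambda>n. Re (cinner v (E (F n) v))) sums Re (cinner v (E (\<Union> (range F)) v))" .
      moreover have "0 \<le> Re (cinner v (E (F n) v))" for n
        using F(1) projection_opD(4)[OF pvm_projection, of "F n" v] by auto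
      ultimately show "(\<Sum>n. ?\<mu> (F n)) = ?\<mu> (\<Union> (range F))"
        by (intro suminf_ennreal_eq)
    qed
  qed
  then show ?thesis using projection_opD(4)[OF pvm_projection[OF assms], of v] by simp
qed

lemma finite_measure_scalar_measure: "finite_measure (scalar_measure E v)"
  by (rule finite_measureI) (simp add: emeasure_scalar_measure)

text \<open>Projecting the vector restricts its measure to \<open>S\<close>, so the form of an
  operator on the range of \<open>E S\<close> becomes an integral over \<open>S\<close>.\<close>

lemma scalar_measure_projected:
  assumes S: "S \<in> sets borel"
  shows "scalar_measure E (E S v) = density (scalar_measure E v) (\<lambda>l. ennreal (indicator S l))"
proof (rule measure_eqI)
  fix T assume "T \<in> sets (scalar_measure E (E S v))"
  then have T: "T \<in> sets borel" by simp
  have "emeasure (density (scalar_measure E v) (\<lambda>l. ennreal (indicator S l))) T =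
      (\<integral>\<^sup>+ l. ennreal (indicator S l) * indicator T l \<partial>scalar_measure E v)"
    using S T by (intro emeasure_density) auto
  also have "\<dots> = (\<integral>\<^sup>+ l. indicator (T \<inter> S) l \<partial>scalar_measure E v)"
    by (intro nn_integral_cong) (auto simp: indicator_def)
  also have "\<dots> = emeasure (scalar_measure E v) (T \<inter> S)"
    using S T by (intro nn_integral_indicator) auto
  finally show "emeasure (scalar_measure E (E S v)) T =
      emeasure (density (scalar_measure E v) (\<lambda>l. ennreal (indicator S l))) T"
    using S T by (simp add: emeasure_scalar_measure pvm_Int)
qed simp

text \<open>The squared norms of the remainders \<open>E (?D n) v\<close> are scalar measures of
  sets decreasing to the empty set.\<close>

lemma pvm_tendsto_incseq:
  assumes F: "range F \<subseteq> sets borel" "incseq F"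
  shows "(\<lambda>n::nat. E (F n) v) \<longlonglongrightarrow> E (\<Union>n. F n) v"
proof -
  let ?D = "\<lambda>n. (\<Union>n. F n) - F n"
  have D: "range ?D \<subseteq> sets borel" using F by auto
  have eq: "E (\<Union>n. F n) v = E (F n) v + E (?D n) v" for n
    using F D by (subst pvm_Un[symmetric])
      (auto intro!: arg_cong[of _ _ "\<lambda>S. blinfun_apply (E S) v"] image_subset_iff)
  have "(\<lambda>n. emeasure (scalar_measure E v) (?D n)) \<longlonglongrightarrow> emeasure (scalar_measure E v) (\<Inter>n. ?D n)"
    using F D by (intro Lim_emeasure_decseq)
      (auto simp: decseq_def incseq_def emeasure_scalar_measure image_subset_iff)
  moreover have "(\<Inter>n. ?D n) = {}" by auto
  ultimately have "(\<lambda>n. ennreal ((norm (E (?D n) v))\<^sup>2)) \<longlonglongrightarrow> ennreal 0"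
    using D by (simp add: emeasure_scalar_measure image_subset_iff)
  then have "(\<lambda>n. (norm (E (?D n) v))\<^sup>2) \<longlonglongrightarrow> 0"
    by (rule tendsto_ennrealD) auto
  then have "(\<lambda>n. sqrt ((norm (E (?D n) v))\<^sup>2)) \<longlonglongrightarrow> sqrt 0"
    by (intro tendsto_real_sqrt)
  then have "(\<lambda>n. E (?D n) v) \<longlonglongrightarrow> 0"
    by (simp add: tendsto_norm_zero_iff)
  then have "(\<lambda>n. E (\<Union>n. F n) v - E (?D n) v) \<longlonglongrightarrow> E (\<Union>n. F n) v - 0"
    by (intro tendsto_intros)
  moreover have "E (\<Union>n. F n) v - E (?D n) v = E (F n) v" for n
    unfolding eq[of n] by simp
  ultimately show ?thesis by simp
qed

end

subsection \<open>Spectral measures of a bounded operator\<close>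

context
  fixes X :: "'a::chilbert_space \<Rightarrow>\<^sub>L 'a" and E
  assumes X: "X \<in> bounded_ops" and XE: "spectral_measure X E"
begin

lemma spectral_measure_pvm: "projection_valued_measure E"
  using XE by (simp add: spectral_measure_def)

lemma spectral_measure_form:
  "integrable (scalar_measure E v) (\<lambda>l. l)"
  "cinner v (X v) = complex_of_real (\<integral>l. l \<partial>scalar_measure E v)"
  using XE by (auto simp: spectral_measure_def)

lemma spectral_measure_form_projected:
  assumes S: "S \<in> sets borel"
  shows "cinner (E S v) (X (E S v)) = complex_of_real (\<integral>l. indicator S l * l \<partial>scalar_measure E v)"
  using S unfolding spectral_measure_form scalar_measure_projected[OF spectral_measure_pvm S]
  by (subst integral_density)
    (auto simp: measurable_cong_sets[OF sets_scalar_measure[OF spectral_measure_pvm] refl])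

lemma spectral_measure_form_split:
  assumes S: "S \<in> sets borel"
  shows "cinner v (X v) = cinner (E S v) (X (E S v)) + cinner (E (- S) v) (X (E (- S) v))"
proof -
  let ?M = "scalar_measure E v"
  have int: "integrable ?M (\<lambda>l. indicator T l * l)" if "T \<in> sets borel" for T
    using integrable_mult_indicator[OF _ spectral_measure_form(1), of T v] that
    by (simp add: sets_scalar_measure[OF spectral_measure_pvm])
  have "(\<integral>l. l \<partial>?M) = (\<integral>l. indicator S l * l + indicator (- S) l * l \<partial>?M)"
    by (rule Bochner_Integration.integral_cong) (auto simp: indicator_def)
  also have "\<dots> = (\<integral>l. indicator S l * l \<partial>?M) + (\<integral>l. indicator (- S) l * l \<partial>?M)"
    using S int by (intro Bochner_Integration.integral_add) (auto simp: borel_comp)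
  finally show ?thesis
    using S by (simp add: spectral_measure_form_projected spectral_measure_form(2)[of v] borel_comp)
qed

text \<open>Only diagonal elements of \<open>X\<close> are given by the spectral integral. Splitting
  the form at \<open>x + z\<close> shows that the two cross terms cancel; the choices
  \<open>z = y\<close> and \<open>z = \<i> *\<^sub>C y\<close> then make each of them
  vanish.\<close>

lemma spectral_measure_off_diagonal:
  assumes S: "S \<in> sets borel" and x: "E S x = x" and y: "E (- S) y = y"
  shows "cinner x (X y) = 0"
proof -
  have cross: "cinner x (X z) + cinner z (X x) = 0" if z: "E (- S) z = z" for z
  proof -
    have "E S z = 0" "E (- S) x = 0"
      using pvm_Compl[OF spectral_measure_pvm S, of z] pvm_Compl[OF spectral_measure_pvm S, of x] x z
      by auto
    then show ?thesis
      using spectral_measure_form_split[OF S, of "x + z"] x z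
      by (simp add: blinfun.add_right cinner_simps add.commute)
  qed
  have "E (- S) (\<i> *\<^sub>C y) = \<i> *\<^sub>C y"
    using projection_opD(1)[OF pvm_projection[OF spectral_measure_pvm], of "- S"] S y
    by (simp add: bounded_ops_scaleC borel_comp)
  from cross[OF this] have "\<i> * (cinner x (X y) - cinner y (X x)) = 0"
    by (simp add: bounded_ops_scaleC[OF X] cinner_simps algebra_simps)
  then show ?thesis using cross[OF y] by simp
qed

text \<open>No matrix element of \<open>X\<close> links the ranges of \<open>E S\<close> and
  \<open>E (- S)\<close>, so both ranges are invariant under \<open>X\<close>.\<close>

lemma spectral_measure_commute:
  assumes S: "S \<in> sets borel"
  shows "X (E S v) = E S (X v)"
proof -
  have mixed: "E S' (X (E (- S') w)) = 0" if S': "S' \<in> sets borel" for S' w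
  proof (rule cinner_eqI)
    fix u
    have P: "projection_op (E S')" "projection_op (E (- S'))"
      using S' by (auto intro!: pvm_projection[OF spectral_measure_pvm] borel_comp)
    have "cinner (E S' u) (X (E (- S') w)) = 0"
      using S' P by (intro spectral_measure_off_diagonal[of S']) (auto simp: projection_opD)
    then show "cinner u (E S' (X (E (- S') w))) = cinner u 0"
      by (simp add: projection_opD(3)[OF P(1)])
  qed
  have "X v = X (E S v) + X (E (- S) v)"
    using pvm_Compl[OF spectral_measure_pvm S, of v] by (simp add: blinfun.diff_right)
  then have "E S (X v) = E S (X (E S v))"
    using mixed[OF S] by (simp add: blinfun.add_right)
  also have "\<dots> = X (E S v)"
    using mixed[of "- S" v] pvm_Compl[OF spectral_measure_pvm S, of "X (E S v)"] S
    by (simp add: borel_comp)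
  finally show ?thesis by simp
qed

lemma spectral_measure_norm_sq:
  "measure (scalar_measure E v) UNIV = (norm v)\<^sup>2"
  by (simp add: measure_def emeasure_scalar_measure[OF spectral_measure_pvm]
      pvm_UNIV[OF spectral_measure_pvm])

lemma spectral_measure_AE:
  assumes S: "S \<in> sets borel" and v: "E S v = v"
  shows "AE l in scalar_measure E v. l \<in> S"
proof (rule AE_I)
  show "{l \<in> space (scalar_measure E v). l \<notin> S} \<subseteq> - S" by auto
  show "emeasure (scalar_measure E v) (- S) = 0" "- S \<in> sets (scalar_measure E v)"
    using S v pvm_Compl[OF spectral_measure_pvm S, of v]
    by (auto simp: emeasure_scalar_measure[OF spectral_measure_pvm] borel_comp
        sets_scalar_measure[OF spectral_measure_pvm])
qed

lemma spectral_measure_lower_bound: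
  assumes S: "S \<in> sets borel" and v: "E S v = v" and t: "\<And>l. l \<in> S \<Longrightarrow> t \<le> l"
  shows "t * (norm v)\<^sup>2 \<le> Re (cinner v (X v))"
proof -
  interpret finite_measure "scalar_measure E v"
    by (rule finite_measure_scalar_measure[OF spectral_measure_pvm])
  have "(\<integral>l. t \<partial>scalar_measure E v) \<le> (\<integral>l. l \<partial>scalar_measure E v)"
    using spectral_measure_AE[OF S v] t
    by (intro integral_mono_AE spectral_measure_form(1)) auto
  then show ?thesis
    by (simp add: spectral_measure_form(2) spectral_measure_norm_sq mult.commute
        space_scalar_measure[OF spectral_measure_pvm])
qed

lemma spectral_measure_upper_bound:
  assumes S: "S \<in> sets borel" and v: "E S v = v" and t: "\<And>l. l \<in> S \<Longrightarrow> l \<le> t"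
  shows "Re (cinner v (X v)) \<le> t * (norm v)\<^sup>2"
proof -
  interpret finite_measure "scalar_measure E v"
    by (rule finite_measure_scalar_measure[OF spectral_measure_pvm])
  have "(\<integral>l. l \<partial>scalar_measure E v) \<le> (\<integral>l. t \<partial>scalar_measure E v)"
    using spectral_measure_AE[OF S v] t
    by (intro integral_mono_AE spectral_measure_form(1)) auto
  then show ?thesis
    by (simp add: spectral_measure_form(2) spectral_measure_norm_sq mult.commute
        space_scalar_measure[OF spectral_measure_pvm])
qed

end

text \<open>If \<open>C\<close> is at least \<open>t\<close> on the range of \<open>P\<close> and at most \<open>s < t\<close> on that of \<open>Q\<close>, then
  \<open>Z = P Y Q\<close> satisfies \<open>t \<parallel>Z\<parallel> \<le> \<parallel>C Z\<parallel> = \<parallel>Z C Q\<parallel> \<le> s \<parallel>Z\<parallel>\<close>.\<close>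

lemma separated_projections_intertwiner:
  fixes C Y P Q :: "'a::chilbert_space \<Rightarrow>\<^sub>L 'a"
  assumes C: "positive_op C" and P: "projection_op P" and Q: "projection_op Q"
    and CP: "\<And>x. blinfun_apply C (P x) = P (C x)" and CQ: "\<And>x. blinfun_apply C (Q x) = Q (C x)"
    and CY: "\<And>x. blinfun_apply C (Y x) = Y (C x)"
    and lower: "\<And>x. blinfun_apply P x = x \<Longrightarrow> t * (norm x)\<^sup>2 \<le> Re (cinner x (C x))"
    and upper: "\<And>x. blinfun_apply Q x = x \<Longrightarrow> Re (cinner x (C x)) \<le> s * (norm x)\<^sup>2"
    and st: "0 \<le> s" "s < t"
  shows "P (Y (Q x)) = 0"
proof -
  define Z where "Z = P o\<^sub>L Y o\<^sub>L Q"
  have Z: "Z x = P (Y (Q x))" for x by (simp add: Z_def)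
  have bound: "norm (Z x) \<le> s / t * norm Z * norm x" for x
  proof -
    have "t * (norm (Z x))\<^sup>2 \<le> Re (cinner (Z x) (C (Z x)))"
      by (rule lower) (simp add: Z projection_opD[OF P])
    also have "\<dots> \<le> norm (Z x) * norm (C (Z x))"
      using complex_Re_le_cmod cinner_Cauchy_Schwarz order_trans by blast
    finally have "t * norm (Z x) \<le> norm (C (Z x))"
      by (cases "Z x = 0") (simp_all add: power2_eq_square)
    also have "C (Z x) = Z (C (Q x))"
      by (simp add: Z CP CQ CY projection_opD[OF Q])
    also have "norm (Z (C (Q x))) \<le> norm Z * norm (C (Q x))"
      by (rule norm_blinfun)
    also have "\<dots> \<le> norm Z * (s * norm (Q x))"
      using C st by (intro mult_left_mono norm_le_of_positive_form upper positive_opD)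
        (auto simp: CQ projection_opD[OF Q])
    also have "\<dots> \<le> norm Z * (s * norm x)"
      using st by (intro mult_left_mono projection_op_norm_apply[OF Q]) auto
    finally show ?thesis
      using st by (simp add: field_simps)
  qed
  have "norm Z \<le> s / t * norm Z"
    by (rule norm_blinfun_bound[OF _ bound]) (use st in auto)
  then have "norm Z * (t - s) \<le> 0"
    using st by (simp add: field_simps)
  then have "Z = 0"
    using st by (simp add: mult_le_0_iff)
  then show ?thesis using Z[of x] by simp
qed

section \<open>Intertwining and uniqueness of spectral measures\<close>

text \<open>The separation argument concerns positive operators; a shift by a multiple of the
  identity brings \<open>X\<close> and \<open>- X\<close> within its reach and preserves commutation
  relations.\<close>

lemma positive_op_shift:
  assumes X: "hermitean X" and M: "norm X \<le> M"
  shows "positive_op (M *\<^sub>R id_blinfun + X)"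
  unfolding positive_op_def
proof (intro conjI allI)
  have XB: "X \<in> bounded_ops" using X by (simp add: hermitean_def)
  then show "M *\<^sub>R id_blinfun + X \<in> bounded_ops"
    by (intro bounded_ops_add bounded_ops_scaleR bounded_ops_id)
  fix v
  have "cinner v (X v) = cnj (cinner v (X v))"
    using X cinner_commute[of "X v" v] by (simp add: hermitean_def is_adjoint_def)
  then have im: "Im (cinner v (X v)) = 0" by (simp add: complex_eq_iff)
  have "cmod (cinner v (X v)) \<le> norm v * (norm X * norm v)"
    by (rule order_trans[OF cinner_Cauchy_Schwarz mult_left_mono[OF norm_blinfun]]) simp
  also have "\<dots> \<le> norm v * (M * norm v)"
    using M by (intro mult_left_mono mult_right_mono) auto
  finally have "- Re (cinner v (X v)) \<le> M * (norm v)\<^sup>2"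
    using abs_Re_le_cmod[of "cinner v (X v)"] by (simp add: power2_eq_square mult_ac)
  then show "cinner v ((M *\<^sub>R id_blinfun + X) v) \<in> \<real>\<^sub>\<ge>\<^sub>0"
    using im by (simp add: blinfun.add_left blinfun.scaleR_left cinner_simps cinner_scaleR_right
        cinner_self complex_nonneg_Reals_iff)
qed

context
  fixes X Y :: "'a::chilbert_space \<Rightarrow>\<^sub>L 'a" and E E'
  assumes X: "hermitean X" and E: "spectral_measure X E" and E': "spectral_measure X E'"
    and XY: "X o\<^sub>L Y = Y o\<^sub>L X"
begin

lemma intertwine_half_lines_strict:
  assumes "s < t"
  shows "E {t..} (Y (E' {..s} v)) = 0" "E {..s} (Y (E' {t..} v)) = 0"
proof -
  have XB: "X \<in> bounded_ops" using X by (simp add: hermitean_def)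
  have comm: "blinfun_apply X (Y x) = Y (X x)" for x
    using arg_cong[OF XY, of "\<lambda>Z. blinfun_apply Z x"] by simp
  \<comment> \<open>Large enough for both shifted operators to be positive and for both upper
    bounds, \<open>M + s\<close> and \<open>M - t\<close>, to be nonnegative.\<close>
  define M where "M = norm X + \<bar>s\<bar> + \<bar>t\<bar>"
  have M: "norm X \<le> M" "norm (- X) \<le> M" "0 \<le> M + s" "0 \<le> M - t"
    unfolding M_def norm_minus_cancel using norm_ge_zero[of X] by linarith+
  have X': "hermitean (- X)"
    using X by (auto simp: hermitean_def is_adjoint_def bounded_ops_minus blinfun.minus_left cinner_simps)
  note pvm = spectral_measure_pvm[OF XB E] spectral_measure_pvm[OF XB E']
  have proj: "projection_op (E S)" "projection_op (E' S)" if "S \<in> sets borel" for S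
    using that pvm by (auto intro: pvm_projection)
  have lower: "M * (norm x)\<^sup>2 + t * (norm x)\<^sup>2 \<le> M * (norm x)\<^sup>2 + Re (cinner x (X x))"
    if "E {t..} x = x \<or> E' {t..} x = x" for x
    using that spectral_measure_lower_bound[OF XB E, of "{t..}"]
      spectral_measure_lower_bound[OF XB E', of "{t..}"] by fastforce
  have upper: "M * (norm x)\<^sup>2 + Re (cinner x (X x)) \<le> M * (norm x)\<^sup>2 + s * (norm x)\<^sup>2"
    if "E {..s} x = x \<or> E' {..s} x = x" for x
    using that spectral_measure_upper_bound[OF XB E, of "{..s}"]
      spectral_measure_upper_bound[OF XB E', of "{..s}"] by fastforce
  note ops = blinfun.diff_left blinfun.diff_right blinfun.add_left blinfun.minus_left blinfun.scaleR_left blinfun.add_right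
    blinfun.minus_right blinfun.scaleR_right cinner_simps cinner_scaleR_right cinner_self
  show "E {t..} (Y (E' {..s} v)) = 0"
    by (rule separated_projections_intertwiner[OF positive_op_shift[OF X M(1)] proj(1) proj(2),
          where s="M + s" and t="M + t"])
      (use lower upper M assms in \<open>auto simp: ops comm spectral_measure_commute[OF XB E]
          spectral_measure_commute[OF XB E'] algebra_simps\<close>)
  \<comment> \<open>For \<open>- X\<close> the half-lines exchange their roles: the form is at least
    \<open>- s\<close> on the lower one and at most \<open>- t\<close> on the upper one.\<close>
  show "E {..s} (Y (E' {t..} v)) = 0"
    by (rule separated_projections_intertwiner[OF positive_op_shift[OF X' M(2)] proj(1) proj(2),
          where s="M - t" and t="M - s"])
      (use lower upper M assms in \<open>auto simp: ops comm spectral_measure_commute[OF XB E]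
          spectral_measure_commute[OF XB E'] algebra_simps\<close>)
qed

text \<open>The gap between the half-lines is closed by exhausting \<open>{..<t}\<close> from inside
  with closed half-lines, along which both spectral measures are strongly continuous.\<close>

lemma intertwine_half_lines:
  "E {t..} (Y (E' {..<t} v)) = 0" "E {..<t} (Y (E' {t..} v)) = 0"
proof -
  have XB: "X \<in> bounded_ops" using X by (simp add: hermitean_def)
  note pvm = spectral_measure_pvm[OF XB E] spectral_measure_pvm[OF XB E']
  let ?F = "\<lambda>n::nat. {..t - 1 / (real n + 1)}"
  have UF: "(\<Union>n. ?F n) = {..<t}"
  proof (intro equalityI subsetI)
    fix x assume "x \<in> {..<t}"
    then obtain n :: nat where "1 / (real n + 1) < t - x"
      using reals_Archimedean[of "t - x"] by (auto simp: inverse_eq_divide add.commute)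
    then show "x \<in> (\<Union>n. ?F n)" by (intro UN_I[of n]) auto
  qed (auto intro: order_le_less_trans)
  have inc: "incseq ?F" "range ?F \<subseteq> sets borel"
    by (auto simp: incseq_def frac_le intro: order_trans)
  have lt: "t - 1 / (real n + 1) < t" for n by simp
  have "(\<lambda>n. E {t..} (Y (E' (?F n) v))) \<longlonglongrightarrow> E {t..} (Y (E' (\<Union>n. ?F n) v))"
    by (intro blinfun.tendsto tendsto_const pvm_tendsto_incseq[OF pvm(2) inc(2,1)])
  then have "(\<lambda>n::nat. 0) \<longlonglongrightarrow> E {t..} (Y (E' (\<Union>n. ?F n) v))"
    by (simp only: intertwine_half_lines_strict(1)[OF lt])
  then show "E {t..} (Y (E' {..<t} v)) = 0"
    unfolding UF by (simp add: LIMSEQ_const_iff)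
  have "(\<lambda>n. E (?F n) (Y (E' {t..} v))) \<longlonglongrightarrow> E (\<Union>n. ?F n) (Y (E' {t..} v))"
    by (rule pvm_tendsto_incseq[OF pvm(1) inc(2,1)])
  then have "(\<lambda>n::nat. 0) \<longlonglongrightarrow> E (\<Union>n. ?F n) (Y (E' {t..} v))"
    by (simp only: intertwine_half_lines_strict(2)[OF lt])
  then show "E {..<t} (Y (E' {t..} v)) = 0"
    unfolding UF by (simp add: LIMSEQ_const_iff)
qed

text \<open>Half-lines form an intersection-stable generator of the Borel sets, and the sets
  satisfying the relation form a Dynkin system. Taking \<open>Y\<close> to be the identity gives
  uniqueness of the spectral measure; taking \<open>E = E'\<close> shows that it commutes with
  everything that commutes with \<open>X\<close>.\<close>

lemma spectral_measures_intertwine: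
  assumes "S \<in> sets borel"
  shows "E S (Y v) = Y (E' S v)"
proof -
  have XB: "X \<in> bounded_ops" using X by (simp add: hermitean_def)
  note pvm = spectral_measure_pvm[OF XB E] spectral_measure_pvm[OF XB E']
  have half: "E {t..} (Y v) = Y (E' {t..} v)" for t v
  proof -
    have "v = E' {t..} v + E' {..<t} v" "Y (E' {t..} v) = E {t..} (Y (E' {t..} v)) + E {..<t} (Y (E' {t..} v))"
      using pvm_Compl[OF pvm(1), of "{t..}" "Y (E' {t..} v)"] pvm_Compl[OF pvm(2), of "{t..}" v]
      by (simp_all add: Compl_atLeast)
    then show ?thesis
      using intertwine_half_lines[of t v] by (metis add.right_neutral blinfun.add_right)
  qed
  have borel: "sets borel = sigma_sets UNIV (range atLeast :: real set set)"
    using borel_Ici by (metis sets_measure_of subset_UNIV top_greatest Pow_UNIV)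
  have "Int_stable (range (atLeast :: real \<Rightarrow> _))"
  proof (rule Int_stableI)
    fix A B :: "real set" assume "A \<in> range atLeast" "B \<in> range atLeast"
    then obtain a b where "A = {a..}" "B = {b..}" by auto
    then have "A \<inter> B = {max a b..}" by auto
    then show "A \<inter> B \<in> range atLeast" by blast
  qed
  moreover have "range (atLeast :: real \<Rightarrow> _) \<subseteq> Pow UNIV" by simp
  moreover have "S \<in> sigma_sets UNIV (range atLeast)" using assms by (simp add: borel)
  ultimately have "\<forall>v. E S (Y v) = Y (E' S v)"
  proof (induction S rule: sigma_sets_induct_disjoint)
    case (basic A)
    then show ?case using half by auto
  next
    case empty
    show ?case by (simp add: pvm_empty[OF pvm(1)] pvm_empty[OF pvm(2)])
  next
    case (compl A)
    then have "A \<in> sets borel" by (simp add: borel)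
    with compl show ?case
      by (simp add: Compl_eq_Diff_UNIV[symmetric] pvm_Compl[OF pvm(1)] pvm_Compl[OF pvm(2)] blinfun.diff_right)
  next
    case (union A)
    show ?case
    proof
      fix v
      have A: "range A \<subseteq> sets borel" using union by (auto simp: borel)
      have "(\<lambda>n. E (A n) (Y v)) sums E (\<Union>n. A n) (Y v)"
        by (rule pvm_sums[OF pvm(1) A union(1)])
      moreover have "(\<lambda>n. Y (E' (A n) v)) sums Y (E' (\<Union>n. A n) v)"
        by (intro bounded_linear.sums[OF blinfun.bounded_linear_right] pvm_sums[OF pvm(2) A union(1)])
      ultimately show "E (\<Union>n. A n) (Y v) = Y (E' (\<Union>n. A n) v)"
        using union by (simp add: sums_unique2)
    qed
  qed
  then show ?thesis by simp
qed

end

lemma spectral_projection_eq: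
  assumes X: "hermitean X" and E: "spectral_measure X E" and S: "S \<in> sets borel"
  shows "spectral_projection X S = E S"
  unfolding spectral_projection_def
proof (rule the_equality)
  show "\<exists>E'. spectral_measure X E' \<and> E S = E' S" using E by blast
  fix P assume "\<exists>E. spectral_measure X E \<and> P = E S"
  then obtain E' where E': "spectral_measure X E'" "P = E' S" by blast
  have "E' S = E S"
    using spectral_measures_intertwine[OF X E'(1) E, of id_blinfun S] S
    by (intro blinfun_eqI) (auto simp: blinfun_eqI)
  then show "P = E S" using E' by simp
qed

lemma spectral_measure_in_bicommutant:
  assumes X: "hermitean X" and E: "spectral_measure X E" and S: "S \<in> sets borel"
  shows "E S \<in> commutant (commutant {X})"
proof -
  have XB: "X \<in> bounded_ops" using X by (simp add: hermitean_def)
  have "Y o\<^sub>L E S = E S o\<^sub>L Y" if "Y \<in> commutant {X}" for Y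
    using spectral_measures_intertwine[OF X E E _ S, of Y] that
    by (intro blinfun_eqI) (auto simp: commutant_def)
  moreover have "E S \<in> bounded_ops"
    by (intro projection_opD pvm_projection[OF spectral_measure_pvm[OF XB E] S])
  ultimately show ?thesis by (auto simp: commutant_def)
qed

lemma commutant_antimono: "M \<subseteq> N \<Longrightarrow> commutant N \<subseteq> commutant M"
  by (auto simp: commutant_def)

text \<open>Places the spectral projections of \<open>B\<close> in the algebra, so that their tensor
  products with bounded operators lie in the domain of the CP-map.\<close>

lemma spectral_measure_in_algebra:
  assumes "von_neumann_algebra M" "X \<in> M" "hermitean X" "spectral_measure X E" "S \<in> sets borel"
  shows "E S \<in> M"
proof -
  have "commutant (commutant {X}) \<subseteq> commutant (commutant M)"
    using assms(2) by (intro commutant_antimono) auto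
  then show ?thesis
    using spectral_measure_in_bicommutant[OF assms(3-5)] assms(1) by (auto simp: von_neumann_algebra_def)
qed

subsection \<open>Operators with an eigenbasis\<close>

text \<open>The basis may be uncountable. Integrals against counting measure turn unconditional sums
  over it into measures that can be pushed forward along the eigenvalues.\<close>

lemma has_sum_integral_count_space:
  fixes f :: "'i \<Rightarrow> real"
  assumes "(f has_sum s) UNIV"
  shows "integrable (count_space UNIV) f" "integral\<^sup>L (count_space UNIV) f = s"
proof -
  have "f summable_on UNIV" using assms by (auto simp: summable_on_def)
  then have abs: "Infinite_Set_Sum.abs_summable_on f UNIV"
    using abs_summable_equivalent[of f UNIV] summable_on_iff_abs_summable_on_real[of f UNIV] by blast
  then show "integrable (count_space UNIV) f"
    by (simp add: Infinite_Set_Sum.abs_summable_on_def)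
  show "integral\<^sup>L (count_space UNIV) f = s"
    using infsetsum_infsum[OF abs] infsumI[OF assms] by (simp add: infsetsum_def)
qed

context
  fixes \<psi> :: "'i \<Rightarrow> 'a::chilbert_space"
  assumes inj: "inj \<psi>" and onb: "is_onb (range \<psi>)"
begin

lemma eigenbasis_cinner: "cinner (\<psi> i) (\<psi> j) = of_bool (i = j)"
  using onb inj by (auto simp: is_onb_def inj_eq)

lemma eigenbasis_norm: "norm (\<psi> i) = 1"
proof -
  have "(norm (\<psi> i))\<^sup>2 = 1"
    using arg_cong[OF eigenbasis_cinner[of i i], of Re] by (simp add: Re_cinner_self)
  then show ?thesis by (simp add: power2_eq_1_iff) (use norm_ge_zero[of "\<psi> i"] in linarith)
qed

lemma eigenbasis_dense: "closure (cspan (range \<psi>)) = UNIV"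
  using onb by (simp add: is_onb_def)

lemma eigenbasis_expansion: "((\<lambda>i. cinner (\<psi> i) v *\<^sub>C \<psi> i) has_sum v) UNIV"
  using onb_expansion[OF onb, of v] by (simp add: has_sum_reindex[OF inj] o_def)

lemma diagonal_op_form:
  assumes D: "D \<in> bounded_ops" and d: "\<And>i. blinfun_apply D (\<psi> i) = d i *\<^sub>R \<psi> i"
  shows "((\<lambda>i. d i * (cmod (cinner (\<psi> i) v))\<^sup>2) has_sum Re (cinner v (D v))) UNIV"
    and "cinner v (D v) = complex_of_real (Re (cinner v (D v)))"
proof -
  have "bounded_linear (\<lambda>x. cinner v (D x))"
    by (intro bounded_linear_compose[OF cinner.bounded_linear_right] blinfun.bounded_linear_right)
  from has_sum_bounded_linear[OF this eigenbasis_expansion[of v]]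
  have "((\<lambda>i. cinner v (D (cinner (\<psi> i) v *\<^sub>C \<psi> i))) has_sum cinner v (D v)) UNIV" .
  moreover have "cinner v (D (cinner (\<psi> i) v *\<^sub>C \<psi> i)) =
      complex_of_real (d i * (cmod (cinner (\<psi> i) v))\<^sup>2)" for i
    using cinner_commute[of v "\<psi> i"]
    by (simp add: bounded_ops_scaleC[OF D] d cinner_simps cinner_scaleR_right
        complex_norm_square[unfolded of_real_power] mult_ac)
  ultimately have sum: "((\<lambda>i. complex_of_real (d i * (cmod (cinner (\<psi> i) v))\<^sup>2)) has_sum
      cinner v (D v)) UNIV" by simp
  from has_sum_bounded_linear[OF bounded_linear_Re sum]
  show "((\<lambda>i. d i * (cmod (cinner (\<psi> i) v))\<^sup>2) has_sum Re (cinner v (D v))) UNIV" by simp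
  from has_sum_bounded_linear[OF bounded_linear_Im sum]
  have "((\<lambda>i::'i. 0) has_sum Im (cinner v (D v))) UNIV" by simp
  then have "Im (cinner v (D v)) = 0"
    using has_sum_unique[OF _ has_sum_0] by blast
  then show "cinner v (D v) = complex_of_real (Re (cinner v (D v)))"
    by (simp add: complex_eq_iff)
qed

lemma norm_eigenbasis_sum: "finite F \<Longrightarrow> (norm (\<Sum>i\<in>F. c i *\<^sub>C \<psi> i))\<^sup>2 = (\<Sum>i\<in>F. (cmod (c i))\<^sup>2)"
  by (subst norm_sum_Pythagorean)
    (auto simp: pairwise_def orthogonal_def inner_eq_Re_cinner cinner_simps eigenbasis_cinner
      scaleC_norm eigenbasis_norm)

text \<open>On finite combinations of the basis, multiplying the coefficients by \<open>d\<close> is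
  bounded by \<open>M\<close> because of Pythagoras, and a bounded graph over a dense subspace
  extends.\<close>

lemma diagonal_op_exists:
  assumes bound: "\<And>i. \<bar>d i\<bar> \<le> M"
  shows "\<exists>D\<in>bounded_ops. \<forall>i. blinfun_apply D (\<psi> i) = d i *\<^sub>R \<psi> i"
proof -
  let ?G = "{(c *\<^sub>C \<psi> i, d i *\<^sub>R c *\<^sub>C \<psi> i) | c i. True}"
  have "fst ` span ?G = span (fst ` ?G)"
    by (rule linear_span_image[symmetric]) (simp add: bounded_linear.linear bounded_linear_fst)
  also have "fst ` ?G = {c *\<^sub>C x | c x. x \<in> range \<psi>}" by force
  finally have dense: "closure (fst ` span ?G) = UNIV"
    using eigenbasis_dense unfolding cspan_def by simp
  have form: "\<exists>F c. finite F \<and> g = (\<Sum>i\<in>F. c i *\<^sub>C \<psi> i, \<Sum>i\<in>F. (complex_of_real (d i) * c i) *\<^sub>C \<psi> i)"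
    if "g \<in> span ?G" for g
    using that
  proof (induction rule: span_induct_alt)
    case base
    show ?case by (intro exI[of _ "{}"]) (auto simp: zero_prod_def)
  next
    case (step r z g)
    then obtain c' k where z: "z = (c' *\<^sub>C \<psi> k, d k *\<^sub>R c' *\<^sub>C \<psi> k)" by auto
    from step obtain F c where F: "finite F"
      and g: "g = (\<Sum>i\<in>F. c i *\<^sub>C \<psi> i, \<Sum>i\<in>F. (complex_of_real (d i) * c i) *\<^sub>C \<psi> i)"
      by auto
    \<comment> \<open>The new index \<open>k\<close> may already occur in \<open>F\<close>; then its
      coefficient is added to the old one.\<close>
    define e where "e i = (if i \<in> F then c i else 0) + (if i = k then r * c' else 0)" for i
    have split: "(\<Sum>i\<in>insert k F. (h i * e i) *\<^sub>C \<psi> i) =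
        (h k * (r * c')) *\<^sub>C \<psi> k + (\<Sum>i\<in>F. (h i * c i) *\<^sub>C \<psi> i)" for h :: "'i \<Rightarrow> complex"
    proof -
      have "(\<Sum>i\<in>insert k F. (h i * e i) *\<^sub>C \<psi> i) =
          (\<Sum>i\<in>insert k F. if i \<in> F then (h i * c i) *\<^sub>C \<psi> i else 0) +
          (\<Sum>i\<in>insert k F. if i = k then (h k * (r * c')) *\<^sub>C \<psi> k else 0)"
        unfolding sum.distrib[symmetric]
        by (intro sum.cong refl) (auto simp: e_def distrib_left scaleC_add_left)
      also have "(\<Sum>i\<in>insert k F. if i \<in> F then (h i * c i) *\<^sub>C \<psi> i else 0) =
          (\<Sum>i\<in>F. (h i * c i) *\<^sub>C \<psi> i)"
        using F by (intro sum.mono_neutral_cong_right) auto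
      finally show ?thesis using F by (simp add: add.commute)
    qed
    show ?case
      using F split[of "\<lambda>_. 1"] split[of "\<lambda>i. complex_of_real (d i)"]
      by (intro exI[of _ "insert k F"] exI[of _ e])
        (simp add: z g scaleR_scaleC scaleC_scaleC mult_ac)
  qed
  have bound': "norm w \<le> M * norm u" if uw: "(u, w) \<in> span ?G" for u w
  proof -
    have M: "0 \<le> M" using bound[of undefined] by linarith
    obtain F c where F: "finite F" and u: "u = (\<Sum>i\<in>F. c i *\<^sub>C \<psi> i)"
      and w: "w = (\<Sum>i\<in>F. (complex_of_real (d i) * c i) *\<^sub>C \<psi> i)"
      using form[OF uw] by auto
    have "(norm w)\<^sup>2 = (\<Sum>i\<in>F. \<bar>d i\<bar>\<^sup>2 * (cmod (c i))\<^sup>2)"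
      unfolding w norm_eigenbasis_sum[OF F] by (simp add: norm_mult power_mult_distrib)
    also have "\<dots> \<le> (\<Sum>i\<in>F. M\<^sup>2 * (cmod (c i))\<^sup>2)"
      by (intro sum_mono mult_right_mono power_mono bound) auto
    also have "\<dots> = (M * norm u)\<^sup>2"
      unfolding u power_mult_distrib norm_eigenbasis_sum[OF F] by (simp add: sum_distrib_left)
    finally show ?thesis by (rule power2_le_imp_le) (use M in simp)
  qed
  from dense_graph_extension[OF subspace_span dense bound']
  obtain D where D: "\<forall>z\<in>span ?G. blinfun_apply D (fst z) = snd z" ..
  have Dc: "D (c *\<^sub>C \<psi> i) = d i *\<^sub>R c *\<^sub>C \<psi> i" for c i
    using D[rule_format, of "(c *\<^sub>C \<psi> i, d i *\<^sub>R c *\<^sub>C \<psi> i)"] by (auto intro: span_base)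
  have "D \<in> bounded_ops"
  proof (rule bounded_opsI)
    fix c v
    show "D (c *\<^sub>C v) = c *\<^sub>C D v"
    proof (rule dense_cspan_induct[OF eigenbasis_dense, of "\<lambda>v. \<forall>c. D (c *\<^sub>C v) = c *\<^sub>C D v", THEN spec])
      show "closed {v. \<forall>c. D (c *\<^sub>C v) = c *\<^sub>C D v}"
        by (intro closed_Collect_all closed_Collect_eq continuous_intros scaleC.continuous_on)
      show "\<forall>c. D (c *\<^sub>C x) = c *\<^sub>C D x" if "x \<in> range \<psi>" for x
        using that Dc[of 1] by (auto simp: Dc scaleC_scaleR_right)
    qed (auto simp: scaleC_add_right blinfun.add_right scaleC_scaleC)
  qed
  then show ?thesis using Dc[of 1] by auto
qed

lemma eigenbasis_projection:
  assumes P: "P \<in> bounded_ops" "\<And>i. blinfun_apply P (\<psi> i) = of_bool (Q i) *\<^sub>R \<psi> i"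
  shows "projection_op P"
proof (rule projection_opI[OF P(1)])
  have "P o\<^sub>L P = P"
    by (rule bounded_ops_eqI[OF _ _ eigenbasis_dense])
      (auto simp: P bounded_ops_compose blinfun.scaleR_right)
  then show "P (P x) = P x" for x by (metis blinfun_apply_blinfun_compose)
  have "0 \<le> Re (cinner v (P v))" for v
    by (rule has_sum_nonneg[OF diagonal_op_form(1)[OF P]]) simp
  then have "cinner v (P v) \<in> \<real>\<^sub>\<ge>\<^sub>0" for v
    using diagonal_op_form(2)[OF P, of v] by (metis nonneg_Reals_of_real_iff)
  then show "cinner (P x) y = cinner x (P y)" for x y
    by (rule positive_form_hermitean[OF P(1), symmetric])
qed

context
  fixes A :: "'a \<Rightarrow>\<^sub>L 'a" and a :: "'i \<Rightarrow> real"
  assumes A: "A \<in> bounded_ops" and eigenvector: "\<And>i. A (\<psi> i) = a i *\<^sub>R \<psi> i"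
begin

text \<open>The spectral theorem for a diagonal operator: \<open>E S\<close> is diagonal with
  entries the indicator of \<open>S\<close> at the eigenvalues.\<close>

lemma eigenbasis_spectral_measure:
  obtains E where "spectral_measure A E" "\<And>S i. blinfun_apply (E S) (\<psi> i) = of_bool (a i \<in> S) *\<^sub>R \<psi> i"
proof -
  have "\<exists>D\<in>bounded_ops. \<forall>i. blinfun_apply D (\<psi> i) = of_bool (a i \<in> S) *\<^sub>R \<psi> i" for S
    by (rule diagonal_op_exists[of _ 1]) auto
  then obtain E where E: "\<And>S. E S \<in> bounded_ops"
    "\<And>S i. blinfun_apply (E S) (\<psi> i) = of_bool (a i \<in> S) *\<^sub>R \<psi> i"
    by metis
  have proj: "projection_op (E S)" for S by (rule eigenbasis_projection[OF E])
  \<comment> \<open>The weights of \<open>v\<close> in the basis, as a measure on indices. Its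
    push-forward along \<open>a\<close> is the scalar measure of \<open>v\<close>, and the spectral
    integral reduces to the sum of the eigenvalues against these weights.\<close>
  define W where "W v = density (count_space UNIV) (\<lambda>i. ennreal ((cmod (cinner (\<psi> i) v))\<^sup>2))" for v
  have W: "emeasure (distr (W v) borel a) S = ennreal (Re (cinner v (E S v)))"
    if S: "S \<in> sets borel" for v S
  proof -
    have "emeasure (distr (W v) borel a) S = emeasure (W v) (a -` S)"
      using S by (subst emeasure_distr) (auto simp: W_def)
    also have "\<dots> = (\<integral>\<^sup>+ i. ennreal (of_bool (a i \<in> S) * (cmod (cinner (\<psi> i) v))\<^sup>2) \<partial>count_space UNIV)"
      unfolding W_def by (subst emeasure_density)
        (auto intro!: nn_integral_cong simp: indicator_def)
    also have "\<dots> = ennreal (Re (cinner v (E S v)))"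
      using has_sum_integral_count_space[OF diagonal_op_form(1)[OF E], of S v]
      by (subst nn_integral_eq_integral) auto
    finally show ?thesis .
  qed
  have pvm: "projection_valued_measure E"
    unfolding projection_valued_measure_def
  proof (intro conjI ballI allI impI)
    show "E UNIV = id_blinfun"
      by (rule bounded_ops_eqI[OF E(1) bounded_ops_id eigenbasis_dense]) (auto simp: E)
  next
    fix F :: "nat \<Rightarrow> real set" and v
    assume F: "range F \<subseteq> sets borel" "disjoint_family F"
    \<comment> \<open>Strong additivity is proved through the remainders: these sets decrease to the
      empty set, and the squared norm of \<open>E (?R n) v\<close> is their push-forward
      measure.\<close>
    let ?R = "\<lambda>n. (\<Union>m. F m) - (\<Union>m<n. F m)"
    have R: "?R n \<in> sets borel" for n using F by auto
    have "(\<lambda>n. emeasure (distr (W v) borel a) (?R n)) \<longlonglongrightarrow>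
        emeasure (distr (W v) borel a) (\<Inter>n. ?R n)"
      using R by (intro Lim_emeasure_decseq) (auto simp: W decseq_def)
    moreover have "(\<Inter>n. ?R n) = {}" by auto
    ultimately have "(\<lambda>n. ennreal (Re (cinner v (E (?R n) v)))) \<longlonglongrightarrow> ennreal 0"
      by (simp only: W[OF R] emeasure_empty ennreal_0)
    then have "(\<lambda>n. ennreal ((norm (E (?R n) v))\<^sup>2)) \<longlonglongrightarrow> ennreal 0"
      by (simp add: projection_opD(4)[OF proj])
    then have "(\<lambda>n. (norm (E (?R n) v))\<^sup>2) \<longlonglongrightarrow> 0"
      by (rule tendsto_ennrealD) auto
    then have "(\<lambda>n. sqrt ((norm (E (?R n) v))\<^sup>2)) \<longlonglongrightarrow> sqrt 0"
      by (intro tendsto_real_sqrt)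
    then have "(\<lambda>n. E (?R n) v) \<longlonglongrightarrow> 0"
      by (simp add: tendsto_norm_zero_iff)
    then have "(\<lambda>n. E (\<Union>m. F m) v - E (?R n) v) \<longlonglongrightarrow> E (\<Union>m. F m) v - 0"
      by (intro tendsto_intros)
    moreover have "E (\<Union>m. F m) v - E (?R n) v = (\<Sum>m<n. E (F m) v)" for n
    proof -
      have "E (\<Union>m. F m) - E (?R n) = (\<Sum>m<n. E (F m))"
      proof (rule bounded_ops_eqI[OF _ _ eigenbasis_dense])
        show "E (\<Union>m. F m) - E (?R n) \<in> bounded_ops" by (intro bounded_ops_diff E)
        show "(\<Sum>m<n. E (F m)) \<in> bounded_ops"
          by (rule bounded_opsI) (simp add: blinfun.sum_left bounded_ops_scaleC[OF E(1)] scaleC.sum_right)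
        fix x assume "x \<in> range \<psi>"
        then obtain i where x: "x = \<psi> i" by auto
        have "(\<Sum>m<n. of_bool (a i \<in> F m)) = (of_bool (a i \<in> (\<Union>m<n. F m)) :: real)"
        proof (cases "a i \<in> (\<Union>m<n. F m)")
          case True
          then obtain k where k: "k < n" "a i \<in> F k" by auto
          then have "a i \<in> F m \<longleftrightarrow> m = k" for m
            using F(2) by (auto simp: disjoint_family_on_def)
          then show ?thesis using k True by (simp add: of_bool_def)
        qed auto
        then have "(\<Sum>m<n. of_bool (a i \<in> F m) *\<^sub>R \<psi> i) = of_bool (a i \<in> (\<Union>m<n. F m)) *\<^sub>R \<psi> i"
          by (simp only: scaleR_left.sum[symmetric])
        then show "(E (\<Union>m. F m) - E (?R n)) x = (\<Sum>m<n. E (F m)) x"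
          by (auto simp: x E blinfun.sum_left blinfun.diff_left scaleR_left_diff_distrib[symmetric])
      qed
      then show ?thesis by (metis (no_types) blinfun.diff_left blinfun.sum_left)
    qed
    ultimately show "(\<lambda>n. E (F n) v) sums E (\<Union>n. F n) v"
      by (simp add: sums_def)
  qed (rule proj)
  have "spectral_measure A E"
    unfolding spectral_measure_def
  proof (intro conjI allI pvm)
    fix v
    have M: "scalar_measure E v = distr (W v) borel a"
    proof (rule measure_eqI)
      fix S assume "S \<in> sets (scalar_measure E v)"
      then have "S \<in> sets borel" by (simp add: sets_scalar_measure[OF pvm])
      then show "emeasure (scalar_measure E v) S = emeasure (distr (W v) borel a) S"
        by (simp add: W emeasure_scalar_measure[OF pvm] projection_opD(4)[OF proj])
    qed (simp add: sets_scalar_measure[OF pvm])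
    note sum = has_sum_integral_count_space[OF diagonal_op_form(1)[OF A eigenvector], of v]
    show "integrable (scalar_measure E v) (\<lambda>l. l)"
      unfolding M W_def using sum(1)
      by (subst integrable_distr_eq) (auto simp: integrable_density mult.commute)
    have "(\<integral>l. l \<partial>scalar_measure E v) = Re (cinner v (A v))"
      unfolding M W_def using sum(2)
      by (subst integral_distr) (auto simp: integral_density mult.commute)
    then show "cinner v (A v) = complex_of_real (\<integral>l. l \<partial>scalar_measure E v)"
      using diagonal_op_form(2)[OF A eigenvector, of v] by simp
  qed
  then show ?thesis using that E by blast
qed

end

end

subsection \<open>The upper bound\<close>

text \<open>Cauchy-Schwarz in the plane for the vectors (sqrt a, sqrt c) and (sqrt b, sqrt d). It
  merges the contributions of p and 1 - p.\<close>

lemma sqrt_mult_add_le: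
  assumes "0 \<le> a" "0 \<le> b" "0 \<le> c" "0 \<le> d"
  shows "sqrt (a * b) + sqrt (c * d) \<le> sqrt ((a + c) * (b + d))"
proof (rule real_le_rsqrt)
  have "2 * (sqrt (a * d) * sqrt (c * b)) \<le> a * d + c * b"
    using sum_squares_bound[of "sqrt (a * d)" "sqrt (c * b)"] assms by (simp add: mult.assoc)
  moreover have "sqrt (a * b) * sqrt (c * d) = sqrt (a * d) * sqrt (c * b)"
    by (simp add: real_sqrt_mult mult_ac)
  ultimately show "(sqrt (a * b) + sqrt (c * d))\<^sup>2 \<le> (a + c) * (b + d)"
    using assms by (simp add: power2_sum algebra_simps)
qed

text \<open>The square of the left-hand side is at most \<open>m (2 - m)\<close> for \<open>m = 1 - g + h \<le> 2 \<delta> \<le> 1\<close>,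
  by the inequality of arithmetic and geometric means.\<close>

lemma infidelity_sqrt_bound:
  fixes g h \<delta> :: real
  assumes "0 \<le> h" "h \<le> \<delta>" "g \<le> 1" "1 - \<delta> \<le> g" "\<delta> \<le> 1 / 2"
  shows "sqrt (g * h) + sqrt ((1 - g) * (1 - h)) \<le> 2 * sqrt (\<delta> * (1 - \<delta>))"
proof -
  define m where "m = 1 - g + h"
  have nonneg: "0 \<le> g" "0 \<le> 1 - g" "0 \<le> 1 - h" "0 \<le> \<delta>" using assms by auto
  have "2 * (sqrt (g * (1 - g)) * sqrt (h * (1 - h))) \<le> g * (1 - g) + h * (1 - h)"
    using sum_squares_bound[of "sqrt (g * (1 - g))" "sqrt (h * (1 - h))"] nonneg assms
    by (simp add: mult.assoc)
  moreover have "sqrt (g * h) * sqrt ((1 - g) * (1 - h)) = sqrt (g * (1 - g)) * sqrt (h * (1 - h))"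
    by (simp add: real_sqrt_mult mult_ac)
  moreover have "(sqrt (g * h))\<^sup>2 = g * h" "(sqrt ((1 - g) * (1 - h)))\<^sup>2 = (1 - g) * (1 - h)"
    using nonneg assms by simp_all
  ultimately have "(sqrt (g * h) + sqrt ((1 - g) * (1 - h)))\<^sup>2 \<le>
      g * h + (1 - g) * (1 - h) + (g * (1 - g) + h * (1 - h))"
    by (simp only: power2_sum mult.assoc add_le_cancel_left)
  also have "\<dots> = m * (2 - m)"
    by (simp add: m_def algebra_simps)
  also have "\<dots> \<le> 2 * \<delta> * (2 - 2 * \<delta>)"
  proof -
    \<comment> \<open>The factored difference of the values of \<open>t * (2 - t)\<close> at
      \<open>2 * \<delta>\<close> and at \<open>m\<close>.\<close>
    have "0 \<le> (2 * \<delta> - m) * (2 - m - 2 * \<delta>)"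
      using assms by (intro mult_nonneg_nonneg) (auto simp: m_def)
    then show ?thesis by (simp add: algebra_simps)
  qed
  finally have "sqrt (g * h) + sqrt ((1 - g) * (1 - h)) \<le> sqrt (2\<^sup>2 * (\<delta> * (1 - \<delta>)))"
    by (intro real_le_rsqrt) (simp add: algebra_simps)
  then show ?thesis by (simp add: real_sqrt_mult)
qed

lemma positive_op_Cauchy_Schwarz:
  assumes "positive_op K"
  shows "cmod (cinner x (K y)) \<le> sqrt (Re (cinner x (K x)) * Re (cinner y (K y)))"
  by (rule real_le_rsqrt) (rule positive_form_Cauchy_Schwarz[OF positive_opD[OF assms]])

text \<open>Since \<open>u\<close> and \<open>w\<close> are orthogonal, the off-diagonal elements of \<open>K\<^sub>1 + K\<^sub>2\<close> and of
  \<open>K\<^sub>3 + K\<^sub>4\<close> agree up to sign, and each of the four terms obeys the Cauchy-Schwarz inequality.\<close>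

lemma off_diagonal_bound:
  assumes K: "positive_op K1" "positive_op K2" "positive_op K3" "positive_op K4"
    and sum: "K1 + K2 + (K3 + K4) = id_blinfun"
    and uw: "cinner u w = 0" and norms: "norm u = 1" "norm w = 1"
    and g: "g = Re (cinner u ((K1 + K3) u))" and h: "h = Re (cinner w ((K1 + K3) w))"
  shows "2 * cmod (cinner u ((K1 + K2) w)) \<le> sqrt (g * h) + sqrt ((1 - g) * (1 - h))"
    and "0 \<le> g" "g \<le> 1" "0 \<le> h" "h \<le> 1"
proof -
  let ?q = "\<lambda>K v. Re (cinner v (blinfun_apply K v))"
  have q: "0 \<le> ?q K v" if "positive_op K" for K v
    using positive_opD(2)[OF that, of v] by (simp add: complex_nonneg_Reals_iff)
  have decomp: "v = K1 v + K2 v + (K3 v + K4 v)" for v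
    using arg_cong[OF sum, of "\<lambda>K. blinfun_apply K v"] by (simp add: blinfun.add_left)
  have total: "?q K1 v + ?q K2 v + (?q K3 v + ?q K4 v) = (norm v)\<^sup>2" for v
    using arg_cong[OF decomp[of v], of "\<lambda>x. Re (cinner v x)"]
    by (simp add: cinner_simps cinner_self)
  have gh: "g = ?q K1 u + ?q K3 u" "h = ?q K1 w + ?q K3 w"
    by (simp_all add: g h blinfun.add_left cinner_simps)
  then have gh': "1 - g = ?q K2 u + ?q K4 u" "1 - h = ?q K2 w + ?q K4 w"
    using total[of u] total[of w] norms by simp_all
  show "0 \<le> g" "0 \<le> h" unfolding gh by (intro add_nonneg_nonneg q K)+
  have "0 \<le> 1 - g" "0 \<le> 1 - h" unfolding gh' by (intro add_nonneg_nonneg q K)+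
  then show "g \<le> 1" "h \<le> 1" by auto
  let ?x = "cinner u ((K1 + K2) w)"
  have x1: "?x = cinner u (K1 w) + cinner u (K2 w)"
    by (simp add: blinfun.add_left cinner_simps)
  have x2: "?x = - (cinner u (K3 w) + cinner u (K4 w))"
    using arg_cong[OF decomp[of w], of "cinner u"] uw
    by (simp add: x1 cinner_simps add_eq_0_iff)
  have "2 * cmod ?x = cmod (cinner u (K1 w) + cinner u (K2 w)) + cmod (cinner u (K3 w) + cinner u (K4 w))"
    using x1 x2 by (metis mult_2 norm_minus_cancel)
  also have "\<dots> \<le> cmod (cinner u (K1 w)) + cmod (cinner u (K2 w)) +
      (cmod (cinner u (K3 w)) + cmod (cinner u (K4 w)))"
    by (intro add_mono norm_triangle_ineq)
  also have "\<dots> \<le> sqrt (?q K1 u * ?q K1 w) + sqrt (?q K2 u * ?q K2 w) +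
      (sqrt (?q K3 u * ?q K3 w) + sqrt (?q K4 u * ?q K4 w))"
    by (intro add_mono positive_op_Cauchy_Schwarz K)
  \<comment> \<open>Regrouping across the two sums, \<open>K1\<close> with \<open>K3\<close> and
    \<open>K2\<close> with \<open>K4\<close>, leaves only the diagonal elements of
    \<open>K1 + K3\<close> and of its complement.\<close>
  also have "\<dots> \<le> sqrt (g * h) + sqrt ((1 - g) * (1 - h))"
    using sqrt_mult_add_le[OF q[OF K(1)] q[OF K(1)] q[OF K(3)] q[OF K(3)], of u w u w]
      sqrt_mult_add_le[OF q[OF K(2)] q[OF K(2)] q[OF K(4)] q[OF K(4)], of u w u w]
    unfolding gh' unfolding gh by linarith
  finally show "2 * cmod ?x \<le> sqrt (g * h) + sqrt ((1 - g) * (1 - h))" .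
qed

lemma norm_positive_op_le_1:
  assumes K: "positive_op K" and L: "positive_op (id_blinfun - K)"
  shows "norm K \<le> 1"
proof (rule norm_blinfun_bound)
  have le: "Re (cinner v (K v)) \<le> 1 * (norm v)\<^sup>2" for v
    using positive_opD(2)[OF L, of v]
    by (simp add: complex_nonneg_Reals_iff blinfun.diff_left cinner_simps cinner_self)
  show "norm (K x) \<le> 1 * norm x" for x
    by (rule norm_le_of_positive_form[OF positive_opD[OF K] le le]) auto
qed simp

context nondestructive_measurement
begin

abbreviation "\<M> \<equiv> algebra_tensor tens bounded_ops \<B>"

lemma \<B>_bounded: "\<B> \<subseteq> bounded_ops"
  using algebra by (simp add: von_neumann_algebra_def)

lemma id_in_\<B>: "id_blinfun \<in> \<B>"
proof -
  have "id_blinfun \<in> commutant (commutant \<B>)"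
    by (auto simp: commutant_def bounded_ops_id intro: blinfun_eqI)
  then show ?thesis using algebra by (simp add: von_neumann_algebra_def)
qed

lemma op_tensor_in_\<M>: "X \<in> bounded_ops \<Longrightarrow> Y \<in> \<B> \<Longrightarrow> op_tensor tens X Y \<in> \<M>"
  by (rule op_tensor_in_algebra_tensor[OF tens _ \<B>_bounded]) auto

lemma T_add: "X \<in> \<M> \<Longrightarrow> Y \<in> \<M> \<Longrightarrow> T (X + Y) = T X + T Y"
  using cp by (simp add: cp_map_def)

lemma T_id: "T id_blinfun = id_blinfun"
  using cp by (simp add: cp_map_def)

lemma T_bounded: "X \<in> \<M> \<Longrightarrow> T X \<in> bounded_ops"
  using cp by (simp add: cp_map_def)

lemma T_positive:
  assumes K: "K \<in> \<M>" "positive_op K"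
  shows "positive_op (T K)"
  unfolding positive_op_def
proof (intro conjI allI)
  fix v
  have "positive_matrix 1 (\<lambda>_ _. K)"
    using K(2) by (simp add: positive_matrix_def positive_op_def)
  then have "positive_matrix 1 (\<lambda>_ _. T K)"
    using cp K(1) by (simp add: cp_map_def completely_positive_def)
  then show "cinner v (T K v) \<in> \<real>\<^sub>\<ge>\<^sub>0"
    by (auto simp: positive_matrix_def dest: spec[of _ "\<lambda>_. v"])
qed (rule T_bounded[OF K(1)])

lemma T_tensor_positive:
  assumes "projection_op p" "projection_op P" "P \<in> \<B>"
  shows "positive_op (T (op_tensor tens p P))"
  using assms
  by (intro T_positive op_tensor_in_\<M> positive_op_projection projection_op_tensor[OF tens])
    (auto dest: projection_opD)

lemma complement_in_\<B>:
  assumes "P \<in> \<B>"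
  shows "id_blinfun - P \<in> \<B>"
proof -
  have "Y o\<^sub>L (id_blinfun - P) = (id_blinfun - P) o\<^sub>L Y" if "Y \<in> commutant \<B>" for Y
  proof (rule blinfun_eqI)
    have "P o\<^sub>L Y = Y o\<^sub>L P" using that assms by (simp add: commutant_def)
    then have "P (Y x) = Y (P x)" for x by (metis blinfun_apply_blinfun_compose)
    then show "(Y o\<^sub>L (id_blinfun - P)) x = ((id_blinfun - P) o\<^sub>L Y) x" for x
      by (simp add: blinfun.diff_left blinfun.diff_right)
  qed
  then have "id_blinfun - P \<in> commutant (commutant \<B>)"
    using assms \<B>_bounded by (auto simp: commutant_def bounded_ops_id bounded_ops_diff)
  then show ?thesis using algebra by (simp add: von_neumann_algebra_def)
qed

lemma T_tensor_split:
  assumes p: "projection_op p" and P: "projection_op P" "P \<in> \<B>"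
  shows "T (op_tensor tens p P) + T (op_tensor tens p (id_blinfun - P)) = T (op_tensor tens p id_blinfun)"
    "T (op_tensor tens p P) + T (op_tensor tens (id_blinfun - p) P) = T (op_tensor tens id_blinfun P)"
    "T (op_tensor tens p id_blinfun) + T (op_tensor tens (id_blinfun - p) id_blinfun) = id_blinfun"
    "T (op_tensor tens id_blinfun P) + T (op_tensor tens id_blinfun (id_blinfun - P)) = id_blinfun"
proof -
  note ops = projection_opD(1)[OF p] projection_opD(1)[OF P(1)]
    projection_opD(1)[OF projection_op_complement[OF p]]
    projection_opD(1)[OF projection_op_complement[OF P(1)]] bounded_ops_id
    P(2) complement_in_\<B>[OF P(2)] id_in_\<B>
  show "T (op_tensor tens p P) + T (op_tensor tens p (id_blinfun - P)) = T (op_tensor tens p id_blinfun)"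
    "T (op_tensor tens p P) + T (op_tensor tens (id_blinfun - p) P) = T (op_tensor tens id_blinfun P)"
    "T (op_tensor tens p id_blinfun) + T (op_tensor tens (id_blinfun - p) id_blinfun) = id_blinfun"
    "T (op_tensor tens id_blinfun P) + T (op_tensor tens id_blinfun (id_blinfun - P)) = id_blinfun"
    by (simp_all add: ops T_add[symmetric] op_tensor_in_\<M> op_tensor_add_left[OF tens, symmetric]
        op_tensor_add_right[OF tens, symmetric] op_tensor_id[OF tens] T_id)
qed

text \<open>The real supremum in the infidelity majorises its members only if they are bounded; this
  supplies the bound.\<close>

lemma norm_T_tensor_le_1:
  assumes P: "projection_op P" "P \<in> \<B>"
  shows "norm (T (op_tensor tens id_blinfun P)) \<le> 1"
proof (rule norm_positive_op_le_1)
  show "positive_op (T (op_tensor tens id_blinfun P))"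
    by (intro T_tensor_positive projection_op_id P)
  have "id_blinfun - T (op_tensor tens id_blinfun P) = T (op_tensor tens id_blinfun (id_blinfun - P))"
    using T_tensor_split(4)[OF projection_op_id P] by (simp add: algebra_simps)
  then show "positive_op (id_blinfun - T (op_tensor tens id_blinfun P))"
    by (simp add: T_tensor_positive projection_op_id projection_op_complement complement_in_\<B> P)
qed

text \<open>\<open>K1\<close>, \<open>K2\<close> of the off-diagonal bound come from p tensored with
  P and 1 - P, and \<open>K3\<close>, \<open>K4\<close> likewise from 1 - p. Then
  \<open>K1 + K2\<close> is R(p), while \<open>K1 + K3\<close> is T(1 \<otimes> P), which no longer
  involves p and is what the infidelity controls.\<close>

lemma coherence_bound:
  assumes p: "projection_op p" and P: "projection_op P" "P \<in> \<B>" and ij: "i \<noteq> j"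
    and g: "g = Re (cinner (\<psi> i) (T (op_tensor tens id_blinfun P) (\<psi> i)))"
    and h: "h = Re (cinner (\<psi> j) (T (op_tensor tens id_blinfun P) (\<psi> j)))"
  shows "2 * cmod (cinner (\<psi> i) (T (op_tensor tens p id_blinfun) (\<psi> j)))
      \<le> sqrt (g * h) + sqrt ((1 - g) * (1 - h))"
    and "0 \<le> g" "g \<le> 1" "0 \<le> h" "h \<le> 1"
proof -
  note p' = projection_op_complement[OF p] and P' = projection_op_complement[OF P(1)] complement_in_\<B>[OF P(2)]
  have sum: "T (op_tensor tens p P) + T (op_tensor tens p (id_blinfun - P)) +
      (T (op_tensor tens (id_blinfun - p) P) + T (op_tensor tens (id_blinfun - p) (id_blinfun - P))) = id_blinfun"
    by (simp add: T_tensor_split(1)[OF p P] T_tensor_split(1)[OF p' P] T_tensor_split(3)[OF p P])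
  have uw: "cinner (\<psi> i) (\<psi> j) = 0"
    using eigenbasis_cinner[OF basis] ij by simp
  note bound = off_diagonal_bound[OF T_tensor_positive[OF p P] T_tensor_positive[OF p P']
      T_tensor_positive[OF p' P] T_tensor_positive[OF p' P'] sum uw
      eigenbasis_norm[OF basis] eigenbasis_norm[OF basis]]
  show "2 * cmod (cinner (\<psi> i) (T (op_tensor tens p id_blinfun) (\<psi> j)))
      \<le> sqrt (g * h) + sqrt ((1 - g) * (1 - h))" "0 \<le> g" "g \<le> 1" "0 \<le> h" "h \<le> 1"
    using bound[of g h] g h by (simp_all add: T_tensor_split(1,2)[OF p P])
qed

text \<open>If \<open>B\<close> had no spectral measure, then \<open>spectral_projection B S\<close> would not depend on \<open>S\<close>. Comparing
  the empty set with the whole line then gives \<open>\<delta> = 1/2\<close>, for which the bound holds for any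
  nondestructive map. So the spectral theorem for \<open>B\<close> is not needed.\<close>

lemma coherence_infidelity_bound:
  assumes p: "projection_op p" and ij: "a i \<noteq> a j"
    and \<delta>: "\<delta> = measurement_infidelity tens T A B" "0 \<le> \<delta>" "\<delta> \<le> 1/2"
  shows "cmod (cinner (\<psi> i) (T (op_tensor tens p id_blinfun) (\<psi> j))) \<le> sqrt (\<delta> * (1 - \<delta>))"
proof -
  let ?Q = "spectral_projection B" and ?F = "spectral_projection A"
  let ?f = "\<lambda>S. norm (T (op_tensor tens id_blinfun (?Q S)) - ?F S)"
  have ij': "i \<noteq> j" using ij by auto
  have AB: "A \<in> bounded_ops" "B \<in> bounded_ops" using A B by (auto simp: hermitean_def)
  obtain EA where EA: "spectral_measure A EA"
    "\<And>S i. blinfun_apply (EA S) (\<psi> i) = of_bool (a i \<in> S) *\<^sub>R \<psi> i"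
    using eigenbasis_spectral_measure[OF basis AB(1) eigenvector] by blast
  have F: "?F S = EA S" if "S \<in> sets borel" for S
    using spectral_projection_eq[OF A EA(1) that] .
  have F1: "norm (?F S) \<le> 1" if "S \<in> sets borel" for S
    unfolding F[OF that]
    by (intro projection_op_norm_le pvm_projection[OF spectral_measure_pvm[OF AB(1) EA(1)]] that)
  \<comment> \<open>The bound \<open>C\<close> is a parameter, since the two cases below bound the
    family differently: by 1 if \<open>B\<close> has a spectral measure, by the norm of a constant
    otherwise.\<close>
  have le: "?f S \<le> \<delta>" if C: "\<And>S. S \<in> sets borel \<Longrightarrow> norm (T (op_tensor tens id_blinfun (?Q S))) \<le> C"
    and S: "S \<in> sets borel" for S C
    unfolding \<delta>(1) measurement_infidelity_def
  proof (rule cSUP_upper[OF S])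
    show "bdd_above (?f ` sets borel)"
      using C F1 by (intro bdd_aboveI2[of _ _ "C + 1"])
        (metis (no_types, lifting) add_mono norm_triangle_ineq4 order_trans)
  qed
  show ?thesis
  proof (cases "\<exists>E. spectral_measure B E")
    case True
    then obtain EB where EB: "spectral_measure B EB" by blast
    have Q: "?Q S = EB S" "projection_op (EB S)" "EB S \<in> \<B>" if "S \<in> sets borel" for S
      using spectral_projection_eq[OF B(2) EB that] spectral_measure_in_algebra[OF algebra B EB that]
        pvm_projection[OF spectral_measure_pvm[OF AB(2) EB] that] by auto
    let ?S = "{a i}" and ?T = "T (op_tensor tens id_blinfun (EB {a i}))"
    define g h where "g = Re (cinner (\<psi> i) (?T (\<psi> i)))" and "h = Re (cinner (\<psi> j) (?T (\<psi> j)))"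
    have "?f ?S \<le> \<delta>"
      by (rule le[of 1]) (simp_all add: Q norm_T_tensor_le_1)
    then have d: "norm (?T - EA ?S) \<le> \<delta>" by (simp add: Q F)
    have dev: "\<bar>Re (cinner (\<psi> k) ((?T - EA ?S) (\<psi> k)))\<bar> \<le> \<delta>" for k
    proof -
      have "\<bar>Re (cinner (\<psi> k) ((?T - EA ?S) (\<psi> k)))\<bar> \<le> norm (\<psi> k) * norm ((?T - EA ?S) (\<psi> k))"
        using abs_Re_le_cmod cinner_Cauchy_Schwarz order_trans by blast
      also have "\<dots> \<le> norm (?T - EA ?S)"
        using norm_blinfun[of "?T - EA ?S" "\<psi> k"] by (simp add: eigenbasis_norm[OF basis])
      finally show ?thesis using d by simp
    qed
    \<comment> \<open>\<open>EA ?S\<close> has diagonal element 1 at \<open>\<psi> i\<close> and, as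
      \<open>a j\<close> differs from \<open>a i\<close>, 0 at \<open>\<psi> j\<close>.\<close>
    have gh: "1 - \<delta> \<le> g" "h \<le> \<delta>"
      using dev[of i] dev[of j] ij
      by (auto simp: g_def h_def EA(2) blinfun.diff_left cinner_simps eigenbasis_cinner[OF basis])
    note bound = coherence_bound[OF p Q(2,3) ij' g_def h_def]
    show ?thesis
      using infidelity_sqrt_bound[of h \<delta> g] bound gh \<delta> by simp
  next
    case False
    then have const: "?Q S = ?Q {}" for S by (simp add: spectral_projection_def)
    let ?K = "T (op_tensor tens id_blinfun (?Q {}))"
    have K: "T (op_tensor tens id_blinfun (?Q S)) = ?K" for S
      by (simp only: const[of S])
    have le': "norm (?K - ?F S) \<le> \<delta>" if "S \<in> sets borel" for S
    proof -
      have "?f S \<le> \<delta>" by (rule le[of "norm ?K", OF _ that]) (metis K order_refl)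
      then show ?thesis by (simp only: K[of S])
    qed
    note pvm = spectral_measure_pvm[OF AB(1) EA(1)]
    have "norm ?K \<le> \<delta>" "norm (?K - id_blinfun) \<le> \<delta>"
      using le'[of "{}"] le'[of UNIV] by (simp_all add: F pvm_empty[OF pvm] pvm_UNIV[OF pvm])
    moreover have "1 \<le> norm ?K + norm (?K - id_blinfun)"
    proof -
      have "norm (\<psi> i) = norm (?K (\<psi> i) - (?K - id_blinfun) (\<psi> i))"
        by (simp add: blinfun.diff_left)
      also have "\<dots> \<le> norm (?K (\<psi> i)) + norm ((?K - id_blinfun) (\<psi> i))"
        by (rule norm_triangle_ineq4)
      also have "\<dots> \<le> norm ?K + norm (?K - id_blinfun)"
        using norm_blinfun[of ?K "\<psi> i"] norm_blinfun[of "?K - id_blinfun" "\<psi> i"]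
        by (simp add: eigenbasis_norm[OF basis])
      finally show ?thesis by (simp add: eigenbasis_norm[OF basis])
    qed
    ultimately have half: "1 - \<delta> = \<delta>" "2 * \<delta> = 1" using \<delta> by auto
    then have "sqrt (\<delta> * (1 - \<delta>)) = \<delta>"
      using \<delta> by (simp only: real_sqrt_abs2 abs_of_nonneg)
    \<comment> \<open>With \<open>P\<close> the identity, \<open>g = h = 1\<close>, and the
      coherence bound becomes 1/2, which is the required value at \<delta> = 1/2.\<close>
    moreover have "2 * cmod (cinner (\<psi> i) (T (op_tensor tens p id_blinfun) (\<psi> j))) \<le> 1"
      using coherence_bound(1)[OF p projection_op_id id_in_\<B> ij' refl refl]
      by (simp add: op_tensor_id[OF tens] T_id eigenbasis_cinner[OF basis])
    ultimately show ?thesis using half by linarith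
  qed
qed

lemma density_state_coherent_op:
  assumes "X \<in> bounded_ops"
  shows "density_state (coherent_op \<psi> i j \<alpha> \<beta>) X =
    cinner (\<alpha> *\<^sub>C \<psi> i + \<beta> *\<^sub>C \<psi> j) (X (\<alpha> *\<^sub>C \<psi> i + \<beta> *\<^sub>C \<psi> j))"
  unfolding coherent_op_def by (rule density_state_ketbra[OF basis(2) assms])

lemma density_state_incoherent_op:
  assumes X: "X \<in> bounded_ops" and ij: "i \<noteq> j"
  shows "density_state (incoherent_op \<psi> i j \<alpha> \<beta>) X =
    complex_of_real ((cmod \<alpha>)\<^sup>2) * cinner (\<psi> i) (X (\<psi> i)) +
    complex_of_real ((cmod \<beta>)\<^sup>2) * cinner (\<psi> j) (X (\<psi> j))"
proof -
  \<comment> \<open>The mixing weights are put into the functionals, which gives the finite-rank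
    form with \<open>u = \<psi>\<close>.\<close>
  let ?w = "\<lambda>k. (if k = i then (cmod \<alpha>)\<^sup>2 else (cmod \<beta>)\<^sup>2) *\<^sub>R \<psi> k"
  have "density_state (incoherent_op \<psi> i j \<alpha> \<beta>) X = (\<Sum>k\<in>{i, j}. cinner (?w k) (X (\<psi> k)))"
    unfolding density_state_def
    by (rule op_trace_finite_rank[OF basis(2)])
      (use X ij in \<open>auto simp: incoherent_op_def blinfun.add_left blinfun.scaleR_left ketbra_apply
        cinner_scaleC_left scaleR_scaleC scaleC_scaleC\<close>)
  then show ?thesis using ij by (simp add: cinner_scaleR_left)
qed

lemma reduced_map_bounded: "X \<in> bounded_ops \<Longrightarrow> reduced_map tens T X \<in> bounded_ops"
  unfolding reduced_map_def by (intro T_bounded op_tensor_in_\<M> id_in_\<B>)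

lemma reduced_map_diagonal:
  assumes "X \<in> bounded_ops"
  shows "cinner (\<psi> i) (reduced_map tens T X (\<psi> i)) = cinner (\<psi> i) (X (\<psi> i))"
  using nondestructive[OF assms, of i] assms
  by (simp add: pullback_def density_state_ketbra[OF basis(2)] reduced_map_bounded)

text \<open>Nondestructiveness cancels the diagonal contributions; positivity of R(p) makes the two
  interference terms complex conjugates.\<close>

lemma state_difference:
  assumes p: "projection_op p" and ij: "i \<noteq> j"
  shows "Re (pullback (reduced_map tens T) (density_state (coherent_op \<psi> i j \<alpha> \<beta>)) p) -
      Re (density_state (incoherent_op \<psi> i j \<alpha> \<beta>) p) =
    2 * Re (cnj \<alpha> * \<beta> * cinner (\<psi> i) (reduced_map tens T p (\<psi> j)))"
proof -
  let ?R = "reduced_map tens T p"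
  note pB = projection_opD(1)[OF p]
  note RB = reduced_map_bounded[OF pB]
  have "positive_op ?R"
    unfolding reduced_map_def by (intro T_tensor_positive p projection_op_id id_in_\<B>)
  from positive_form_hermitean[OF positive_opD[OF this]]
  have "cinner (\<psi> j) (?R (\<psi> i)) = cnj (cinner (\<psi> i) (?R (\<psi> j)))"
    by (metis cinner_commute)
  moreover have "complex_of_real ((cmod \<alpha>)\<^sup>2) = cnj \<alpha> * \<alpha>"
    "complex_of_real ((cmod \<beta>)\<^sup>2) = cnj \<beta> * \<beta>"
    by (simp_all only: complex_norm_square mult.commute)
  ultimately have "cinner (\<alpha> *\<^sub>C \<psi> i + \<beta> *\<^sub>C \<psi> j) (?R (\<alpha> *\<^sub>C \<psi> i + \<beta> *\<^sub>C \<psi> j)) =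
      complex_of_real ((cmod \<alpha>)\<^sup>2) * cinner (\<psi> i) (p (\<psi> i)) +
      complex_of_real ((cmod \<beta>)\<^sup>2) * cinner (\<psi> j) (p (\<psi> j)) +
      (cnj \<alpha> * \<beta> * cinner (\<psi> i) (?R (\<psi> j)) + cnj (cnj \<alpha> * \<beta> * cinner (\<psi> i) (?R (\<psi> j))))"
    by (simp del: of_real_power add: cinner_simps blinfun.add_right bounded_ops_scaleC[OF RB]
        reduced_map_diagonal[OF pB] algebra_simps)
  then have "Re (cinner (\<alpha> *\<^sub>C \<psi> i + \<beta> *\<^sub>C \<psi> j) (?R (\<alpha> *\<^sub>C \<psi> i + \<beta> *\<^sub>C \<psi> j))) =
      Re (complex_of_real ((cmod \<alpha>)\<^sup>2) * cinner (\<psi> i) (p (\<psi> i)) +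
        complex_of_real ((cmod \<beta>)\<^sup>2) * cinner (\<psi> j) (p (\<psi> j))) +
      2 * Re (cnj \<alpha> * \<beta> * cinner (\<psi> i) (?R (\<psi> j)))"
    by (simp only: plus_complex.simps cnj.simps mult_2)
  then show ?thesis
    by (simp only: pullback_def density_state_coherent_op[OF RB] density_state_incoherent_op[OF pB ij])
qed

lemma state_difference_le:
  assumes p: "projection_op p" and ij: "a i \<noteq> a j" and \<alpha>\<beta>: "(cmod \<alpha>)\<^sup>2 + (cmod \<beta>)\<^sup>2 = 1"
    and \<delta>: "\<delta> = measurement_infidelity tens T A B" "0 \<le> \<delta>" "\<delta> \<le> 1/2"
  shows "Re (pullback (reduced_map tens T) (density_state (coherent_op \<psi> i j \<alpha> \<beta>)) p) -
      Re (density_state (incoherent_op \<psi> i j \<alpha> \<beta>) p) \<le> sqrt (\<delta> * (1 - \<delta>))"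
proof -
  let ?x = "cinner (\<psi> i) (reduced_map tens T p (\<psi> j))"
  have "i \<noteq> j" using ij by auto
  then have "Re (pullback (reduced_map tens T) (density_state (coherent_op \<psi> i j \<alpha> \<beta>)) p) -
      Re (density_state (incoherent_op \<psi> i j \<alpha> \<beta>) p) = 2 * Re (cnj \<alpha> * \<beta> * ?x)"
    by (rule state_difference[OF p])
  also have "\<dots> \<le> 2 * cmod (cnj \<alpha> * \<beta> * ?x)"
    by (intro mult_left_mono complex_Re_le_cmod) simp
  also have "\<dots> = (2 * cmod \<alpha> * cmod \<beta>) * cmod ?x"
    by (simp add: norm_mult)
  also have "\<dots> \<le> 1 * cmod ?x"
    using sum_squares_bound[of "cmod \<alpha>" "cmod \<beta>"] \<alpha>\<beta> by (intro mult_right_mono) auto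
  also have "\<dots> \<le> sqrt (\<delta> * (1 - \<delta>))"
    using coherence_infidelity_bound[OF p ij \<delta>] by (simp add: reduced_map_def)
  finally show ?thesis .
qed

lemma trace_distance_le:
  assumes ij: "a i \<noteq> a j" and \<alpha>\<beta>: "(cmod \<alpha>)\<^sup>2 + (cmod \<beta>)\<^sup>2 = 1"
    and \<delta>: "\<delta> = measurement_infidelity tens T A B" "0 \<le> \<delta>" "\<delta> \<le> 1/2"
  shows "trace_distance (pullback (reduced_map tens T) (density_state (coherent_op \<psi> i j \<alpha> \<beta>)))
      (density_state (incoherent_op \<psi> i j \<alpha> \<beta>)) \<le> sqrt (\<delta> * (1 - \<delta>))"
  unfolding trace_distance_def
  \<comment> \<open>The zero projection makes the index set of the supremum nonempty.\<close>
  by (rule cSUP_least) (use projection_op_zero state_difference_le[OF _ assms] in auto)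

end

subsection \<open>Finite-dimensional spaces\<close>

lemma is_onb_finite:
  fixes b :: "'j::finite \<Rightarrow> 'a::chilbert_space"
  assumes orth: "\<And>i j. cinner (b i) (b j) = of_bool (i = j)"
    and expansion: "\<And>x. x = (\<Sum>j\<in>UNIV. cinner (b j) x *\<^sub>C b j)"
  shows "is_onb (range b)"
proof -
  have inj: "b i = b j \<longleftrightarrow> i = j" for i j
    using orth[of i i] orth[of i j] by auto
  have "x \<in> cspan (range b)" for x
    unfolding cspan_def by (subst expansion[of x]) (intro span_sum span_base; blast)
  then have "cspan (range b) = UNIV" by blast
  then show ?thesis by (auto simp: is_onb_def orth inj)
qed

lemma op_trace_finite:
  fixes b :: "'j::finite \<Rightarrow> 'a::chilbert_space"
  assumes orth: "\<And>i j. cinner (b i) (b j) = of_bool (i = j)"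
    and expansion: "\<And>x. x = (\<Sum>j\<in>UNIV. cinner (b j) x *\<^sub>C b j)"
    and Y: "Y \<in> bounded_ops"
  shows "op_trace Y = (\<Sum>j\<in>UNIV. cinner (b j) (Y (b j)))"
  using op_trace_finite_rank[OF is_onb_finite[OF orth expansion], of UNIV "\<lambda>_. Y" Y b b] Y
    expansion by simp

text \<open>Both sides are the same double sum over the two bases. The spaces may differ, as is
  required for an isometry from the system into system plus pointer.\<close>

lemma trace_cyclic:
  fixes b :: "'j::finite \<Rightarrow> 'a::chilbert_space" and c :: "'k::finite \<Rightarrow> 'b::chilbert_space"
    and F :: "'b \<Rightarrow>\<^sub>L 'a" and G :: "'a \<Rightarrow>\<^sub>L 'b"
  assumes b: "\<And>x. x = (\<Sum>j\<in>UNIV. cinner (b j) x *\<^sub>C b j)"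
    and c: "\<And>x. x = (\<Sum>j\<in>UNIV. cinner (c j) x *\<^sub>C c j)"
    and F: "\<And>r x. F (r *\<^sub>C x) = r *\<^sub>C F x" and G: "\<And>r x. G (r *\<^sub>C x) = r *\<^sub>C G x"
  shows "(\<Sum>k\<in>UNIV. cinner (c k) (G (F (c k)))) = (\<Sum>j\<in>UNIV. cinner (b j) (F (G (b j))))"
proof -
  have "cinner (c k) (G (F (c k))) = (\<Sum>j\<in>UNIV. cinner (b j) (F (c k)) * cinner (c k) (G (b j)))" for k
    by (subst b[of "F (c k)"]) (simp add: blinfun.sum_right G cinner_simps)
  moreover have "cinner (b j) (F (G (b j))) = (\<Sum>k\<in>UNIV. cinner (b j) (F (c k)) * cinner (c k) (G (b j)))" for j
    by (subst c[of "G (b j)"]) (simp add: blinfun.sum_right F cinner_simps mult.commute)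
  ultimately show ?thesis by (simp only:) (rule sum.swap)
qed

section \<open>Coordinate spaces and their tensor product\<close>

abbreviation unit_vec :: "'n::finite \<Rightarrow> complex ^ 'n" where
  "unit_vec i \<equiv> axis i 1"

lemma unit_vec_nth: "unit_vec i $ k = of_bool (i = k)"
  by (simp add: axis_def)

lemma scaleC_nth: "(c *\<^sub>C x) $ k = c *\<^sub>C (x $ k)"
  by (simp add: scaleC_vec_def)

lemma cnj_of_bool: "cnj (of_bool b) = of_bool b"
  by (cases b) simp_all

lemma cinner_unit_vec: "cinner (unit_vec i) x = x $ i"
  by (simp add: cinner_vec_def cinner_complex_def unit_vec_nth cnj_of_bool)

lemma unit_vec_orthonormal: "cinner (unit_vec i) (unit_vec j) = of_bool (i = j)"
  by (simp add: cinner_unit_vec unit_vec_nth eq_commute)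

lemma unit_vec_expansion: "x = (\<Sum>i\<in>UNIV. cinner (unit_vec i) x *\<^sub>C unit_vec i)"
  by (simp add: vec_eq_iff cinner_unit_vec scaleC_nth scaleC_complex_def unit_vec_nth)

lemma is_onb_unit_vec: "is_onb (range unit_vec)"
  by (rule is_onb_finite[OF unit_vec_orthonormal unit_vec_expansion])

lemma inj_unit_vec: "inj (unit_vec :: 'n::finite \<Rightarrow> complex ^ 'n)"
  by (auto simp: inj_def axis_eq_axis)

text \<open>Iterating the vector type already yields a Hilbert space of coefficient matrices, which
  can serve as the tensor product.\<close>

definition vec_tensor :: "complex ^ 'n \<Rightarrow> complex ^ 'm \<Rightarrow> complex ^ 'm ^ 'n" where
  "vec_tensor x y = (\<chi> i. (x $ i) *\<^sub>C y)"

lemma vec_tensor_nth: "vec_tensor x y $ i = (x $ i) *\<^sub>C y"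
  by (simp add: vec_tensor_def)

lemma cinner_vec_tensor: "cinner (vec_tensor x y) u = (\<Sum>i\<in>UNIV. cnj (x $ i) * cinner y (u $ i))"
  by (simp add: cinner_vec_def[of "vec_tensor x y"] vec_tensor_nth cinner_simps)

lemma cinner_vec_tensor_unit_vec: "cinner (vec_tensor (unit_vec i) (unit_vec k)) u = u $ i $ k"
  by (simp add: cinner_vec_tensor cinner_unit_vec unit_vec_nth cnj_of_bool)

abbreviation unit_tensor :: "'n::finite \<times> 'm::finite \<Rightarrow> complex ^ 'm ^ 'n" where
  "unit_tensor p \<equiv> vec_tensor (unit_vec (fst p)) (unit_vec (snd p))"

lemma unit_tensor_orthonormal: "cinner (unit_tensor p) (unit_tensor q) = of_bool (p = q)"
  by (auto simp: cinner_vec_tensor_unit_vec vec_tensor_nth scaleC_nth scaleC_complex_def unit_vec_nth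
      prod_eq_iff)

lemma unit_tensor_expansion: "u = (\<Sum>p\<in>UNIV. cinner (unit_tensor p) u *\<^sub>C unit_tensor p)"
proof -
  have "(\<Sum>p\<in>UNIV. cinner (unit_tensor p) u *\<^sub>C unit_tensor p) $ i $ k =
      u $ i $ k" for i k
  proof -
    have "(\<Sum>p\<in>UNIV. cinner (unit_tensor p) u *\<^sub>C unit_tensor p) $ i $ k =
        (\<Sum>p\<in>UNIV. u $ fst p $ snd p * (unit_vec (fst p) $ i * unit_vec (snd p) $ k))"
      by (simp add: cinner_vec_tensor_unit_vec vec_tensor_nth scaleC_nth scaleC_complex_def)
    also have "\<dots> = (\<Sum>p\<in>UNIV. of_bool (p = (i, k)) * u $ i $ k)"
      by (rule sum.cong) (auto simp: unit_vec_nth prod_eq_iff)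
    finally show ?thesis by simp
  qed
  then show ?thesis by (simp add: vec_eq_iff)
qed

lemma hilbert_tensor_vec_tensor:
  "hilbert_tensor (vec_tensor :: complex ^ 'n \<Rightarrow> complex ^ 'm \<Rightarrow> complex ^ 'm ^ 'n)"
  unfolding hilbert_tensor_def
proof (intro conjI allI)
  fix x x' :: "complex ^ 'n" and y y' :: "complex ^ 'm" and c
  show "vec_tensor (x + x') y = vec_tensor x y + vec_tensor x' y"
    by (simp add: vec_eq_iff vec_tensor_nth scaleC_add_left scaleC_nth scaleC_complex_def)
  show "vec_tensor x (y + y') = vec_tensor x y + vec_tensor x y'"
    by (simp add: vec_eq_iff vec_tensor_nth scaleC_nth scaleC_complex_def distrib_left)
  show "vec_tensor (c *\<^sub>C x) y = c *\<^sub>C vec_tensor x y" "vec_tensor x (c *\<^sub>C y) = c *\<^sub>C vec_tensor x y"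
    by (simp_all add: vec_eq_iff vec_tensor_nth scaleC_nth scaleC_complex_def mult_ac)
  show "cinner (vec_tensor x y) (vec_tensor x' y') = cinner x x' * cinner y y'"
    by (simp add: cinner_vec_tensor vec_tensor_nth cinner_simps cinner_vec_def[of x x']
        cinner_complex_def sum_distrib_right mult.assoc)
next
  let ?b = "unit_tensor :: 'n \<times> 'm \<Rightarrow> _"
  have "closure (cspan (range ?b)) = UNIV"
    using is_onb_finite[OF unit_tensor_orthonormal unit_tensor_expansion]
    unfolding is_onb_def by blast
  moreover have "cspan (range ?b) \<subseteq> cspan {vec_tensor x y | x y. True}"
    unfolding cspan_def by (rule span_mono) auto
  ultimately show "closure (cspan {vec_tensor x y :: complex ^ 'm ^ 'n | x y. True}) = UNIV"
    using closure_mono by blast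
qed

text \<open>The components of the adjoint are its inner products with the unit vectors, which can be
  written down from \<open>X\<close>.\<close>

lemma vec_adjoint_exists:
  fixes X :: "(complex ^ 'n) \<Rightarrow>\<^sub>L (complex ^ 'n)"
  assumes X: "X \<in> bounded_ops"
  shows "\<exists>Y\<in>bounded_ops. is_adjoint X Y"
proof -
  let ?f = "\<lambda>y. \<chi> k. cinner (X (unit_vec k)) y"
  have "linear ?f"
    by (rule linearI) (simp_all add: vec_eq_iff cinner_simps cinner.scaleR_right)
  then have f: "blinfun_apply (Blinfun ?f) = ?f"
    by (simp add: bounded_linear_Blinfun_apply linear_conv_bounded_linear)
  have "is_adjoint X (Blinfun ?f)"
    unfolding is_adjoint_def
  proof (intro allI)
    fix x y
    show "cinner (X x) y = cinner x (Blinfun ?f y)"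
      by (subst unit_vec_expansion[of x])
        (simp add: f blinfun.sum_right bounded_ops_scaleC[OF X] cinner_simps cinner_unit_vec
          cinner_vec_def[of x] cinner_complex_def)
  qed
  moreover have "Blinfun ?f \<in> bounded_ops"
    by (rule bounded_opsI) (simp add: f vec_eq_iff cinner_simps scaleC_nth scaleC_complex_def)
  ultimately show ?thesis by blast
qed

text \<open>Allows a CP-map to be checked on all bounded operators, without computing the tensor
  product algebra inside them. A normal state restricts with the same density operator.\<close>

lemma cp_map_subset:
  assumes T: "cp_map M N T" and sub: "M' \<subseteq> M"
  shows "cp_map M' N T"
  unfolding cp_map_def
proof (intro conjI ballI allI impI)
  show "completely_positive M' T"
    using T sub by (simp add: cp_map_def completely_positive_def subset_iff)
  fix \<phi> assume "normal_state N \<phi>"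
  then have "normal_state M (\<lambda>X. \<phi> (T X))" using T by (simp add: cp_map_def)
  then show "normal_state M' (\<lambda>X. \<phi> (T X))"
    using sub by (auto simp: normal_state_def)
qed (use T sub in \<open>auto simp: cp_map_def subset_iff\<close>)

lemma von_neumann_algebra_bounded_ops:
  "von_neumann_algebra (bounded_ops :: ((complex ^ 'n) \<Rightarrow>\<^sub>L (complex ^ 'n)) set)"
  unfolding von_neumann_algebra_def
  using vec_adjoint_exists subset_bicommutant[of bounded_ops] by (auto simp: commutant_def)

subsection \<open>A von Neumann measurement with imperfect pointer states\<close>

context
  fixes \<phi> :: "'n::finite \<Rightarrow> complex ^ 'm"
  assumes unit: "\<And>i. norm (\<phi> i) = 1"
begin

definition pointer_coupling :: "(complex ^ 'n) \<Rightarrow>\<^sub>L (complex ^ 'm ^ 'n)" where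
  "pointer_coupling = Blinfun (\<lambda>x. \<chi> i. (x $ i) *\<^sub>C \<phi> i)"

text \<open>Given by an explicit formula; \<open>pointer_coupling_adjoint\<close> identifies it as
  the adjoint of the coupling.\<close>

definition pointer_coupling_adj :: "(complex ^ 'm ^ 'n) \<Rightarrow>\<^sub>L (complex ^ 'n)" where
  "pointer_coupling_adj = Blinfun (\<lambda>u. \<chi> i. cinner (\<phi> i) (u $ i))"

text \<open>The Heisenberg picture X -> V* X V of the coupling isometry V. This is a Stinespring
  form, so complete positivity is immediate.\<close>

definition pointer_measurement ::
  "((complex ^ 'm ^ 'n) \<Rightarrow>\<^sub>L (complex ^ 'm ^ 'n)) \<Rightarrow> ((complex ^ 'n) \<Rightarrow>\<^sub>L (complex ^ 'n))" where
  "pointer_measurement X = pointer_coupling_adj o\<^sub>L X o\<^sub>L pointer_coupling"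

lemma pointer_coupling_apply: "pointer_coupling x = (\<chi> i. (x $ i) *\<^sub>C \<phi> i)"
proof -
  have "linear (\<lambda>x. \<chi> i. (x $ i) *\<^sub>C \<phi> i)"
    by (rule linearI) (simp_all add: vec_eq_iff scaleC_add_left scaleC.scaleR_left)
  then show ?thesis
    by (simp add: pointer_coupling_def bounded_linear_Blinfun_apply linear_conv_bounded_linear)
qed

lemma pointer_coupling_nth: "pointer_coupling x $ i = (x $ i) *\<^sub>C \<phi> i"
  by (simp add: pointer_coupling_apply)

lemma pointer_coupling_adj_apply: "pointer_coupling_adj u = (\<chi> i. cinner (\<phi> i) (u $ i))"
proof -
  have "linear (\<lambda>u :: complex ^ 'm ^ 'n. \<chi> i. cinner (\<phi> i) (u $ i))"
    by (rule linearI) (simp_all add: vec_eq_iff cinner_simps cinner.scaleR_right)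
  then show ?thesis
    by (simp add: pointer_coupling_adj_def bounded_linear_Blinfun_apply linear_conv_bounded_linear)
qed

lemma pointer_coupling_scaleC: "pointer_coupling (c *\<^sub>C x) = c *\<^sub>C pointer_coupling x"
  by (simp add: pointer_coupling_nth vec_eq_iff scaleC_nth scaleC_complex_def mult.assoc)

lemma pointer_coupling_adj_scaleC: "pointer_coupling_adj (c *\<^sub>C x) = c *\<^sub>C pointer_coupling_adj x"
  by (simp add: pointer_coupling_adj_apply vec_eq_iff scaleC_nth
      scaleC_complex_def cinner_simps)

lemma pointer_coupling_adjoint: "cinner (pointer_coupling x) u = cinner x (pointer_coupling_adj u)"
  by (simp add: cinner_vec_def[of x] cinner_vec_def[of "pointer_coupling x"] pointer_coupling_nth
      pointer_coupling_adj_apply cinner_complex_def cinner_simps)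

lemma pointer_coupling_isometry: "pointer_coupling_adj (pointer_coupling x) = x"
  by (simp add: vec_eq_iff pointer_coupling_nth pointer_coupling_adj_apply cinner_simps cinner_self unit)

lemma pointer_coupling_unit_vec: "pointer_coupling (unit_vec i) = vec_tensor (unit_vec i) (\<phi> i)"
  by (auto simp: vec_eq_iff pointer_coupling_nth vec_tensor_nth unit_vec_nth)

lemma cinner_pointer_measurement:
  "cinner x (pointer_measurement X y) = cinner (pointer_coupling x) (X (pointer_coupling y))"
  by (simp add: pointer_measurement_def pointer_coupling_adjoint)

lemma pointer_measurement_bounded_ops:
  "X \<in> bounded_ops \<Longrightarrow> pointer_measurement X \<in> bounded_ops"
  by (rule bounded_opsI)
    (simp add: pointer_measurement_def pointer_coupling_scaleC pointer_coupling_adj_scaleC bounded_ops_scaleC)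

text \<open>With \<open>Y\<close> the identity, the reduced map is entrywise multiplication by the
  Gram matrix of the pointer states; with \<open>X\<close> the identity, the diagonal contains the
  pointer statistics.\<close>

lemma pointer_measurement_tensor:
  assumes "X \<in> bounded_ops" "Y \<in> bounded_ops"
  shows "cinner (unit_vec i) (pointer_measurement (op_tensor vec_tensor X Y) (unit_vec j)) =
    cinner (unit_vec i) (X (unit_vec j)) * cinner (\<phi> i) (Y (\<phi> j))"
  by (simp add: cinner_pointer_measurement pointer_coupling_unit_vec
      op_tensor_apply[OF hilbert_tensor_vec_tensor assms] hilbert_tensorD(5)[OF hilbert_tensor_vec_tensor])

lemma pointer_measurement_normal:
  assumes \<phi>': "normal_state bounded_ops \<phi>'"
  shows "normal_state bounded_ops (\<lambda>X. \<phi>' (pointer_measurement X))"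
proof -
  from \<phi>' obtain \<rho> where \<rho>: "density_op \<rho>" and \<rho>': "\<And>X. X \<in> bounded_ops \<Longrightarrow> \<phi>' X = density_state \<rho> X"
    by (auto simp: normal_state_def)
  have pos: "positive_op \<rho>" and tr: "op_trace \<rho> = 1" using \<rho> by (auto simp: density_op_def)
  note \<rho>B = positive_opD(1)[OF pos]
  \<comment> \<open>Cyclicity of the trace moves V and V* around \<rho>, so the pulled-back state
    has density V \<rho> V*. Its trace is 1 because V is an isometry.\<close>
  define \<sigma> where "\<sigma> = pointer_coupling o\<^sub>L \<rho> o\<^sub>L pointer_coupling_adj"
  note scaleC_rules = pointer_coupling_scaleC pointer_coupling_adj_scaleC bounded_ops_scaleC
  have \<sigma>B: "\<sigma> \<in> bounded_ops"
    by (rule bounded_opsI) (simp add: \<sigma>_def scaleC_rules \<rho>B)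
  have trace: "op_trace (\<sigma> o\<^sub>L X) = op_trace (\<rho> o\<^sub>L pointer_measurement X)" if X: "X \<in> bounded_ops" for X
  proof -
    let ?F = "\<rho> o\<^sub>L pointer_coupling_adj o\<^sub>L X"
    have "op_trace (\<sigma> o\<^sub>L X) = (\<Sum>p\<in>UNIV. cinner (unit_tensor p) (pointer_coupling (?F (unit_tensor p))))"
      by (subst op_trace_finite[OF unit_tensor_orthonormal unit_tensor_expansion])
        (simp_all add: \<sigma>B X bounded_ops_compose, simp add: \<sigma>_def)
    also have "\<dots> = (\<Sum>j\<in>UNIV. cinner (unit_vec j) (?F (pointer_coupling (unit_vec j))))"
      by (rule trace_cyclic[OF unit_vec_expansion unit_tensor_expansion])
        (simp_all add: scaleC_rules \<rho>B X)
    also have "\<dots> = op_trace (\<rho> o\<^sub>L pointer_measurement X)"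
      by (subst op_trace_finite[OF unit_vec_orthonormal unit_vec_expansion])
        (simp_all add: bounded_ops_compose \<rho>B pointer_measurement_bounded_ops[OF X],
          simp add: pointer_measurement_def)
    finally show ?thesis .
  qed
  have "positive_op \<sigma>"
    unfolding positive_op_def
  proof (intro conjI allI \<sigma>B)
    fix u
    have "cinner u (\<sigma> u) = cinner (pointer_coupling_adj u) (\<rho> (pointer_coupling_adj u))"
      by (metis (no_types) \<sigma>_def blinfun_apply_blinfun_compose cinner_commute pointer_coupling_adjoint)
    then show "cinner u (\<sigma> u) \<in> \<real>\<^sub>\<ge>\<^sub>0" using positive_opD(2)[OF pos] by simp
  qed
  moreover have "op_trace \<sigma> = 1"
  proof -
    have "pointer_measurement id_blinfun = id_blinfun" "\<rho> o\<^sub>L id_blinfun = \<rho>" "\<sigma> o\<^sub>L id_blinfun = \<sigma>"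
      by (auto intro!: blinfun_eqI simp: pointer_measurement_def pointer_coupling_isometry)
    then show ?thesis using trace[OF bounded_ops_id] tr by simp
  qed
  ultimately have "density_op \<sigma>" by (simp add: density_op_def)
  moreover have "\<phi>' (pointer_measurement X) = density_state \<sigma> X" if "X \<in> bounded_ops" for X
    using trace[OF that] \<rho>'[OF pointer_measurement_bounded_ops[OF that]] by (simp add: density_state_def)
  ultimately show ?thesis by (auto simp: normal_state_def)
qed

lemma pointer_measurement_cp: "cp_map bounded_ops bounded_ops pointer_measurement"
  unfolding cp_map_def
proof (intro conjI ballI allI impI)
  fix X Y :: "(complex ^ 'm ^ 'n) \<Rightarrow>\<^sub>L (complex ^ 'm ^ 'n)" and c
  show "pointer_measurement (X + Y) = pointer_measurement X + pointer_measurement Y"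
    by (rule blinfun_eqI) (simp add: pointer_measurement_def blinfun.add_left blinfun.add_right)
  show "pointer_measurement (scaleC_op c X) = scaleC_op c (pointer_measurement X)"
    by (rule blinfun_eqI)
      (simp add: pointer_measurement_def scaleC_op.rep_eq pointer_coupling_adj_scaleC)
  show "pointer_measurement id_blinfun = id_blinfun"
    by (rule blinfun_eqI) (simp add: pointer_measurement_def pointer_coupling_isometry)
  show "completely_positive bounded_ops pointer_measurement"
    by (auto simp: completely_positive_def positive_matrix_def cinner_pointer_measurement)
qed (auto intro: pointer_measurement_bounded_ops pointer_measurement_normal)

text \<open>Diagonal elements are multiplied by the inner product of a unit pointer vector with
  itself, hence unchanged.\<close>

lemma pointer_measurement_nondestructive:
  assumes A: "hermitean A" "\<And>i. blinfun_apply A (unit_vec i) = a i *\<^sub>R unit_vec i" and B: "hermitean B"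
  shows "nondestructive_measurement vec_tensor bounded_ops pointer_measurement A B unit_vec a"
proof
  show "hilbert_tensor (vec_tensor :: complex ^ 'n \<Rightarrow> complex ^ 'm \<Rightarrow> _)"
    by (rule hilbert_tensor_vec_tensor)
  have sub: "algebra_tensor vec_tensor bounded_ops bounded_ops \<subseteq> bounded_ops"
    by (auto simp: algebra_tensor_def commutant_def)
  show "cp_map (algebra_tensor vec_tensor bounded_ops bounded_ops) bounded_ops pointer_measurement"
    by (rule cp_map_subset[OF pointer_measurement_cp sub])
  fix i and X :: "(complex ^ 'n) \<Rightarrow>\<^sub>L (complex ^ 'n)"
  assume X: "X \<in> bounded_ops"
  have RX: "reduced_map vec_tensor pointer_measurement X \<in> bounded_ops"
    unfolding reduced_map_def
    by (intro pointer_measurement_bounded_ops op_tensor_bounded_ops hilbert_tensor_vec_tensor X bounded_ops_id)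
  show "pullback (reduced_map vec_tensor pointer_measurement) (density_state (ketbra (unit_vec i))) X =
      density_state (ketbra (unit_vec i)) X"
    using pointer_measurement_tensor[OF X bounded_ops_id, of i i]
    by (simp add: pullback_def density_state_ketbra[OF is_onb_unit_vec] RX X)
      (simp add: reduced_map_def cinner_self unit)
qed (use A B in \<open>auto simp: von_neumann_algebra_bounded_ops inj_unit_vec is_onb_unit_vec hermitean_def\<close>)

end

subsection \<open>Sharpness\<close>

text \<open>For either basis state the wrong pointer value has probability \<delta>. All amplitudes
  are nonnegative, so both terms of the overlap add up.\<close>

definition sharp_pointer :: "real \<Rightarrow> 2 \<Rightarrow> complex ^ 2" where
  "sharp_pointer \<delta> i = (\<chi> k. complex_of_real (if k = i then sqrt (1 - \<delta>) else sqrt \<delta>))"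

context
  fixes \<delta> :: real
  assumes \<delta>: "0 \<le> \<delta>" "\<delta> \<le> 1 / 2"
begin

lemma norm_sharp_pointer: "norm (sharp_pointer \<delta> i) = 1"
proof -
  have "(norm (sharp_pointer \<delta> i))\<^sup>2 = 1"
    using \<delta> exhaust_2[of i]
    by (auto simp: Re_cinner_self[symmetric] cinner_vec_def cinner_complex_def sharp_pointer_def sum_2)
  then show ?thesis by (simp add: power2_eq_1_iff) (use norm_ge_zero[of "sharp_pointer \<delta> i"] in linarith)
qed

lemma cinner_sharp_pointer: "cinner (sharp_pointer \<delta> 1) (sharp_pointer \<delta> 2) = 2 * sqrt (\<delta> * (1 - \<delta>))"
  by (simp add: cinner_vec_def cinner_complex_def sharp_pointer_def sum_2 real_sqrt_mult)

abbreviation "T\<delta> \<equiv> pointer_measurement (sharp_pointer \<delta>)"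

lemma sharp_infidelity:
  assumes A: "A \<in> bounded_ops" "hermitean A"
    "\<And>i::2. blinfun_apply A (unit_vec i) = of_bool (i = 1) *\<^sub>R unit_vec i"
  shows "measurement_infidelity vec_tensor T\<delta> A A = \<delta>"
proof -
  note basis = inj_unit_vec is_onb_unit_vec
  \<comment> \<open>The inner \<open>of_bool\<close> is the eigenvalue, 1 or 0; the outer one tests
    its membership in \<open>S\<close>.\<close>
  obtain E where E: "spectral_measure A E"
    "\<And>S i. blinfun_apply (E S) (unit_vec i) = of_bool (of_bool (i = (1::2)) \<in> S) *\<^sub>R unit_vec i"
    using eigenbasis_spectral_measure[OF basis A(1), of "\<lambda>i. of_bool (i = 1)"] A(3) by blast
  have P: "spectral_projection A S = E S" if "S \<in> sets borel" for S
    by (rule spectral_projection_eq[OF A(2) E(1) that])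
  have EB: "E S \<in> bounded_ops" if "S \<in> sets borel" for S
    by (rule projection_opD(1)[OF pvm_projection[OF spectral_measure_pvm[OF A(1) E(1)] that]])
  define D where "D S = T\<delta> (op_tensor vec_tensor id_blinfun (E S)) - E S" for S
  \<comment> \<open>The deviation \<open>D S\<close> turns out to be diagonal with these entries:
    \<delta> up to sign if \<open>S\<close> contains exactly one of 0 and 1, and 0
    otherwise.\<close>
  define d where "d S i = (if i = (1::2) then 1 else - 1) * \<delta> * (of_bool (0 \<in> S) - of_bool (1 \<in> S))"
    for S :: "real set" and i
  have ES: "cinner (sharp_pointer \<delta> i) (E S (sharp_pointer \<delta> i)) =
      d S i + of_bool (of_bool (i = 1) \<in> S)" if S: "S \<in> sets borel" for S i
  proof -
    have "E S (sharp_pointer \<delta> i) = (\<chi> k. of_bool (of_bool (k = 1) \<in> S) * sharp_pointer \<delta> i $ k)"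
      by (subst unit_vec_expansion[of "sharp_pointer \<delta> i"])
        (simp add: blinfun.add_right bounded_ops_scaleC[OF EB[OF S]] E(2) sum_2 cinner_unit_vec
          vec_eq_iff forall_2 scaleC_nth scaleC_complex_def unit_vec_nth)
    then show ?thesis
      using \<delta> exhaust_2[of i]
      by (auto simp: cinner_vec_def cinner_complex_def sharp_pointer_def sum_2 d_def
          complex_eq_iff algebra_simps)
  qed
  have DB: "D S \<in> bounded_ops" if "S \<in> sets borel" for S
    unfolding D_def
    by (intro bounded_ops_diff pointer_measurement_bounded_ops[OF norm_sharp_pointer] op_tensor_bounded_ops
        hilbert_tensor_vec_tensor bounded_ops_id EB that)
  have D: "D S (unit_vec i) = d S i *\<^sub>R unit_vec i" if S: "S \<in> sets borel" for S i
  proof -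
    have "cinner (unit_vec k) (D S (unit_vec i)) = cinner (unit_vec k) (d S i *\<^sub>R unit_vec i)" for k
      using ES[OF S, of i]
        pointer_measurement_tensor[where \<phi>="sharp_pointer \<delta>" and i=k and j=i,
          OF norm_sharp_pointer bounded_ops_id EB[OF S]]
      by (simp add: D_def blinfun.diff_left cinner_simps E(2) cinner_scaleR_right unit_vec_orthonormal)
    then show ?thesis by (simp add: cinner_unit_vec vec_eq_iff)
  qed
  have norm_le: "norm (D S) \<le> \<delta>" if S: "S \<in> sets borel" for S
  proof (rule norm_blinfun_bound)
    fix x
    have "D S x = (\<Sum>i\<in>UNIV. (x $ i * d S i) *\<^sub>C unit_vec i)"
      by (subst unit_vec_expansion[of x])
        (simp add: blinfun.sum_right bounded_ops_scaleC[OF DB[OF S]] D[OF S] cinner_unit_vec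
          scaleR_scaleC scaleC_scaleC)
    then have "(norm (D S x))\<^sup>2 = (\<Sum>i\<in>UNIV. (cmod (x $ i))\<^sup>2 * (d S i)\<^sup>2)"
      by (simp add: norm_eigenbasis_sum[OF basis] norm_mult power_mult_distrib)
    also have "\<dots> \<le> (\<Sum>i\<in>UNIV. (cmod (x $ i))\<^sup>2 * \<delta>\<^sup>2)"
      by (intro sum_mono mult_left_mono) (auto simp: d_def)
    also have "\<dots> = (\<delta> * norm x)\<^sup>2"
      by (simp add: power_mult_distrib norm_vec_def L2_set_def sum_nonneg sum_distrib_left mult.commute)
    finally show "norm (D S x) \<le> \<delta> * norm x"
      by (rule power2_le_imp_le) (use \<delta> in simp)
  qed (use \<delta> in simp)
  \<comment> \<open>The set \<open>{1}\<close> separates the two eigenvalues, so the supremum is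
    attained there.\<close>
  have "\<delta> \<le> norm (D {1})"
    using norm_blinfun[of "D {1}" "unit_vec 1"] D[of "{1}" 1] \<delta>
    by (simp add: d_def eigenbasis_norm[OF basis])
  then have attained: "norm (D {1}) = \<delta>" using norm_le[of "{1}"] by simp
  have "measurement_infidelity vec_tensor T\<delta> A A = (SUP S\<in>sets borel. norm (D S))"
    unfolding measurement_infidelity_def by (intro SUP_cong refl) (simp add: P D_def)
  also have "\<dots> = \<delta>"
    by (rule cSup_eq_maximum) (use norm_le attained in \<open>auto intro!: image_eqI[of _ _ "{1}"]\<close>)
  finally show ?thesis .
qed

lemma sharp_example:
  "\<exists>(tens :: complex^2 \<Rightarrow> complex^2 \<Rightarrow> complex^2^2) \<B> T A B (\<psi> :: 2 \<Rightarrow> complex^2) a i j \<alpha> \<beta>.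
    nondestructive_measurement tens \<B> T A B \<psi> a \<and> a i \<noteq> a j \<and> (cmod \<alpha>)\<^sup>2 + (cmod \<beta>)\<^sup>2 = 1 \<and>
    measurement_infidelity tens T A B = \<delta> \<and>
    trace_distance (pullback (reduced_map tens T) (density_state (coherent_op \<psi> i j \<alpha> \<beta>)))
      (density_state (incoherent_op \<psi> i j \<alpha> \<beta>)) = sqrt (\<delta> * (1 - \<delta>))"
proof -
  note basis = inj_unit_vec is_onb_unit_vec
  obtain A where diag: "A \<in> bounded_ops"
    "\<And>i::2. blinfun_apply A (unit_vec i) = of_bool (i = 1) *\<^sub>R unit_vec i"
    using diagonal_op_exists[OF basis, of "\<lambda>i. of_bool (i = 1)" 1] by auto
  have herm: "hermitean A"
    using eigenbasis_projection[OF basis diag] by (simp add: projection_op_def)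
  interpret nondestructive_measurement vec_tensor bounded_ops T\<delta> A A unit_vec "\<lambda>i. of_bool (i = 1)"
    by (rule pointer_measurement_nondestructive[OF norm_sharp_pointer herm diag(2) herm])
  note infidelity = sharp_infidelity[OF diag(1) herm diag(2)]
  \<comment> \<open>Equal amplitudes turn 2 |\<alpha>| |\<beta>| \<le> 1 into an equality.\<close>
  define r where "r = complex_of_real (1 / sqrt 2)"
  have "r * r = complex_of_real (1 / sqrt 2 * (1 / sqrt 2))"
    by (simp only: r_def of_real_mult)
  also have "1 / sqrt 2 * (1 / sqrt 2) = 1 / 2" by simp
  finally have r: "(cmod r)\<^sup>2 = 1 / 2" "cnj r = r" "r * r = 1 / 2"
    by (simp_all add: r_def norm_divide power_divide)
  \<comment> \<open>The optimal test projection is the coherent state itself: its off-diagonal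
    element 1/2 times the pointer overlap is the claimed value.\<close>
  define w :: "complex ^ 2" where "w = r *\<^sub>C unit_vec 1 + r *\<^sub>C unit_vec 2"
  have w: "w $ 1 = r" "w $ 2 = r" by (simp_all add: w_def scaleC_nth scaleC_complex_def unit_vec_nth)
  have "(norm w)\<^sup>2 = 1"
    by (simp add: Re_cinner_self[symmetric] cinner_vec_def cinner_complex_def sum_2 w r)
  then have "norm w = 1"
    by (simp add: power2_eq_1_iff) (use norm_ge_zero[of w] in linarith)
  then have p: "projection_op (ketbra w)" by (rule projection_op_ketbra)
  let ?\<rho> = "pullback (reduced_map vec_tensor T\<delta>) (density_state (coherent_op unit_vec 1 2 r r))"
  let ?\<sigma> = "density_state (incoherent_op unit_vec (1::2) 2 r r)"
  have rr: "(cmod r)\<^sup>2 + (cmod r)\<^sup>2 = 1" by (simp add: r)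
  have le: "Re (?\<rho> P) - Re (?\<sigma> P) \<le> sqrt (\<delta> * (1 - \<delta>))" if "projection_op P" for P
    by (rule state_difference_le[OF that _ rr infidelity[symmetric] \<delta>]) simp
  have "cinner (unit_vec 1) (ketbra w (unit_vec 2)) = 1 / 2"
    by (simp add: ketbra_apply cinner_simps cinner_unit_vec w r cinner_commute[of w "unit_vec 2"])
  then have "cinner (unit_vec 1) (reduced_map vec_tensor T\<delta> (ketbra w) (unit_vec 2)) = sqrt (\<delta> * (1 - \<delta>))"
    unfolding reduced_map_def
    by (subst pointer_measurement_tensor[OF norm_sharp_pointer projection_opD(1)[OF p] bounded_ops_id])
      (simp add: cinner_sharp_pointer)
  then have eq: "Re (?\<rho> (ketbra w)) - Re (?\<sigma> (ketbra w)) = sqrt (\<delta> * (1 - \<delta>))"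
    by (subst state_difference[OF p]) (simp_all add: r)
  have "trace_distance ?\<rho> ?\<sigma> = sqrt (\<delta> * (1 - \<delta>))"
    unfolding trace_distance_def
    by (rule cSup_eq_maximum) (use p le eq in \<open>auto intro!: image_eqI[of _ _ "ketbra w"]\<close>)
  then show ?thesis
    using nondestructive_measurement_axioms infidelity rr
    by (intro exI[of _ vec_tensor] exI[of _ bounded_ops] exI[of _ T\<delta>] exI[of _ A] exI[of _ unit_vec]
      exI[of _ "\<lambda>i. of_bool (i = 1)"] exI[of _ 1] exI[of _ 2] exI[of _ r] conjI) simp_all
qed

end

theorem mainTheorem9:
  shows
  "(\<forall>(tens :: 'h::chilbert_space \<Rightarrow> 'k::chilbert_space \<Rightarrow> 'l::chilbert_space) \<B> T A B
      (\<psi> :: 'i \<Rightarrow> 'h) a i j \<alpha> \<beta> \<delta>.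
      nondestructive_measurement tens \<B> T A B \<psi> a \<longrightarrow>
      a i \<noteq> a j \<longrightarrow>
      (cmod \<alpha>)\<^sup>2 + (cmod \<beta>)\<^sup>2 = 1 \<longrightarrow>
      \<delta> = measurement_infidelity tens T A B \<longrightarrow>
      \<delta> \<in> {0..1/2} \<longrightarrow>
      trace_distance
        (pullback (reduced_map tens T) (density_state (coherent_op \<psi> i j \<alpha> \<beta>)))
        (density_state (incoherent_op \<psi> i j \<alpha> \<beta>))
      \<le> sqrt (\<delta> * (1 - \<delta>)))
   \<and>
   (\<forall>\<delta>\<in>{0..1/2}.
      \<exists>(tens :: complex^2 \<Rightarrow> complex^2 \<Rightarrow> complex^2^2) \<B> T A B
        (\<psi> :: 2 \<Rightarrow> complex^2) a i j \<alpha> \<beta>.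
        nondestructive_measurement tens \<B> T A B \<psi> a \<and>
        a i \<noteq> a j \<and>
        (cmod \<alpha>)\<^sup>2 + (cmod \<beta>)\<^sup>2 = 1 \<and>
        measurement_infidelity tens T A B = \<delta> \<and>
        trace_distance
          (pullback (reduced_map tens T) (density_state (coherent_op \<psi> i j \<alpha> \<beta>)))
          (density_state (incoherent_op \<psi> i j \<alpha> \<beta>))
        = sqrt (\<delta> * (1 - \<delta>)))"
proof (intro conjI allI impI ballI)
  fix tens :: "'h \<Rightarrow> 'k \<Rightarrow> 'l" and \<B> T A B and \<psi> :: "'i \<Rightarrow> 'h" and a i j \<alpha> \<beta> and \<delta> :: real
  assume "nondestructive_measurement tens \<B> T A B \<psi> a" "a i \<noteq> a j" "(cmod \<alpha>)\<^sup>2 + (cmod \<beta>)\<^sup>2 = 1"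
    "\<delta> = measurement_infidelity tens T A B" "\<delta> \<in> {0..1/2}"
  then show "trace_distance (pullback (reduced_map tens T) (density_state (coherent_op \<psi> i j \<alpha> \<beta>)))
      (density_state (incoherent_op \<psi> i j \<alpha> \<beta>)) \<le> sqrt (\<delta> * (1 - \<delta>))"
    by (intro nondestructive_measurement.trace_distance_le) auto
qed (rule sharp_example; simp)

end
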